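(* Let $T$ be a polygonal trajectory with $n$ vertices and $s>0$ a fixed side length. After $O(n)$ preprocessing, time-windowed hotspot queries can be answered with time complexity $O(\log^2 n)$: each query is given by two times $x<y$ (which need not coincide with time-stamps of vertices of $T$), and the algorithm returns an axis-parallel square of side length $s$ whose weight with respect to $T_{xy}$ is at least half of the weight of a hotspot of $T_{xy}$.
   Context: A polygonal trajectory $T$ is given by a sequence of vertices; each vertex has a location in $\mathbb{R}^2$ and a time-stamp, with time-stamps strictly increasing; the position $T(t)$ at intermediate times is obtained by linear interpolation between consecutive vertices. For times $a<b$ within the time span of $T$, $T_{ab}$ denotes the sub-trajectory from time $a$ to time $b$. All squares are axis-parallel with fixed side length $s$. The weight of a square $r$ with respect to a trajectory $T'$ is the maximum duration of a contiguous sub-trajectory of $T'$ contained in $r$. A hotspot of $T'$ is a square of maximum weight with respect to $T'$. *)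

theory Defs
  imports "HOL-Analysis.Analysis"
begin

type_synonym point = "real \<times> real"
type_synonym trajectory = "(point \<times> real) list"

definition valid_traj :: "trajectory \<Rightarrow> bool" where
  "valid_traj V \<longleftrightarrow> V \<noteq> [] \<and> sorted_wrt (<) (map snd V)"

definition t_start :: "trajectory \<Rightarrow> real" where
  "t_start V = snd (hd V)"

definition t_end :: "trajectory \<Rightarrow> real" where
  "t_end V = snd (last V)"

text \<open>Position T(t) by linear interpolation between consecutive vertices
  (for t in the time span of T; the segment index is chosen as the least
  one whose time interval contains t; at shared endpoints both agree).\<close>
definition traj_pos :: "trajectory \<Rightarrow> real \<Rightarrow> point" where
  "traj_pos V t =
     (if length V = 1 then fst (hd V)
      else (let i = (LEAST i. i + 1 < length V \<and> snd (V!i) \<le> t \<and> t \<le> snd (V!(i+1)));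
                p = fst (V!i); q = fst (V!(i+1)); a = snd (V!i); b = snd (V!(i+1))
            in p + ((t - a) / (b - a)) *\<^sub>R (q - p)))"

definition square :: "real \<Rightarrow> point \<Rightarrow> point set" where
  "square s c = {q. fst c \<le> fst q \<and> fst q \<le> fst c + s \<and> snd c \<le> snd q \<and> snd q \<le> snd c + s}"

definition weight :: "trajectory \<Rightarrow> real \<Rightarrow> real \<Rightarrow> point set \<Rightarrow> real" where
  "weight V x y r =
     Sup (insert 0 {b - a | a b. x \<le> a \<and> a \<le> b \<and> b \<le> y \<and> (\<forall>t\<in>{a..b}. traj_pos V t \<in> r)})"

definition hotspot_weight :: "real \<Rightarrow> trajectory \<Rightarrow> real \<Rightarrow> real \<Rightarrow> real" where
  "hotspot_weight s V x y = (SUP c\<in>UNIV. weight V x y (square s c))"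

datatype aop = AAdd | ASub | AMul | ADiv

datatype instr =
    Const nat real
  | Arith aop nat nat nat
  | Load nat nat
  | Store nat nat
  | JumpLe nat nat nat
  | Jump nat
  | Halt

type_synonym mem = "nat \<Rightarrow> real"
type_synonym config = "nat \<times> mem"

fun aop_eval :: "aop \<Rightarrow> real \<Rightarrow> real \<Rightarrow> real" where
  "aop_eval AAdd a b = a + b"
| "aop_eval ASub a b = a - b"
| "aop_eval AMul a b = a * b"
| "aop_eval ADiv a b = a / b"

fun exec_instr :: "instr \<Rightarrow> config \<Rightarrow> config" where
  "exec_instr (Const i c) (pc, m) = (Suc pc, m(i := c))"
| "exec_instr (Arith f i j k) (pc, m) = (Suc pc, m(i := aop_eval f (m j) (m k)))"
| "exec_instr (Load i j) (pc, m) = (Suc pc, m(i := m (nat \<lfloor>m j\<rfloor>)))"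
| "exec_instr (Store i j) (pc, m) = (Suc pc, m(nat \<lfloor>m i\<rfloor> := m j))"
| "exec_instr (JumpLe j k l) (pc, m) = (if m j \<le> m k then (l, m) else (Suc pc, m))"
| "exec_instr (Jump l) (pc, m) = (l, m)"
| "exec_instr Halt (pc, m) = (pc, m)"

definition step :: "instr list \<Rightarrow> config \<Rightarrow> config" where
  "step P cf = (if fst cf < length P then exec_instr (P ! fst cf) cf else cf)"

definition halts_within :: "instr list \<Rightarrow> real \<Rightarrow> mem \<Rightarrow> mem \<Rightarrow> bool" where
  "halts_within P t m m' \<longleftrightarrow>
     (\<exists>k. real k \<le> t \<and> fst ((step P ^^ k) (0, m)) < length P \<and>
          P ! fst ((step P ^^ k) (0, m)) = Halt \<and> snd ((step P ^^ k) (0, m)) = m')"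

definition encode_traj :: "trajectory \<Rightarrow> mem" where
  "encode_traj V a =
     (if a = 0 then real (length V)
      else if a \<le> 3 * length V then
        (let i = (a - 1) div 3; k = (a - 1) mod 3; v = V ! i in
           if k = 0 then fst (fst v) else if k = 1 then snd (fst v) else snd v)
      else 0)"

end

theory Submission
  imports Defs "HOL-Library.Discrete_Functions"
begin

text \<open>The time span is cut greedily: a piece starting at \<open>a\<close> runs until the last time \<open>F a\<close> for which the
  positions on \<open>[a, F a]\<close> fit into a square. If both \<open>a\<close> and \<open>F a\<close> lie on the same edge, the rest of that
  edge is taken as one record, on which every interval not longer than a fixed cap fits into a square. So there are
  at most two records per edge. An interval that starts before a cut and fits into a square ends before
  the next cut but one, hence meets at most two records, and half of it lies in one of them. A query
  therefore only needs the largest cap among the records inside the window, and the clipped records at its ends.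
  Both are found in logarithmically many steps by one walk along skew-binary jump pointers, which are built in a single
  pass and carry the index of the best record they skip.\<close>

section \<open>A compiler from expressions and loops to machine code\<close>

text \<open>Greedy cuts alone would not give linear preprocessing: one long edge can need
  arbitrarily many squares, so the number of pieces would depend on distances and not on
  \<open>n\<close>. This is why the rest of an edge is kept as a single record. The motion there is
  uniform, so a suitable square for an interval starting at \<open>u\<close> is a fixed corner
  translated linearly in \<open>u\<close>; hence a record stores a velocity. The factor 2 is the
  price for looking only at intervals inside one record. The maximum over a range of caps must be
  prepared in linear time by a machine that only has real arithmetic and comparisons. Tables for all
  powers of two would take \<open>n log n\<close>; skew-binary pointers arise from subtractions and
  comparisons alone, and a walk along them is logarithmic, which stays below the required squared
  logarithm. The programs are fixed while the input fills memory from cell 0 on. They are generated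
  by a small compiler that is verified together with a cost semantics, so that the algorithmic part
  only deals with states, invariants and numbers of iterations.\<close>

definition runs :: "instr list \<Rightarrow> nat \<Rightarrow> nat \<Rightarrow> mem \<Rightarrow> nat \<Rightarrow> mem \<Rightarrow> bool" where
  "runs P t pc m pc' m' \<longleftrightarrow> (\<exists>k\<le>t. (step P ^^ k) (pc, m) = (pc', m'))"

lemma runs_refl: "runs P t pc m pc m"
  unfolding runs_def by (rule exI[of _ 0]) simp

lemma runs_mono: "runs P t pc m pc' m' \<Longrightarrow> t \<le> u \<Longrightarrow> runs P u pc m pc' m'"
  unfolding runs_def by (meson le_trans)

lemma runs_trans:
  assumes "runs P t pc m pc1 m1" "runs P u pc1 m1 pc2 m2"
  shows "runs P (t + u) pc m pc2 m2"
proof -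
  obtain j k where "j \<le> t" "k \<le> u" "(step P ^^ j) (pc, m) = (pc1, m1)"
    "(step P ^^ k) (pc1, m1) = (pc2, m2)"
    using assms unfolding runs_def by blast
  then have "(step P ^^ (k + j)) (pc, m) = (pc2, m2)" "k + j \<le> t + u"
    by (simp_all add: funpow_add)
  then show ?thesis unfolding runs_def by blast
qed

text \<open>Jump targets are absolute, so generated code depends on its position and is always
  considered inside a complete program \<open>P\<close>.\<close>

definition code_at :: "instr list \<Rightarrow> nat \<Rightarrow> instr list \<Rightarrow> bool" where
  "code_at P pc xs \<longleftrightarrow> (\<exists>us vs. P = us @ xs @ vs \<and> length us = pc)"

lemma code_at_Nil [simp]: "code_at P pc [] \<longleftrightarrow> pc \<le> length P"
proof
  assume "pc \<le> length P"
  then show "code_at P pc []" unfolding code_at_def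
    by (intro exI[of _ "take pc P"] exI[of _ "drop pc P"]) simp
qed (auto simp: code_at_def)

lemma code_at_append:
  "code_at P pc (xs @ ys) \<longleftrightarrow> code_at P pc xs \<and> code_at P (pc + length xs) ys" (is "?L \<longleftrightarrow> ?R")
proof
  assume ?L
  then obtain us vs where "P = us @ (xs @ ys) @ vs" "length us = pc" unfolding code_at_def by blast
  then have "P = us @ xs @ (ys @ vs)" "P = (us @ xs) @ ys @ vs" "length (us @ xs) = pc + length xs" by auto
  then show ?R unfolding code_at_def using \<open>length us = pc\<close> by blast
next
  assume ?R
  then obtain us vs us' vs' where *: "P = us @ xs @ vs" "length us = pc"
    "P = us' @ ys @ vs'" "length us' = pc + length xs" unfolding code_at_def by blast
  then have "us @ xs = us'" "vs = ys @ vs'"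
    by (metis append.assoc append_eq_append_conv length_append)+
  then show ?L unfolding code_at_def using * by (metis append.assoc)
qed

lemma code_at_Cons:
  "code_at P pc (x # xs) \<longleftrightarrow> pc < length P \<and> P ! pc = x \<and> code_at P (Suc pc) xs"
proof -
  have "code_at P pc [x] \<longleftrightarrow> pc < length P \<and> P ! pc = x"
  proof
    assume "pc < length P \<and> P ! pc = x"
    then show "code_at P pc [x]" unfolding code_at_def
      by (intro exI[of _ "take pc P"] exI[of _ "drop (Suc pc) P"]) (auto simp: id_take_nth_drop[symmetric])
  qed (auto simp: code_at_def)
  then show ?thesis using code_at_append[of P pc "[x]" xs] by simp
qed

lemma runs_step:
  assumes "pc < length P" "exec_instr (P ! pc) (pc, m) = (pc1, m1)" "runs P t pc1 m1 pc2 m2"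
  shows "runs P (Suc t) pc m pc2 m2"
proof -
  have "runs P 1 pc m pc1 m1" unfolding runs_def using assms(1,2)
    by (intro exI[of _ 1]) (simp add: step_def)
  from runs_trans[OF this assms(3)] show ?thesis by simp
qed

section \<open>Expressions, evaluated on a stack of scratch cells\<close>

datatype exp = Rg nat | Cst real | Op aop exp exp | Mm exp | Ite exp exp exp exp

fun ev :: "exp \<Rightarrow> mem \<Rightarrow> real" where
  "ev (Rg r) m = m r"
| "ev (Cst c) m = c"
| "ev (Op f a b) m = aop_eval f (ev a m) (ev b m)"
| "ev (Mm e) m = m (max 128 (nat \<lfloor>ev e m\<rfloor>))"
| "ev (Ite a b c d) m = (if ev a m \<le> ev b m then ev c m else ev d m)"

text \<open>Cells below 64 hold program variables, cells 64 to 127 hold intermediate results, and all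
  indirect accesses are clamped to addresses from 128 on, so that they never touch either.\<close>

fun wf_exp :: "exp \<Rightarrow> nat \<Rightarrow> bool" where
  "wf_exp (Rg r) t \<longleftrightarrow> r < 64 \<and> t < 128"
| "wf_exp (Cst c) t \<longleftrightarrow> t < 128"
| "wf_exp (Op f a b) t \<longleftrightarrow> wf_exp a t \<and> wf_exp b (Suc t)"
| "wf_exp (Mm e) t \<longleftrightarrow> wf_exp e t \<and> Suc t < 128"
| "wf_exp (Ite a b c d) t \<longleftrightarrow> wf_exp a t \<and> wf_exp b (Suc t) \<and> wf_exp c t \<and> wf_exp d t"

fun exp_len :: "exp \<Rightarrow> nat" where
  "exp_len (Rg r) = 2"
| "exp_len (Cst c) = 1"
| "exp_len (Op f a b) = exp_len a + exp_len b + 1"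
| "exp_len (Mm e) = exp_len e + 4"
| "exp_len (Ite a b c d) = exp_len a + exp_len b + exp_len c + exp_len d + 2"

text \<open>The value ends up in cell \<open>t\<close>, and the cells from \<open>t\<close> on serve
  as a stack, so a second operand goes to \<open>Suc t\<close>. Registers are copied by adding them
  to 0. In \<open>Ite\<close> the code of the else branch comes first because the jump is taken when
  the comparison succeeds.\<close>

fun comp_exp :: "exp \<Rightarrow> nat \<Rightarrow> nat \<Rightarrow> instr list" where
  "comp_exp (Rg r) t pc = [Const t 0, Arith AAdd t t r]"
| "comp_exp (Cst c) t pc = [Const t c]"
| "comp_exp (Op f a b) t pc =
     comp_exp a t pc @ comp_exp b (Suc t) (pc + exp_len a) @ [Arith f t t (Suc t)]"
| "comp_exp (Mm e) t pc = comp_exp e t pc @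
     [Const (Suc t) 128, JumpLe (Suc t) t (pc + exp_len e + 3), Const t 128, Load t t]"
| "comp_exp (Ite a b c d) t pc =
     comp_exp a t pc @ comp_exp b (Suc t) (pc + exp_len a) @
     [JumpLe t (Suc t) (pc + exp_len a + exp_len b + exp_len d + 2)] @
     comp_exp d t (pc + exp_len a + exp_len b + 1) @
     [Jump (pc + exp_len a + exp_len b + exp_len d + exp_len c + 2)] @
     comp_exp c t (pc + exp_len a + exp_len b + exp_len d + 2)"

lemma length_comp_exp [simp]: "length (comp_exp e t pc) = exp_len e"
  by (induction e t pc rule: comp_exp.induct) auto

text \<open>Scratch cells are left out: the abstract state evaluates expressions without side
  effects, the machine does not.\<close>

definition agree :: "mem \<Rightarrow> mem \<Rightarrow> bool" where
  "agree m \<sigma> \<longleftrightarrow> (\<forall>a. a < 64 \<or> a \<ge> 128 \<longrightarrow> m a = \<sigma> a)"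

definition eq_off :: "nat \<Rightarrow> mem \<Rightarrow> mem \<Rightarrow> bool" where
  "eq_off t m m' \<longleftrightarrow> (\<forall>a. a < t \<or> a \<ge> 128 \<longrightarrow> m' a = m a)"

lemma eq_off_trans: "eq_off t m m' \<Longrightarrow> eq_off u m' m'' \<Longrightarrow> t \<le> u \<Longrightarrow> eq_off t m m''"
  unfolding eq_off_def by auto

lemma eq_off_upd: "eq_off t m m' \<Longrightarrow> t \<le> u \<Longrightarrow> u < 128 \<Longrightarrow> eq_off t m (m'(u := v))"
  unfolding eq_off_def by auto

lemma agree_eq_off: "agree m \<sigma> \<Longrightarrow> eq_off t m m' \<Longrightarrow> 64 \<le> t \<Longrightarrow> agree m' \<sigma>"
  unfolding agree_def eq_off_def by auto

lemma clamp_address: "nat \<lfloor>max 128 v\<rfloor> = max 128 (nat \<lfloor>v::real\<rfloor>)"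
proof (cases "128 \<le> v")
  case False
  then have "\<lfloor>v\<rfloor> < 128" by (simp add: floor_less_iff)
  then have "nat \<lfloor>v\<rfloor> \<le> 128" by linarith
  then show ?thesis using False by (simp add: max_def)
qed (auto simp: max_def le_nat_iff le_floor_iff)

lemma wf_exp_bound: "wf_exp e t \<Longrightarrow> t < 128"
  by (induction e t rule: wf_exp.induct) auto

text \<open>The part \<open>eq_off t m m'\<close> carries the induction: code for a second operand,
  run with \<open>Suc t\<close>, preserves the first value in cell \<open>t\<close>, and variables
  and heap keep agreeing with \<sigma>.\<close>

lemma comp_exp_correct:
  assumes "code_at P pc (comp_exp e t pc)" "wf_exp e t" "64 \<le> t" "agree m \<sigma>"
  shows "\<exists>m'. runs P (exp_len e) pc m (pc + exp_len e) m' \<and> m' t = ev e \<sigma> \<and> eq_off t m m'"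
  using assms
proof (induction e arbitrary: pc t m)
  case (Rg r)
  define m' where "m' = m(t := ev (Rg r) \<sigma>)"
  have "r \<noteq> t" "m r = \<sigma> r" using Rg.prems by (auto simp: agree_def)
  then have "exec_instr (Const t 0) (pc, m) = (Suc pc, m(t := 0))"
    "exec_instr (Arith AAdd t t r) (Suc pc, m(t := 0)) = (Suc (Suc pc), m')"
    by (simp_all add: m'_def)
  then have "runs P 2 pc m (Suc (Suc pc)) m'"
    using Rg.prems(1) unfolding numeral_2_eq_2
    by (intro runs_step[OF _ _ runs_step[OF _ _ runs_refl]]) (auto simp: code_at_Cons)
  moreover have "m' t = ev (Rg r) \<sigma>" "eq_off t m m'"
    using Rg.prems by (auto simp: m'_def eq_off_def)
  ultimately show ?case by (intro exI[of _ m']) simp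
next
  case (Cst c)
  have "runs P 1 pc m (Suc pc) (m(t := c))"
    using Cst.prems(1) unfolding One_nat_def
    by (intro runs_step[OF _ _ runs_refl]) (auto simp: code_at_Cons)
  moreover have "(m(t := c)) t = ev (Cst c) \<sigma>" "eq_off t m (m(t := c))"
    using Cst.prems by (auto simp: eq_off_def)
  ultimately show ?case by (intro exI[of _ "m(t := c)"]) (simp add: fun_upd_def)
next
  case (Op f a b)
  have ca: "code_at P pc (comp_exp a t pc)"
    and cb: "code_at P (pc + exp_len a) (comp_exp b (Suc t) (pc + exp_len a))"
    and ci: "code_at P (pc + exp_len a + exp_len b) [Arith f t t (Suc t)]"
    using Op.prems(1) by (simp_all add: code_at_append add.assoc)
  have w: "wf_exp a t" "wf_exp b (Suc t)" using Op.prems by auto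
  obtain m1 where m1: "runs P (exp_len a) pc m (pc + exp_len a) m1" "m1 t = ev a \<sigma>" "eq_off t m m1"
    using Op.IH(1)[OF ca w(1) Op.prems(3,4)] by blast
  have "agree m1 \<sigma>" using agree_eq_off m1(3) Op.prems by blast
  then obtain m2 where m2: "runs P (exp_len b) (pc + exp_len a) m1 (pc + exp_len a + exp_len b) m2"
      "m2 (Suc t) = ev b \<sigma>" "eq_off (Suc t) m1 m2"
    using Op.IH(2)[OF cb w(2)] Op.prems by fastforce
  define m3 where "m3 = m2(t := ev (Op f a b) \<sigma>)"
  have "m2 t = ev a \<sigma>" using m1 m2 by (auto simp: eq_off_def)
  then have "runs P 1 (pc + exp_len a + exp_len b) m2 (pc + exp_len (Op f a b)) m3"
    using ci m2(2) unfolding m3_def by (auto simp: code_at_Cons intro!: runs_step[OF _ _ runs_refl])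
  note r = runs_trans[OF runs_trans[OF m1(1) m2(1)] this]
  have "m3 t = ev (Op f a b) \<sigma>" by (simp add: m3_def)
  moreover have "eq_off t m m3"
    unfolding m3_def using eq_off_trans[OF m1(3) m2(3)] wf_exp_bound[OF w(1)] by (simp add: eq_off_upd)
  ultimately show ?case using r by (intro exI[of _ m3]) simp
next
  case (Mm e)
  let ?p = "pc + exp_len e"
  have ca: "code_at P pc (comp_exp e t pc)"
    and ci: "code_at P ?p [Const (Suc t) 128, JumpLe (Suc t) t (?p + 3), Const t 128, Load t t]"
    using Mm.prems(1) by (simp_all add: code_at_append)
  obtain m1 where m1: "runs P (exp_len e) pc m ?p m1" "m1 t = ev e \<sigma>" "eq_off t m m1"
    using Mm.IH[OF ca] Mm.prems by auto
  \<comment> \<open>One description of the state after clamping for both outcomes of the comparison: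
    if the jump is taken, cell \<open>t\<close> already holds the maximum.\<close>
  define m2 where "m2 = m1(Suc t := 128, t := max 128 (ev e \<sigma>))"
  define m3 where "m3 = m2(t := ev (Mm e) \<sigma>)"
  have t: "Suc t < 128" using Mm.prems by simp
  have "eq_off t m m2" unfolding m2_def using m1(3) t by (intro eq_off_upd) auto
  moreover have "agree m2 \<sigma>" using agree_eq_off calculation Mm.prems by blast
  ultimately have "m2 (nat \<lfloor>m2 t\<rfloor>) = ev (Mm e) \<sigma>"
    unfolding agree_def by (simp add: m2_def clamp_address)
  then have l: "runs P 1 (?p + 3) m2 (pc + exp_len (Mm e)) m3"
    using ci by (auto simp: code_at_Cons m3_def eval_nat_numeral intro!: runs_step[OF _ _ runs_refl])
  have "runs P 3 ?p m1 (?p + 3) m2"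
  proof (cases "128 \<le> ev e \<sigma>")
    case True
    then have "m2 = m1(Suc t := 128)" using m1(2) by (auto simp: m2_def max_def)
    then have "runs P 2 ?p m1 (?p + 3) m2"
      using True m1(2) ci by (auto simp: code_at_Cons numeral_2_eq_2 intro!: runs_step[OF _ _ runs_step[OF _ _ runs_refl]])
    then show ?thesis by (rule runs_mono) simp
  next
    case False
    then show ?thesis
      using m1(2) ci
      by (auto simp: code_at_Cons eval_nat_numeral m2_def max_def
          intro!: runs_step[OF _ _ runs_step[OF _ _ runs_step[OF _ _ runs_refl]]])
  qed
  from runs_trans[OF runs_trans[OF m1(1) this] l]
  have "runs P (exp_len (Mm e)) pc m (pc + exp_len (Mm e)) m3" by (simp add: add.commute)
  moreover have "m3 t = ev (Mm e) \<sigma>" by (simp add: m3_def)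
  moreover have "eq_off t m m3" unfolding m3_def using \<open>eq_off t m m2\<close> t by (simp add: eq_off_upd)
  ultimately show ?case by blast
next
  case (Ite a b c d)
  let ?q = "pc + exp_len a + exp_len b"
  have ca: "code_at P pc (comp_exp a t pc)"
    and cb: "code_at P (pc + exp_len a) (comp_exp b (Suc t) (pc + exp_len a))"
    and ci: "code_at P ?q [JumpLe t (Suc t) (?q + exp_len d + 2)]"
    and cd: "code_at P (?q + 1) (comp_exp d t (?q + 1))"
    and cj: "code_at P (?q + 1 + exp_len d) [Jump (?q + exp_len d + exp_len c + 2)]"
    and cc: "code_at P (?q + exp_len d + 2) (comp_exp c t (?q + exp_len d + 2))"
    using Ite.prems(1) by (simp_all add: code_at_append code_at_Cons add.assoc)
  have w: "wf_exp a t" "wf_exp b (Suc t)" "wf_exp c t" "wf_exp d t" using Ite.prems by auto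
  obtain m1 where m1: "runs P (exp_len a) pc m (pc + exp_len a) m1" "m1 t = ev a \<sigma>" "eq_off t m m1"
    using Ite.IH(1)[OF ca w(1) Ite.prems(3,4)] by blast
  have "agree m1 \<sigma>" using agree_eq_off m1(3) Ite.prems by blast
  then obtain m2 where m2: "runs P (exp_len b) (pc + exp_len a) m1 ?q m2"
      "m2 (Suc t) = ev b \<sigma>" "eq_off (Suc t) m1 m2"
    using Ite.IH(2)[OF cb w(2)] Ite.prems by fastforce
  have m2t: "m2 t = ev a \<sigma>" using m1 m2 by (auto simp: eq_off_def)
  have e2: "eq_off t m m2" using eq_off_trans[OF m1(3) m2(3)] by simp
  have a2: "agree m2 \<sigma>" using agree_eq_off e2 Ite.prems by blast
  note r2 = runs_trans[OF m1(1) m2(1)]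
  show ?case
  proof (cases "ev a \<sigma> \<le> ev b \<sigma>")
    case True
    have "runs P 1 ?q m2 (?q + exp_len d + 2) m2"
      using True ci m2(2) m2t by (auto simp: code_at_Cons intro!: runs_step[OF _ _ runs_refl])
    moreover obtain m3 where m3: "runs P (exp_len c) (?q + exp_len d + 2) m2 (?q + exp_len d + 2 + exp_len c) m3"
        "m3 t = ev c \<sigma>" "eq_off t m2 m3"
      using Ite.IH(3)[OF cc w(3) Ite.prems(3) a2] by blast
    ultimately have "runs P (exp_len a + exp_len b + (1 + exp_len c)) pc m (?q + exp_len d + 2 + exp_len c) m3"
      using r2 by (blast intro: runs_trans)
    moreover have "?q + exp_len d + 2 + exp_len c = pc + exp_len (Ite a b c d)" by simp
    ultimately have "runs P (exp_len a + exp_len b + (1 + exp_len c)) pc m (pc + exp_len (Ite a b c d)) m3"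
      by (metis (no_types))
    then have "runs P (exp_len (Ite a b c d)) pc m (pc + exp_len (Ite a b c d)) m3"
      by (rule runs_mono) simp
    then show ?thesis using True m3 e2 eq_off_trans by (intro exI[of _ m3]) auto
  next
    case False
    have j1: "runs P 1 ?q m2 (?q + 1) m2"
      using False ci m2(2) m2t by (auto simp: code_at_Cons intro!: runs_step[OF _ _ runs_refl])
    obtain m3 where m3: "runs P (exp_len d) (?q + 1) m2 (?q + 1 + exp_len d) m3"
        "m3 t = ev d \<sigma>" "eq_off t m2 m3"
      using Ite.IH(4)[OF cd w(4) Ite.prems(3) a2] by blast
    have j2: "runs P 1 (?q + 1 + exp_len d) m3 (?q + exp_len d + exp_len c + 2) m3"
      using cj by (auto simp: code_at_Cons intro!: runs_step[OF _ _ runs_refl])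
    have "runs P (exp_len a + exp_len b + (1 + (exp_len d + 1))) pc m (?q + exp_len d + exp_len c + 2) m3"
      using r2 j1 m3(1) j2 by (blast intro: runs_trans)
    moreover have "?q + exp_len d + exp_len c + 2 = pc + exp_len (Ite a b c d)" by simp
    ultimately have "runs P (exp_len a + exp_len b + (1 + (exp_len d + 1))) pc m (pc + exp_len (Ite a b c d)) m3"
      by (metis (no_types))
    then have "runs P (exp_len (Ite a b c d)) pc m (pc + exp_len (Ite a b c d)) m3"
      by (rule runs_mono) simp
    then show ?thesis using False m3 e2 eq_off_trans by (intro exI[of _ m3]) auto
  qed
qed

section \<open>Assignments and heap writes\<close>

datatype stmt = Asg nat exp | Wr exp exp

fun exec_stmt :: "stmt \<Rightarrow> mem \<Rightarrow> mem" where
  "exec_stmt (Asg r e) m = m(r := ev e m)"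
| "exec_stmt (Wr a e) m = m(max 128 (nat \<lfloor>ev a m\<rfloor>) := ev e m)"

fun wf_stmt :: "stmt \<Rightarrow> bool" where
  "wf_stmt (Asg r e) \<longleftrightarrow> r < 64 \<and> wf_exp e 64"
| "wf_stmt (Wr a e) \<longleftrightarrow> wf_exp a 64 \<and> wf_exp e 65"

fun stmt_len :: "stmt \<Rightarrow> nat" where
  "stmt_len (Asg r e) = exp_len e + 2"
| "stmt_len (Wr a e) = exp_len a + exp_len e + 4"

fun comp_stmt :: "stmt \<Rightarrow> nat \<Rightarrow> instr list" where
  "comp_stmt (Asg r e) pc = comp_exp e 64 pc @ [Const 65 0, Arith AAdd r 64 65]"
| "comp_stmt (Wr a e) pc = comp_exp a 64 pc @ comp_exp e 65 (pc + exp_len a) @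
     [Const 66 128, JumpLe 66 64 (pc + exp_len a + exp_len e + 3), Const 64 128, Store 64 65]"

lemma length_comp_stmt [simp]: "length (comp_stmt c pc) = stmt_len c"
  by (cases c) auto

lemma comp_stmt_correct:
  assumes "code_at P pc (comp_stmt c pc)" "wf_stmt c" "agree m \<sigma>"
  shows "\<exists>m'. runs P (stmt_len c) pc m (pc + stmt_len c) m' \<and> agree m' (exec_stmt c \<sigma>)"
proof (cases c)
  case (Asg r e)
  have ca: "code_at P pc (comp_exp e 64 pc)"
    and ci: "code_at P (pc + exp_len e) [Const 65 0, Arith AAdd r 64 65]"
    using assms(1) Asg by (simp_all add: code_at_append)
  have w: "r < 64" "wf_exp e 64" using assms Asg by auto
  obtain m1 where m1: "runs P (exp_len e) pc m (pc + exp_len e) m1" "m1 64 = ev e \<sigma>" "eq_off 64 m m1"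
    using comp_exp_correct[OF ca w(2) _ assms(3)] by auto
  have "agree m1 \<sigma>" using agree_eq_off m1 assms by blast
  then have "agree (m1(65 := 0, r := ev e \<sigma>)) (exec_stmt c \<sigma>)"
    using w Asg by (auto simp: agree_def)
  moreover have "runs P 2 (pc + exp_len e) m1 (pc + exp_len e + 2) (m1(65 := 0, r := ev e \<sigma>))"
    using ci m1(2) by (auto simp: code_at_Cons numeral_2_eq_2 intro!: runs_step[OF _ _ runs_step[OF _ _ runs_refl]])
  ultimately show ?thesis using runs_trans[OF m1(1), of 2] Asg
    by (intro exI[of _ "m1(65 := 0, r := ev e \<sigma>)"]) (simp add: add.assoc del: fun_upd_apply)
next
  case (Wr a e)
  let ?p = "pc + exp_len a + exp_len e"
  have ca: "code_at P pc (comp_exp a 64 pc)"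
    and cb: "code_at P (pc + exp_len a) (comp_exp e 65 (pc + exp_len a))"
    and ci: "code_at P ?p [Const 66 128, JumpLe 66 64 (?p + 3), Const 64 128, Store 64 65]"
    using assms(1) Wr by (simp_all add: code_at_append add.assoc)
  have w: "wf_exp a 64" "wf_exp e 65" using assms Wr by auto
  obtain m1 where m1: "runs P (exp_len a) pc m (pc + exp_len a) m1" "m1 64 = ev a \<sigma>" "eq_off 64 m m1"
    using comp_exp_correct[OF ca w(1) _ assms(3)] by auto
  have "agree m1 \<sigma>" using agree_eq_off m1 assms by blast
  then obtain m2 where m2: "runs P (exp_len e) (pc + exp_len a) m1 ?p m2"
      "m2 65 = ev e \<sigma>" "eq_off 65 m1 m2"
    using comp_exp_correct[OF cb w(2)] by fastforce
  have m2a: "m2 64 = ev a \<sigma>" using m1 m2 by (auto simp: eq_off_def)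
  define m3 where "m3 = m2(66 := 128, 64 := max 128 (ev a \<sigma>))"
  define m4 where "m4 = m3(max 128 (nat \<lfloor>ev a \<sigma>\<rfloor>) := ev e \<sigma>)"
  have "eq_off 64 m m2" using eq_off_trans[OF m1(3) m2(3)] by simp
  then have "agree m2 \<sigma>" using agree_eq_off assms by blast
  then have ag: "agree m4 (exec_stmt c \<sigma>)" unfolding Wr by (auto simp: agree_def m4_def m3_def)
  have "runs P 3 ?p m2 (?p + 3) m3"
  proof (cases "128 \<le> ev a \<sigma>")
    case True
    then have "m3 = m2(66 := 128)" using m2a by (auto simp: m3_def max_def)
    then have "runs P 2 ?p m2 (?p + 3) m3"
      using True m2a ci by (auto simp: code_at_Cons numeral_2_eq_2 intro!: runs_step[OF _ _ runs_step[OF _ _ runs_refl]])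
    then show ?thesis by (rule runs_mono) simp
  next
    case False
    then show ?thesis
      using m2a ci
      by (auto simp: code_at_Cons eval_nat_numeral m3_def max_def
          intro!: runs_step[OF _ _ runs_step[OF _ _ runs_step[OF _ _ runs_refl]]])
  qed
  moreover have "runs P 1 (?p + 3) m3 (?p + 4) m4"
  proof -
    have "m3 (64::nat) = max 128 (ev a \<sigma>)" "m3 65 = ev e \<sigma>" by (auto simp: m3_def m2)
    then have "exec_instr (Store 64 65) (?p + 3, m3) = (?p + 4, m4)"
      by (simp add: m4_def clamp_address)
    moreover have "?p + 3 < length P" "P ! (?p + 3) = Store 64 65"
      using ci by (simp_all add: code_at_Cons eval_nat_numeral)
    ultimately show ?thesis by (auto intro!: runs_step[OF _ _ runs_refl])
  qed
  ultimately have "runs P (exp_len a + (exp_len e + (3 + 1))) pc m (?p + 4) m4"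
    using m1(1) m2(1) by (blast intro: runs_trans)
  then show ?thesis using ag Wr by (auto simp: add.assoc)
qed

definition exec :: "stmt list \<Rightarrow> mem \<Rightarrow> mem" where
  "exec cs m = fold exec_stmt cs m"

lemma exec_Nil [simp]: "exec [] m = m"
  and exec_Cons [simp]: "exec (c # cs) m = exec cs (exec_stmt c m)"
  and exec_append: "exec (cs @ ds) m = exec ds (exec cs m)"
  by (simp_all add: exec_def)

definition block_len :: "stmt list \<Rightarrow> nat" where
  "block_len cs = sum_list (map stmt_len cs)"

fun comp_block :: "stmt list \<Rightarrow> nat \<Rightarrow> instr list" where
  "comp_block [] pc = []"
| "comp_block (c # cs) pc = comp_stmt c pc @ comp_block cs (pc + stmt_len c)"

lemma length_comp_block [simp]: "length (comp_block cs pc) = block_len cs"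
  by (induction cs arbitrary: pc) (auto simp: block_len_def)

lemma comp_block_correct:
  assumes "code_at P pc (comp_block cs pc)" "list_all wf_stmt cs" "agree m \<sigma>"
  shows "\<exists>m'. runs P (block_len cs) pc m (pc + block_len cs) m' \<and> agree m' (exec cs \<sigma>)"
  using assms
proof (induction cs arbitrary: pc m \<sigma>)
  case Nil
  then show ?case using runs_refl by (intro exI[of _ m]) (auto simp: block_len_def)
next
  case (Cons c cs)
  have c: "code_at P pc (comp_stmt c pc)" "code_at P (pc + stmt_len c) (comp_block cs (pc + stmt_len c))"
    using Cons.prems by (simp_all add: code_at_append)
  obtain m1 where m1: "runs P (stmt_len c) pc m (pc + stmt_len c) m1" "agree m1 (exec_stmt c \<sigma>)"
    using comp_stmt_correct[OF c(1)] Cons.prems by auto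
  obtain m2 where "runs P (block_len cs) (pc + stmt_len c) m1 (pc + stmt_len c + block_len cs) m2"
      "agree m2 (exec cs (exec_stmt c \<sigma>))"
    using Cons.IH[OF c(2) _ m1(2)] Cons.prems by auto
  then show ?case using runs_trans[OF m1(1)] by (auto simp: block_len_def add.assoc)
qed

section \<open>Loops and an upper bound on their running time\<close>

datatype com = Block "stmt list" | Until exp exp "stmt list"

fun com_len :: "com \<Rightarrow> nat" where
  "com_len (Block cs) = block_len cs"
| "com_len (Until a b cs) = exp_len a + exp_len b + block_len cs + 2"

fun wf_com :: "com \<Rightarrow> bool" where
  "wf_com (Block cs) \<longleftrightarrow> list_all wf_stmt cs"
| "wf_com (Until a b cs) \<longleftrightarrow> wf_exp a 64 \<and> wf_exp b 65 \<and> list_all wf_stmt cs"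

fun comp_com :: "com \<Rightarrow> nat \<Rightarrow> instr list" where
  "comp_com (Block cs) pc = comp_block cs pc"
| "comp_com (Until a b cs) pc = comp_exp a 64 pc @ comp_exp b 65 (pc + exp_len a) @
     [JumpLe 64 65 (pc + exp_len a + exp_len b + block_len cs + 2)] @
     comp_block cs (pc + exp_len a + exp_len b + 1) @ [Jump pc]"

lemma length_comp_com [simp]: "length (comp_com c pc) = com_len c"
  by (cases c) auto

text \<open>Loops are not nested, so one pass through a loop takes at most as many steps as its code
  is long. Every test is charged such a full pass, even the last one, after which the body is not
  run.\<close>

inductive sem :: "com \<Rightarrow> mem \<Rightarrow> nat \<Rightarrow> mem \<Rightarrow> bool" where
  block: "sem (Block cs) \<sigma> (block_len cs) (exec cs \<sigma>)"
| stop: "ev a \<sigma> \<le> ev b \<sigma> \<Longrightarrow> sem (Until a b cs) \<sigma> (com_len (Until a b cs)) \<sigma>"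
| iterate: "\<not> ev a \<sigma> \<le> ev b \<sigma> \<Longrightarrow> sem (Until a b cs) (exec cs \<sigma>) t \<sigma>' \<Longrightarrow>
    sem (Until a b cs) \<sigma> (com_len (Until a b cs) + t) \<sigma>'"

lemma comp_com_correct:
  assumes "sem c \<sigma> t \<sigma>'" "code_at P pc (comp_com c pc)" "wf_com c" "agree m \<sigma>"
  shows "\<exists>m'. runs P t pc m (pc + com_len c) m' \<and> agree m' \<sigma>'"
proof -
  \<comment> \<open>Both loop rules begin with the same evaluation of the condition, which is
    treated once for either outcome.\<close>
  have test: "\<exists>m'. runs P (exp_len a + exp_len b + 1) pc m
      (if ev a \<sigma> \<le> ev b \<sigma> then pc + com_len (Until a b cs) else pc + exp_len a + exp_len b + 1) m'
      \<and> agree m' \<sigma>"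
    if cd: "code_at P pc (comp_com (Until a b cs) pc)" and wf: "wf_com (Until a b cs)" and ag: "agree m \<sigma>"
    for a b cs m \<sigma>
  proof -
    let ?p = "pc + exp_len a + exp_len b"
    have ca: "code_at P pc (comp_exp a 64 pc)"
      and cb: "code_at P (pc + exp_len a) (comp_exp b 65 (pc + exp_len a))"
      and ci: "code_at P ?p [JumpLe 64 65 (?p + block_len cs + 2)]"
      using cd by (simp_all add: code_at_append code_at_Cons add.assoc)
    have w: "wf_exp a 64" "wf_exp b 65" using wf by auto
    obtain m1 where m1: "runs P (exp_len a) pc m (pc + exp_len a) m1" "m1 64 = ev a \<sigma>" "eq_off 64 m m1"
      using comp_exp_correct[OF ca w(1) _ ag] by auto
    have a1: "agree m1 \<sigma>" using agree_eq_off m1 ag by blast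
    then obtain m2 where m2: "runs P (exp_len b) (pc + exp_len a) m1 ?p m2"
        "m2 65 = ev b \<sigma>" "eq_off 65 m1 m2"
      using comp_exp_correct[OF cb w(2)] by fastforce
    have m2a: "m2 64 = ev a \<sigma>" using m1 m2 by (auto simp: eq_off_def)
    have "agree m2 \<sigma>" using agree_eq_off[OF a1 m2(3)] by simp
    moreover have "runs P 1 ?p m2 (if ev a \<sigma> \<le> ev b \<sigma> then pc + com_len (Until a b cs) else ?p + 1) m2"
      using ci m2a m2(2) unfolding One_nat_def
      by (intro runs_step[OF _ _ runs_refl]) (auto simp: code_at_Cons)
    ultimately show ?thesis using runs_trans[OF runs_trans[OF m1(1) m2(1)]] by blast
  qed
  from assms show ?thesis
  proof (induction arbitrary: m rule: sem.induct)
    case (block cs \<sigma>)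
    then show ?case using comp_block_correct by simp
  next
    case (stop a \<sigma> b cs)
    obtain m' where "runs P (exp_len a + exp_len b + 1) pc m (pc + com_len (Until a b cs)) m'" "agree m' \<sigma>"
      using test[OF stop.prems] stop.hyps by auto
    then show ?case by (intro exI[of _ m']) (auto intro: runs_mono)
  next
    case (iterate a \<sigma> b cs t \<sigma>')
    let ?p = "pc + exp_len a + exp_len b + 1"
    obtain m1 where m1: "runs P (exp_len a + exp_len b + 1) pc m ?p m1" "agree m1 \<sigma>"
      using test[OF iterate.prems] iterate.hyps by auto
    have cb: "code_at P ?p (comp_block cs ?p)" and cj: "code_at P (?p + block_len cs) [Jump pc]"
      using iterate.prems(1) by (simp_all add: code_at_append code_at_Cons add.assoc)
    obtain m2 where m2: "runs P (block_len cs) ?p m1 (?p + block_len cs) m2" "agree m2 (exec cs \<sigma>)"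
      using comp_block_correct[OF cb _ m1(2)] iterate.prems by auto
    have j: "runs P 1 (?p + block_len cs) m2 pc m2"
      using cj by (auto simp: code_at_Cons intro!: runs_step[OF _ _ runs_refl])
    obtain m3 where m3: "runs P t pc m2 (pc + com_len (Until a b cs)) m3" "agree m3 \<sigma>'"
      using iterate.IH[OF iterate.prems(1,2) m2(2)] by blast
    from runs_trans[OF runs_trans[OF runs_trans[OF m1(1) m2(1)] j] m3(1)] m3(2)
    show ?case by (intro exI[of _ m3]) (simp add: add.commute add.left_commute)
  qed
qed

text \<open>Invariant and running time in one rule: the index of \<open>I\<close> is a potential
  that bounds the remaining iterations, and one further test is charged for leaving the
  loop.\<close>

lemma sem_Until:
  assumes inv: "I N \<sigma>"
    and stp: "\<And>j \<sigma>. I j \<sigma> \<Longrightarrow> \<not> ev a \<sigma> \<le> ev b \<sigma> \<Longrightarrow> \<exists>i<j. I i (exec cs \<sigma>)"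
  shows "\<exists>t \<sigma>' j. sem (Until a b cs) \<sigma> t \<sigma>' \<and> t \<le> Suc N * com_len (Until a b cs) \<and>
    I j \<sigma>' \<and> ev a \<sigma>' \<le> ev b \<sigma>'"
  using inv
proof (induction N arbitrary: \<sigma> rule: less_induct)
  case (less N)
  show ?case
  proof (cases "ev a \<sigma> \<le> ev b \<sigma>")
    case True
    then show ?thesis using less.prems sem.stop[of a \<sigma> b cs]
      by (intro exI[of _ "com_len (Until a b cs)"] exI[of _ \<sigma>] exI[of _ N]) auto
  next
    case False
    obtain i where i: "i < N" "I i (exec cs \<sigma>)" using stp[OF less.prems False] by blast
    from less.IH[OF i] obtain t \<sigma>' j where "sem (Until a b cs) (exec cs \<sigma>) t \<sigma>'"
      "t \<le> Suc i * com_len (Until a b cs)" and fin: "I j \<sigma>'" "ev a \<sigma>' \<le> ev b \<sigma>'" by blast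
    then have "sem (Until a b cs) \<sigma> (com_len (Until a b cs) + t) \<sigma>'"
      and "com_len (Until a b cs) + t \<le> Suc (Suc i) * com_len (Until a b cs)"
      using sem.iterate[OF False] by auto
    moreover have "Suc (Suc i) * com_len (Until a b cs) \<le> Suc N * com_len (Until a b cs)"
      using i(1) by (intro mult_le_mono1) simp
    ultimately show ?thesis using fin le_trans by blast
  qed
qed

fun comp_prog :: "com list \<Rightarrow> nat \<Rightarrow> instr list" where
  "comp_prog [] pc = [Halt]"
| "comp_prog (c # cs) pc = comp_com c pc @ comp_prog cs (pc + com_len c)"

inductive sems :: "com list \<Rightarrow> mem \<Rightarrow> nat \<Rightarrow> mem \<Rightarrow> bool" where
  Nil: "sems [] \<sigma> 0 \<sigma>"
| Cons: "sem c \<sigma> t \<sigma>1 \<Longrightarrow> sems cs \<sigma>1 u \<sigma>2 \<Longrightarrow> sems (c # cs) \<sigma> (t + u) \<sigma>2"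

lemma comp_prog_correct:
  assumes "sems cs \<sigma> t \<sigma>'" "code_at P pc (comp_prog cs pc)" "list_all wf_com cs" "agree m \<sigma>"
  shows "\<exists>pc' m'. runs P t pc m pc' m' \<and> pc' < length P \<and> P ! pc' = Halt \<and> agree m' \<sigma>'"
  using assms
proof (induction arbitrary: pc m rule: sems.induct)
  case (Nil \<sigma>)
  then show ?case using runs_refl by (intro exI[of _ pc] exI[of _ m]) (auto simp: code_at_Cons)
next
  case (Cons c \<sigma> t \<sigma>1 cs u \<sigma>2)
  have c: "code_at P pc (comp_com c pc)" "code_at P (pc + com_len c) (comp_prog cs (pc + com_len c))"
    using Cons.prems by (simp_all add: code_at_append)
  have w: "wf_com c" "list_all wf_com cs" using Cons.prems by simp_all
  obtain m1 where m1: "runs P t pc m (pc + com_len c) m1" "agree m1 \<sigma>1"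
    using comp_com_correct[OF Cons.hyps(1) c(1) w(1) Cons.prems(3)] by blast
  show ?case using Cons.IH[OF c(2) w(2) m1(2)] runs_trans[OF m1(1)] by blast
qed

lemma halts_withinI:
  assumes "runs P t 0 m pc' m'" "pc' < length P" "P ! pc' = Halt" "real t \<le> u"
  shows "halts_within P u m m'"
proof -
  obtain k where "k \<le> t" "(step P ^^ k) (0, m) = (pc', m')" using assms(1) unfolding runs_def by blast
  then show ?thesis unfolding halts_within_def using assms(2-4) by (intro exI[of _ k]) auto
qed

section \<open>Skew-binary jump pointers\<close>

text \<open>The skew-binary representation of \<open>i\<close>, smallest digit first: an entry
  \<open>k\<close> stands for a perfect binary tree with \<open>2 ^ k - 1\<close> nodes. A new node
  becomes the root of the two leading trees if their ranks are equal, and a tree of its own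
  otherwise.\<close>

fun forest :: "nat \<Rightarrow> nat list" where
  "forest 0 = []"
| "forest (Suc p) = (case forest p of
     k # k' # ks \<Rightarrow> if k = k' then Suc k # ks else 1 # k # k' # ks
   | ks \<Rightarrow> 1 # ks)"

definition jmp :: "nat \<Rightarrow> nat" where
  "jmp i = (case forest i of [] \<Rightarrow> 0 | k # ks \<Rightarrow> i - (2 ^ k - 1))"

lemma forest_cases:
  obtains "forest p = []" "forest (Suc p) = [1]"
  | k where "forest p = [k]" "forest (Suc p) = [1, k]"
  | k ks where "forest p = k # k # ks" "forest (Suc p) = Suc k # ks"
  | k k' ks where "forest p = k # k' # ks" "k \<noteq> k'" "forest (Suc p) = 1 # k # k' # ks"
proof (cases "forest p")
  case (Cons k ks)
  then show ?thesis using that by (cases ks; cases "k = hd ks") auto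
qed (use that in auto)

lemma forest_sum: "(\<Sum>k\<leftarrow>forest i. 2 ^ k - 1) = i"
proof (induction i)
  case (Suc p)
  have "2 * (2 ^ k - 1) + 1 = 2 ^ Suc k - (1::nat)" for k
  proof -
    have "1 \<le> (2::nat) ^ k" by simp
    then show ?thesis unfolding power_Suc by linarith
  qed
  then show ?case using Suc by (cases p rule: forest_cases) auto
qed simp

text \<open>Only the two leading ranks can coincide: a merge consumes such a pair, and the new rank
  is at most the following one, which was strictly larger than the pair.\<close>

lemma forest_shape:
  "(\<forall>k\<in>set (forest i). 1 \<le> k) \<and> sorted_wrt (<) (tl (forest i)) \<and>
   (\<forall>k k' ks. forest i = k # k' # ks \<longrightarrow> k \<le> k')"
proof (induction i)
  case (Suc p)
  show ?case
    using Suc by (cases p rule: forest_cases) (fastforce simp: Suc_le_eq)+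
qed simp

lemma jmp_0 [simp]: "jmp 0 = 0"
  by (simp add: jmp_def)

lemma jmp_Cons:
  assumes "forest i = k # ks"
  shows "jmp i + 2 ^ k = Suc i" "jmp i < i"
proof -
  have "2 ^ k - 1 \<le> i" using forest_sum[of i] assms by simp
  moreover have "1 \<le> k" using forest_shape[of i] assms by simp
  then have "(2::nat) ^ 1 \<le> 2 ^ k" by (intro power_increasing) auto
  ultimately show *: "jmp i + 2 ^ k = Suc i" using assms by (simp add: jmp_def)
  show "jmp i < i" using * \<open>2 ^ 1 \<le> 2 ^ k\<close> by simp
qed

lemma forest_Nil_iff: "forest i = [] \<longleftrightarrow> i = 0"
  by (cases i) (auto split: list.splits)

lemma jmp_less: "0 < i \<Longrightarrow> jmp i < i"
  using jmp_Cons(2)[of i] forest_Nil_iff[of i] by (cases "forest i") auto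

lemma forest_jmp: "forest (jmp i) = tl (forest i)"
proof (induction i rule: less_induct)
  case (less i)
  show ?case
  proof (cases i)
    case (Suc p)
    show ?thesis
    proof (cases p rule: forest_cases)
      case (3 k ks)
      have a: "jmp p + 2 ^ k = Suc p" "forest (jmp p) = k # ks" "jmp p < i"
        using jmp_Cons[OF 3(1)] less.IH[of p] 3 Suc by auto
      have b: "jmp (jmp p) + 2 ^ k = Suc (jmp p)" "forest (jmp (jmp p)) = ks"
        using jmp_Cons[OF a(2)] less.IH[OF a(3)] a by auto
      have c: "jmp i + 2 ^ Suc k = Suc i" using jmp_Cons(1)[of i] 3 Suc by simp
      have "1 \<le> (2::nat) ^ k" by simp
      then have "jmp i = jmp (jmp p)" using a(1) b(1) c Suc by simp
      then show ?thesis using b 3 Suc by simp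
    qed (use Suc jmp_def[of i] in auto)
  qed simp
qed

text \<open>The recurrence that the machine evaluates. The two leading trees have equal rank exactly
  if two consecutive jumps have equal length, so the pointers can be computed from earlier pointers
  without any ranks in memory.\<close>

lemma jmp_Suc: "jmp (Suc p) = (if p - jmp p = jmp p - jmp (jmp p) then jmp (jmp p) else p)"
proof (cases p rule: forest_cases)
  case 1
  then show ?thesis by (simp add: forest_Nil_iff jmp_def)
next
  case (2 k)
  have "forest (jmp p) = []" "jmp p < p" using 2 forest_jmp jmp_Cons(2)[OF 2(1)] by auto
  then show ?thesis using 2 by (simp add: forest_Nil_iff) (simp add: jmp_def)
next
  case (3 k ks)
  have "forest (jmp p) = k # ks" using forest_jmp[of p] 3 by simp
  note j = jmp_Cons(1)[OF 3(1)] jmp_Cons(1)[OF this] jmp_Cons(1)[OF 3(2)]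
  have "1 \<le> (2::nat) ^ k" by simp
  then have "jmp (Suc p) = jmp (jmp p)" "p - jmp p = jmp p - jmp (jmp p)" using j by auto
  then show ?thesis by simp
next
  case (4 k k' ks)
  have "forest (jmp p) = k' # ks" using forest_jmp[of p] 4 by simp
  note j = jmp_Cons(1)[OF 4(1)] jmp_Cons(1)[OF this] jmp_Cons(1)[OF 4(3)]
  have "(2::nat) ^ k \<noteq> 2 ^ k'" using 4(2) by simp
  moreover have "1 \<le> (2::nat) ^ k" "1 \<le> (2::nat) ^ k'" by auto
  ultimately have "p - jmp p \<noteq> jmp p - jmp (jmp p)" using j by linarith
  then show ?thesis using j(3) by simp
qed

text \<open>The indices above \<open>j\<close> up to \<open>i\<close> form a perfect tree of rank
  \<open>k\<close>, numbered downwards in preorder: the root \<open>i\<close>, one subtree down to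
  \<open>m\<close>, the other down to \<open>j\<close>. The pointer of each root leads just past its
  own tree.\<close>

fun tree :: "nat \<Rightarrow> nat \<Rightarrow> nat \<Rightarrow> bool" where
  "tree 0 i j \<longleftrightarrow> i = j"
| "tree (Suc k) i j \<longleftrightarrow> 0 < i \<and> jmp i = j \<and> (\<exists>m. tree k (i - 1) m \<and> tree k m j)"

lemma tree_le: "tree k i j \<Longrightarrow> j \<le> i"
  by (cases k) (auto simp: jmp_less less_imp_le)

lemma tree_forest: "forest i = k # ks \<Longrightarrow> tree k i (jmp i)"
proof (induction i arbitrary: k ks rule: less_induct)
  case (less i)
  show ?case
  proof (cases i)
    case (Suc p)
    have one: ?thesis if f: "forest (Suc p) = 1 # forest p"
    proof -
      have "jmp i = p" using jmp_Cons(1)[of i 1 "forest p"] f Suc by simp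
      moreover have "k = Suc 0" using less.prems f Suc by simp
      ultimately show ?thesis using Suc by simp
    qed
    show ?thesis
    proof (cases p rule: forest_cases)
      case (3 k' ks')
      have "forest (jmp p) = k' # ks'" "jmp p < i"
        using forest_jmp[of p] 3 jmp_Cons(2)[OF 3(1)] Suc by auto
      then have "tree k' p (jmp p)" "tree k' (jmp p) (jmp (jmp p))"
        using less.IH 3(1) Suc by auto
      moreover have "jmp i = jmp (jmp p)"
      proof -
        have "jmp p + 2 ^ k' = Suc p" "jmp (jmp p) + 2 ^ k' = Suc (jmp p)" "jmp i + 2 * 2 ^ k' = Suc i"
          using jmp_Cons(1)[OF 3(1)] jmp_Cons(1)[of "jmp p" k' ks'] jmp_Cons(1)[of i "Suc k'" ks']
            forest_jmp[of p] 3 Suc by auto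
        then show ?thesis using Suc by linarith
      qed
      ultimately show ?thesis using less.prems 3 Suc by auto
    qed (use one in simp_all)
  qed (use less.prems in simp)
qed

section \<open>Length of a descent along the pointers\<close>

function descent :: "nat \<Rightarrow> nat \<Rightarrow> nat" where
  "descent t i = (if i \<le> t then 0 else Suc (descent t (if t \<le> jmp i then jmp i else i - 1)))"
  by auto
termination by (relation "Wellfounded.measure snd") (auto simp: jmp_less)

declare descent.simps [simp del]

text \<open>Two steps per level are enough: one from the root to the top of its first subtree and,
  if \<open>t\<close> lies below that subtree, one jump across it.\<close>

lemma descent_tree:
  "tree k i j \<Longrightarrow> j \<le> t \<Longrightarrow> t \<le> i \<Longrightarrow> descent t i \<le> 2 * k"
proof (induction k arbitrary: i j)
  case 0
  then show ?case by (simp add: descent.simps)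
next
  case (Suc k)
  then obtain m where m: "0 < i" "jmp i = j" "tree k (i - 1) m" "tree k m j" by auto
  consider "t = i" | "t = j" "t < i" | "j < t" "t < i" using Suc.prems by linarith
  then show ?case
  proof cases
    case 3
    then have d: "descent t i = Suc (descent t (i - 1))" using m by (simp add: descent.simps[of t i])
    show ?thesis
    proof (cases "m \<le> t")
      case True
      moreover have "t \<le> i - 1" using 3 by simp
      ultimately show ?thesis using Suc.IH[OF m(3)] d by fastforce
    next
      case False
      have "k \<noteq> 0"
      proof
        assume "k = 0"
        then show False using m(3,4) False 3 by simp
      qed
      then obtain k' where "k = Suc k'" by (cases k) auto
      then have "jmp (i - 1) = m" using m(3) by simp
      then have "descent t (i - 1) \<le> Suc (descent t m)"
        using False by (subst descent.simps) simp
      moreover have "descent t m \<le> 2 * k" using Suc.IH[OF m(4)] 3 False by simp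
      ultimately show ?thesis using d by simp
    qed
  qed (use m in \<open>simp_all add: descent.simps\<close>)
qed

text \<open>Each tree lying wholly above \<open>t\<close> is crossed by one jump; only the tree
  containing \<open>t\<close> is entered.\<close>

lemma descent_forest:
  assumes "\<forall>k\<in>set (forest i). k \<le> L" "t \<le> i"
  shows "descent t i \<le> length (forest i) + 2 * L"
  using assms
proof (induction i rule: less_induct)
  case (less i)
  show ?case
  proof (cases "forest i")
    case Nil
    then show ?thesis using less.prems by (simp add: forest_Nil_iff descent.simps)
  next
    case (Cons k ks)
    show ?thesis
    proof (cases "jmp i \<le> t")
      case True
      then have "descent t i \<le> 2 * k"
        using descent_tree tree_forest[OF Cons] less.prems by blast
      then show ?thesis using less.prems(1) Cons by simp
    next
      case False
      have "descent t (jmp i) \<le> length ks + 2 * L"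
        using less.IH[of "jmp i"] jmp_Cons(2)[OF Cons] less.prems(1) False forest_jmp[of i] Cons by simp
      then show ?thesis using False Cons less.prems(2) jmp_Cons(2)[OF Cons] by (simp add: descent.simps[of t i])
    qed
  qed
qed

text \<open>All ranks are at most \<open>L\<close> and, apart from the first, distinct. So there are
  at most \<open>L + 1\<close> trees, and \<open>2 * L\<close> steps are spent inside one of
  them.\<close>

lemma descent_le:
  assumes "t \<le> i" "i < 2 ^ L"
  shows "descent t i \<le> 3 * L + 1"
proof -
  have L: "k \<le> L" if "k \<in> set (forest i)" for k
  proof -
    have "2 ^ k - 1 \<le> (\<Sum>k\<leftarrow>forest i. 2 ^ k - (1::nat))"
      using that by (intro member_le_sum_list) auto
    then have "2 ^ k - 1 \<le> i" unfolding forest_sum .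
    then have "2 ^ k \<le> (2::nat) ^ L" using assms(2) by linarith
    then show ?thesis by simp
  qed
  have "distinct (tl (forest i))" "set (tl (forest i)) \<subseteq> {1..L}"
    using forest_shape[of i] L by (auto simp: strict_sorted_iff dest: list.set_sel(2)[rotated])
      (metis list.sel(2) list.set_sel(2))+
  then have "length (tl (forest i)) \<le> card {1..L}"
    by (metis card_mono distinct_card finite_atLeastAtMost)
  then have "length (forest i) \<le> L + 1" by simp
  then show ?thesis using descent_forest[of i L t] L assms(1) by simp
qed

section \<open>Pieces of a trajectory that fit into a square\<close>

definition fits :: "real \<Rightarrow> trajectory \<Rightarrow> real \<Rightarrow> real \<Rightarrow> point \<Rightarrow> bool" where
  "fits s V a b c \<longleftrightarrow> (\<forall>t\<in>{a..b}. traj_pos V t \<in> square s c)"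

lemma fits_iff: "fits s V a b c \<longleftrightarrow>
    (\<forall>t\<in>{a..b}. fst c \<le> fst (traj_pos V t) \<and> fst (traj_pos V t) \<le> fst c + s) \<and>
    (\<forall>t\<in>{a..b}. snd c \<le> snd (traj_pos V t) \<and> snd (traj_pos V t) \<le> snd c + s)"
  by (auto simp: fits_def square_def)

lemma fits_subset: "fits s V a b c \<Longrightarrow> a \<le> u \<Longrightarrow> v \<le> b \<Longrightarrow> fits s V u v c"
  by (auto simp: fits_def)

text \<open>The bounds are attained, so any range that contains the coordinate on the whole interval
  contains \<open>lo\<close> and \<open>hi\<close>. This makes the greedy cut the latest possible
  one.\<close>

definition hull_on :: "(real \<Rightarrow> real) \<Rightarrow> real \<Rightarrow> real \<Rightarrow> real \<Rightarrow> real \<Rightarrow> bool" where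
  "hull_on f a b lo hi \<longleftrightarrow> a \<le> b \<and> (\<forall>t\<in>{a..b}. lo \<le> f t \<and> f t \<le> hi) \<and>
     (\<exists>t\<in>{a..b}. f t = lo) \<and> (\<exists>t\<in>{a..b}. f t = hi)"

lemma hull_on_point: "hull_on f a a (f a) (f a)"
  by (auto simp: hull_on_def)

lemma hull_on_end: "hull_on f a b lo hi \<Longrightarrow> lo \<le> f b \<and> f b \<le> hi"
  by (auto simp: hull_on_def)

text \<open>The fraction of an edge with displacement \<open>d\<close> that a coordinate can travel
  from \<open>p\<close> before its total extent exceeds \<open>s\<close>. A coordinate at rest
  imposes no limit, expressed by the value 1 for the whole edge.\<close>

definition reach :: "real \<Rightarrow> real \<Rightarrow> real \<Rightarrow> real \<Rightarrow> real \<Rightarrow> real" where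
  "reach s lo hi p d = (if 0 < d then (lo + s - p) / d else if d < 0 then (hi - s - p) / d else 1)"

lemma reach_nonneg: "lo \<le> p \<Longrightarrow> p \<le> hi \<Longrightarrow> hi - lo \<le> s \<Longrightarrow> 0 \<le> reach s lo hi p d"
  by (auto simp: reach_def divide_nonneg_pos divide_nonpos_neg)

locale linear_piece =
  fixes f :: "real \<Rightarrow> real" and t0 D p d :: real
  assumes D: "D > 0" and f: "\<And>t. t0 \<le> t \<Longrightarrow> t \<le> t0 + D \<Longrightarrow> f t = p + (t - t0) / D * d"
begin

lemma f_at: "0 \<le> m \<Longrightarrow> m \<le> 1 \<Longrightarrow> f (t0 + m * D) = p + m * d"
  using D by (subst f) (auto simp: mult_left_le_one_le)

lemma between:
  assumes "t0 \<le> t" "t \<le> t0 + m * D" "m \<le> 1"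
  shows "min p (p + m * d) \<le> f t" "f t \<le> max p (p + m * d)"
proof -
  define r where "r = (t - t0) / D"
  have "m * D \<le> 1 * D" using assms D by (intro mult_right_mono) auto
  then have ft: "f t = p + r * d" using assms unfolding r_def by (intro f) auto
  have "0 \<le> r" "r \<le> m" unfolding r_def using assms D by (auto simp: divide_simps)
  then have "0 \<le> d \<Longrightarrow> 0 \<le> r * d \<and> r * d \<le> m * d" "d \<le> 0 \<Longrightarrow> m * d \<le> r * d \<and> r * d \<le> 0"
    by (auto simp: mult_right_mono mult_right_mono_neg mult_nonneg_nonpos)
  then show "min p (p + m * d) \<le> f t" "f t \<le> max p (p + m * d)" unfolding ft by linarith+
qed

lemma hull_extend:
  assumes h: "hull_on f a t0 lo hi" and m: "0 \<le> m" "m \<le> 1"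
  shows "hull_on f a (t0 + m * D) (min lo (p + m * d)) (max hi (p + m * d))"
proof -
  have p: "f t0 = p" using f_at[of 0] by simp
  have a: "a \<le> t0" and lp: "lo \<le> p" "p \<le> hi" using h p by (auto simp: hull_on_def)
  have e: "t0 \<le> t0 + m * D" using m D by simp
  have "min lo (p + m * d) \<le> f t \<and> f t \<le> max hi (p + m * d)" if "t \<in> {a..t0 + m * D}" for t
  proof (cases "t \<le> t0")
    case True
    then have "lo \<le> f t \<and> f t \<le> hi" using h that by (auto simp: hull_on_def)
    then show ?thesis by auto
  next
    case False
    then show ?thesis using between[of t m] that m lp by auto
  qed
  moreover have "\<exists>t\<in>{a..t0 + m * D}. f t = lo" "\<exists>t\<in>{a..t0 + m * D}. f t = hi"
    using h e unfolding hull_on_def by fastforce+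
  moreover have "f (t0 + m * D) = p + m * d" "t0 + m * D \<in> {a..t0 + m * D}" using f_at m a e by auto
  ultimately show ?thesis unfolding hull_on_def using a e by (auto simp: min_def max_def)
qed

lemma hull_extend_le:
  assumes h: "hull_on f a t0 lo hi" "hi - lo \<le> s" and m: "0 \<le> m" "m \<le> reach s lo hi p d"
  shows "max hi (p + m * d) - min lo (p + m * d) \<le> s"
proof -
  have p: "f t0 = p" using f_at[of 0] by simp
  have lp: "lo \<le> p" "p \<le> hi" using h p by (auto simp: hull_on_def)
  consider "d > 0" | "d < 0" | "d = 0" by linarith
  then show ?thesis
  proof cases
    case 1
    then have "m * d \<le> lo + s - p" "0 \<le> m * d" using m by (auto simp: reach_def field_simps)
    then show ?thesis using lp h(2) by linarith
  next
    case 2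
    then have "m * d \<ge> hi - s - p" using m by (auto simp: reach_def field_simps)
    moreover have "m * d \<le> 0" using m 2 by (simp add: mult_nonneg_nonpos)
    ultimately show ?thesis using lp h(2) by linarith
  qed (use lp h in auto)
qed

text \<open>Past the reach, a rising coordinate exceeds \<open>lo + s\<close> and a falling one
  drops below \<open>hi - s\<close>. Since \<open>lo\<close> and \<open>hi\<close> were attained
  before, no range of length \<open>s\<close> contains all values.\<close>

lemma overflow:
  assumes h: "hull_on f a t0 lo hi" and m: "reach s lo hi p d < m" "0 \<le> m" "m \<le> 1"
    and z: "\<forall>t\<in>{a..t0 + m * D}. z \<le> f t \<and> f t \<le> z + s"
  shows False
proof -
  have "a \<le> t0" "t0 \<le> t0 + m * D" using h m D by (auto simp: hull_on_def)
  then have e: "z \<le> p + m * d" "p + m * d \<le> z + s"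
    using bspec[OF z, of "t0 + m * D"] f_at[of m] m by auto
  have l: "z \<le> lo" "hi \<le> z + s" using h z \<open>t0 \<le> t0 + m * D\<close> unfolding hull_on_def by fastforce+
  show False
  proof (cases "d > 0")
    case True
    then have "lo + s < p + m * d" using m by (auto simp: reach_def field_simps)
    then show False using e l by linarith
  next
    case False
    then have "d < 0" using m by (auto simp: reach_def split: if_splits)
    then have "p + m * d < hi - s" using m by (auto simp: reach_def field_simps)
    then show False using e l by linarith
  qed
qed

end

section \<open>Records arising from a single edge\<close>

lemma valid_traj_less:
  assumes "valid_traj V" "i < j" "j < length V"
  shows "snd (V ! i) < snd (V ! j)"
  using assms by (auto simp: valid_traj_def sorted_wrt_iff_nth_less)

lemma traj_pos_edge:
  assumes V: "valid_traj V" and i: "Suc i < length V" and t: "snd (V ! i) \<le> t" "t \<le> snd (V ! Suc i)"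
  shows "traj_pos V t = fst (V ! i) +
    ((t - snd (V ! i)) / (snd (V ! Suc i) - snd (V ! i))) *\<^sub>R (fst (V ! Suc i) - fst (V ! i))"
proof -
  define Q where "Q j \<longleftrightarrow> j + 1 < length V \<and> snd (V ! j) \<le> t \<and> t \<le> snd (V ! (j + 1))" for j
  define k where "k = (LEAST j. Q j)"
  have "Q i" using i t by (simp add: Q_def)
  then have "Q k" "k \<le> i" unfolding k_def by (auto intro: LeastI Least_le)
  have *: "traj_pos V t = fst (V ! k) +
    ((t - snd (V ! k)) / (snd (V ! Suc k) - snd (V ! k))) *\<^sub>R (fst (V ! Suc k) - fst (V ! k))"
    using i unfolding traj_pos_def k_def Q_def by (simp add: Let_def)
  show ?thesis
  proof (cases "k = i")
    case False
    \<comment> \<open>An earlier edge can contain \<open>t\<close> only if it ends there, in the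
      common vertex, where both formulas give the same point.\<close>
    then have "Suc k \<le> i" using \<open>k \<le> i\<close> by simp
    have "t \<le> snd (V ! Suc k)" using \<open>Q k\<close> by (simp add: Q_def)
    moreover have "snd (V ! Suc k) < snd (V ! i)" if "Suc k \<noteq> i"
      using valid_traj_less[OF V, of "Suc k" i] \<open>Suc k \<le> i\<close> that i by simp
    ultimately have "Suc k = i" "t = snd (V ! i)" using t by force+
    moreover have "snd (V ! k) < snd (V ! i)"
      using valid_traj_less[OF V, of k i] \<open>Suc k \<le> i\<close> i by simp
    ultimately show ?thesis using * by auto
  qed (use * in simp)
qed

text \<open>The explicit square gives the lower bound for the reported weight. The bound by
  \<open>cap\<close> on all fitting intervals inside the record, and the one by \<open>r\<close> on
  those starting at \<open>l\<close>, give the upper bound for a hotspot. The latter stops at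
  \<open>t_end V\<close>, since \<open>traj_pos\<close> describes no motion beyond the time
  span.\<close>

definition good_record ::
    "real \<Rightarrow> trajectory \<Rightarrow> real \<Rightarrow> real \<Rightarrow> real \<Rightarrow> real \<Rightarrow> real \<Rightarrow> real \<Rightarrow> real \<Rightarrow> bool" where
  "good_record s V l r cap cx cy vx vy \<longleftrightarrow> l \<le> r \<and> cap \<le> r - l \<and>
     (\<forall>u v. l \<le> u \<and> v \<le> r \<and> v - u \<le> cap \<longrightarrow> fits s V u v (cx + vx * (u - l), cy + vy * (u - l))) \<and>
     (\<forall>a b c. l \<le> a \<and> a \<le> b \<and> b \<le> r \<and> fits s V a b c \<longrightarrow> b - a \<le> cap) \<and>
     (\<forall>b c. b \<le> t_end V \<and> fits s V l b c \<longrightarrow> b \<le> r)"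

definition box_on :: "real \<Rightarrow> trajectory \<Rightarrow> real \<Rightarrow> real \<Rightarrow> real \<Rightarrow> real \<Rightarrow> real \<Rightarrow> real \<Rightarrow> bool" where
  "box_on s V a t x1 x2 y1 y2 \<longleftrightarrow>
     hull_on (fst \<circ> traj_pos V) a t x1 x2 \<and> x2 - x1 \<le> s \<and>
     hull_on (snd \<circ> traj_pos V) a t y1 y2 \<and> y2 - y1 \<le> s"

lemma box_on_fits: "box_on s V a t x1 x2 y1 y2 \<Longrightarrow> fits s V a t (x1, y1)"
  unfolding box_on_def hull_on_def fits_iff by fastforce

text \<open>For a greedy piece one square serves the whole duration, hence the full cap and velocity
  0.\<close>

lemma box_on_record:
  assumes "box_on s V a t x1 x2 y1 y2" "\<And>b c. b \<le> t_end V \<Longrightarrow> fits s V a b c \<Longrightarrow> b \<le> t"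
  shows "good_record s V a t (t - a) x1 y1 0 0"
  unfolding good_record_def
  using assms(2) fits_subset[OF box_on_fits[OF assms(1)]] assms(1)
  by (auto simp: box_on_def hull_on_def)

locale edge =
  fixes s :: real and V :: trajectory and i :: nat
  assumes s: "s > 0" and V: "valid_traj V" and i: "Suc i < length V"
begin

abbreviation "t0 \<equiv> snd (V ! i)"
abbreviation "t1 \<equiv> snd (V ! Suc i)"
abbreviation "px \<equiv> fst (fst (V ! i))"
abbreviation "py \<equiv> snd (fst (V ! i))"
abbreviation "qx \<equiv> fst (fst (V ! Suc i))"
abbreviation "qy \<equiv> snd (fst (V ! Suc i))"
abbreviation "D \<equiv> t1 - t0"
abbreviation "dx \<equiv> qx - px"
abbreviation "dy \<equiv> qy - py"
text \<open>The time in which the faster coordinate covers \<open>s\<close>. On an edge at rest the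
  division by zero makes it 0, but such an edge never stops a piece, as \<open>moving\<close>
  shows.\<close>

abbreviation "tau \<equiv> D * s / max \<bar>dx\<bar> \<bar>dy\<bar>"
abbreviation "X \<equiv> fst \<circ> traj_pos V"
abbreviation "Y \<equiv> snd \<circ> traj_pos V"

lemma D_pos: "D > 0"
  using valid_traj_less[OF V, of i "Suc i"] i by simp

sublocale X: linear_piece X t0 D px dx
  using D_pos traj_pos_edge[OF V i] by unfold_locales auto

sublocale Y: linear_piece Y t0 D py dy
  using D_pos traj_pos_edge[OF V i] by unfold_locales auto

context
  fixes a x1 x2 y1 y2 lam :: real
  assumes box: "box_on s V a t0 x1 x2 y1 y2"
  defines "lam \<equiv> min 1 (min (reach s x1 x2 px dx) (reach s y1 y2 py dy))"
begin

lemma lam_bounds: "0 \<le> lam" "lam \<le> 1"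
proof -
  have "x1 \<le> px" "px \<le> x2" "y1 \<le> py" "py \<le> y2"
    using box X.f_at[of 0] Y.f_at[of 0] hull_on_end[of X a t0 x1 x2] hull_on_end[of Y a t0 y1 y2]
    by (auto simp: box_on_def)
  then show "0 \<le> lam" using reach_nonneg box unfolding lam_def box_on_def by auto
qed (simp add: lam_def)

lemma box_on_extend:
  assumes "0 \<le> m" "m \<le> lam"
  shows "box_on s V a (t0 + m * D) (min x1 (px + m * dx)) (max x2 (px + m * dx))
    (min y1 (py + m * dy)) (max y2 (py + m * dy))"
proof -
  have m: "m \<le> 1" "m \<le> reach s x1 x2 px dx" "m \<le> reach s y1 y2 py dy" using assms(2) by (simp_all add: lam_def)
  have b: "hull_on X a t0 x1 x2" "x2 - x1 \<le> s" "hull_on Y a t0 y1 y2" "y2 - y1 \<le> s"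
    using box by (simp_all add: box_on_def)
  show ?thesis
    unfolding box_on_def
    using X.hull_extend[OF b(1) assms(1) m(1)] X.hull_extend_le[OF b(1,2) assms(1) m(2)]
      Y.hull_extend[OF b(3) assms(1) m(1)] Y.hull_extend_le[OF b(3,4) assms(1) m(3)] by blast
qed

lemma box_on_whole: "1 \<le> lam \<Longrightarrow> box_on s V a t1 (min x1 qx) (max x2 qx) (min y1 qy) (max y2 qy)"
  using box_on_extend[of 1] by simp

lemma piece_record:
  assumes "lam < 1"
  shows "good_record s V a (t0 + lam * D) (t0 + lam * D - a)
    (min x1 (px + lam * dx)) (min y1 (py + lam * dy)) 0 0"
proof (rule box_on_record[OF box_on_extend[OF lam_bounds(1) order_refl]])
  fix b c assume b: "fits s V a b c"
  show "b \<le> t0 + lam * D"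
  proof (rule ccontr)
    assume late: "\<not> b \<le> t0 + lam * D"
    \<comment> \<open>\<open>b\<close> may lie beyond this edge, while \<open>overflow\<close> only
      speaks about the edge, so the interval is cut back to its end. Because of
      \<open>lam < 1\<close> the fraction \<open>m\<close> still exceeds \<open>lam\<close>.\<close>
    define m where "m = min 1 ((b - t0) / D)"
    have r: "lam < (b - t0) / D" using late D_pos by (simp add: pos_less_divide_eq)
    have "m * D \<le> (b - t0) / D * D" unfolding m_def using D_pos by (intro mult_right_mono) auto
    then have m: "lam < m" "0 \<le> m" "m \<le> 1" "t0 + m * D \<le> b"
      using assms r D_pos lam_bounds unfolding m_def by auto
    have fit: "fits s V a (t0 + m * D) c" using fits_subset[OF b] m by auto
    have "reach s x1 x2 px dx < m \<or> reach s y1 y2 py dy < m" using m unfolding lam_def by auto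
    then show False
      using X.overflow[of a x1 x2 s m "fst c"] Y.overflow[of a y1 y2 s m "snd c"] fit m box
      unfolding fits_iff box_on_def by auto
  qed
qed

lemma moving: "lam < 1 \<Longrightarrow> 0 < max \<bar>dx\<bar> \<bar>dy\<bar>"
  unfolding lam_def reach_def by (auto simp: max_def split: if_splits)

end

lemma speed_bound:
  assumes "0 < max \<bar>dx\<bar> \<bar>dy\<bar>"
  shows "\<bar>dx / D\<bar> * tau \<le> s" "\<bar>dy / D\<bar> * tau \<le> s" "\<bar>dx / D\<bar> * w \<le> s \<and> \<bar>dy / D\<bar> * w \<le> s \<Longrightarrow> w \<le> tau"
proof -
  have *: "\<bar>d / D\<bar> * tau = \<bar>d\<bar> / max \<bar>dx\<bar> \<bar>dy\<bar> * s" for d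
    using D_pos by (simp add: abs_divide)
  have "\<bar>dx\<bar> / max \<bar>dx\<bar> \<bar>dy\<bar> \<le> 1" "\<bar>dy\<bar> / max \<bar>dx\<bar> \<bar>dy\<bar> \<le> 1" using assms by auto
  then have "\<bar>dx\<bar> / max \<bar>dx\<bar> \<bar>dy\<bar> * s \<le> 1 * s" "\<bar>dy\<bar> / max \<bar>dx\<bar> \<bar>dy\<bar> * s \<le> 1 * s"
    using s by (intro mult_right_mono; simp)+
  then show "\<bar>dx / D\<bar> * tau \<le> s" "\<bar>dy / D\<bar> * tau \<le> s" unfolding * by simp_all
next
  assume w: "\<bar>dx / D\<bar> * w \<le> s \<and> \<bar>dy / D\<bar> * w \<le> s"
  then have "max \<bar>dx\<bar> \<bar>dy\<bar> / D * w \<le> s" using D_pos by (auto simp: max_def abs_divide)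
  then show "w \<le> tau" using assms D_pos by (simp add: field_simps)
qed

lemma pos_from:
  assumes "0 \<le> m" "m \<le> 1" "b = t0 + m * D" "b \<le> t" "t \<le> t1"
  shows "X t = px + m * dx + dx / D * (t - b)" "Y t = py + m * dy + dy / D * (t - b)"
proof -
  have "t0 \<le> b" using assms D_pos by simp
  then have "(t - t0) / D = m + (t - b) / D" using assms(3) D_pos by (simp add: field_simps)
  moreover have "(m + w / E) * d = m * d + d / E * w" for w E d :: real
    by (simp add: algebra_simps)
  ultimately have "(t - t0) / D * d = m * d + d / D * (t - b)" for d by metis
  then show "X t = px + m * dx + dx / D * (t - b)" "Y t = py + m * dy + dy / D * (t - b)"
    using X.f[of t] Y.f[of t] assms(4,5) \<open>t0 \<le> b\<close> by simp_all
qed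

text \<open>The two end positions suffice: neither coordinate differs by more than \<open>s\<close>
  between them, and constant speed turns this into a bound on time.\<close>

lemma edge_fits_bound:
  assumes "t0 \<le> u" "u \<le> v" "v \<le> t1" "fits s V u v c" "0 < max \<bar>dx\<bar> \<bar>dy\<bar>"
  shows "v - u \<le> tau"
proof (rule speed_bound(3)[OF assms(5)])
  have k: "k * (v - t0) - k * (u - t0) = k * (v - u)" for k :: real
    by (simp add: algebra_simps)
  have pos: "X v = px + dx / D * (v - t0)" "Y v = py + dy / D * (v - t0)"
    "X u = px + dx / D * (u - t0)" "Y u = py + dy / D * (u - t0)"
    using pos_from[of 0 t0 v] pos_from[of 0 t0 u] assms by auto
  have "X v - X u = dx / D * (v - u)" "Y v - Y u = dy / D * (v - u)"
    unfolding pos k[symmetric] by simp_all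
  moreover have "\<forall>t\<in>{u, v}. fst c \<le> X t \<and> X t \<le> fst c + s \<and> snd c \<le> Y t \<and> Y t \<le> snd c + s"
    using assms(2,4) by (simp add: fits_iff)
  then have "\<bar>X v - X u\<bar> \<le> s" "\<bar>Y v - Y u\<bar> \<le> s" unfolding abs_le_iff by auto
  ultimately show "\<bar>dx / D\<bar> * (v - u) \<le> s \<and> \<bar>dy / D\<bar> * (v - u) \<le> s"
    using assms(2) by (simp add: abs_mult)
qed

text \<open>A rest that fits into a square does not become a record of its own: it opens the next
  piece, which may continue along later edges. Its box is spanned by the two ends of the
  segment.\<close>

lemma rest_box:
  assumes m: "0 \<le> m" "m \<le> 1" "b = t0 + m * D" and b: "t1 - b \<le> tau" "0 < max \<bar>dx\<bar> \<bar>dy\<bar>"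
  shows "box_on s V b t1 (min (px + m * dx) qx) (max (px + m * dx) qx)
    (min (py + m * dy) qy) (max (py + m * dy) qy)"
proof -
  have "m * D \<le> 1 * D" "0 \<le> m * D"
    using m D_pos by (intro mult_right_mono mult_nonneg_nonneg; simp)+
  from add_left_mono[OF this(1), of t0] add_left_mono[OF this(2), of t0]
  have bt: "b \<le> t1" "t0 \<le> b" unfolding m(3) by simp_all
  have *: "hull_on f b t1 (min (f b) (f t1)) (max (f b) (f t1))"
    if f: "\<And>t. b \<le> t \<Longrightarrow> t \<le> t1 \<Longrightarrow> f t = f b + v * (t - b)" for f v
  proof -
    have "min (f b) (f t1) \<le> f t \<and> f t \<le> max (f b) (f t1)" if t: "b \<le> t" "t \<le> t1" for t
    proof -
      have "v * (t - b) \<le> v * (t1 - b) \<and> 0 \<le> v * (t - b) \<or> v * (t - b) \<ge> v * (t1 - b) \<and> 0 \<ge> v * (t - b)"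
        using t by (cases "v \<ge> 0") (auto simp: mult_left_mono mult_left_mono_neg mult_nonpos_nonneg)
      then show ?thesis using f[OF t] f[OF bt(1) order_refl] by linarith
    qed
    then show ?thesis using bt by (fastforce simp: hull_on_def min_def max_def)
  qed
  have e: "X b = px + m * dx" "Y b = py + m * dy" "X t1 = qx" "Y t1 = qy"
    using X.f_at[of m] Y.f_at[of m] X.f_at[of 1] Y.f_at[of 1] m by auto
  have "hull_on X b t1 (min (X b) (X t1)) (max (X b) (X t1))"
    using pos_from(1)[OF m] pos_from(1)[OF m, of b] bt by (intro *[of X "dx / D"]) auto
  moreover have "hull_on Y b t1 (min (Y b) (Y t1)) (max (Y b) (Y t1))"
    using pos_from(2)[OF m] pos_from(2)[OF m, of b] bt by (intro *[of Y "dy / D"]) auto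
  moreover have "\<bar>dx / D\<bar> * (t1 - b) \<le> s" "\<bar>dy / D\<bar> * (t1 - b) \<le> s"
    using speed_bound(1,2)[OF b(2)] mult_left_mono[OF b(1), of "\<bar>dx / D\<bar>"]
      mult_left_mono[OF b(1), of "\<bar>dy / D\<bar>"] by auto
  then have "\<bar>X t1 - X b\<bar> \<le> s" "\<bar>Y t1 - Y b\<bar> \<le> s"
    using pos_from[OF m, of t1] pos_from[OF m, of b] bt by (simp_all add: abs_mult)
  then have "max (X b) (X t1) - min (X b) (X t1) \<le> s" "max (Y b) (Y t1) - min (Y b) (Y t1) \<le> s" by linarith+
  ultimately show ?thesis unfolding box_on_def e by blast
qed

text \<open>The corner follows the position at the start of the interval. The term
  \<open>min 0 (dx / D * tau)\<close> shifts the square back if the coordinate decreases, so that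
  the motion during \<open>tau\<close> stays inside. An interval from \<open>b\<close> that passed
  \<open>t1\<close> would contain the whole rest, which is longer than \<open>tau\<close>.\<close>

lemma rest_record:
  assumes m: "0 \<le> m" "m \<le> 1" "b = t0 + m * D" and b: "tau < t1 - b" "0 < max \<bar>dx\<bar> \<bar>dy\<bar>"
  shows "good_record s V b t1 tau (px + m * dx + min 0 (dx / D * tau)) (py + m * dy + min 0 (dy / D * tau))
    (dx / D) (dy / D)"
proof -
  have "m * D \<le> 1 * D" "0 \<le> m * D"
    using m D_pos by (intro mult_right_mono mult_nonneg_nonneg; simp)+
  from add_left_mono[OF this(1), of t0] add_left_mono[OF this(2), of t0]
  have bt: "b \<le> t1" "t0 \<le> b" unfolding m(3) by simp_all
  have band: "min 0 (v * z) \<le> v * w \<and> v * w \<le> min 0 (v * z) + s"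
    if "0 \<le> w" "w \<le> z" "\<bar>v\<bar> * z \<le> s" for v w z :: real
  proof (cases "v \<ge> 0")
    case True
    then have "v * w \<le> v * z" "0 \<le> v * w" "v * z \<le> s" using that by (simp_all add: mult_left_mono)
    then show ?thesis by linarith
  next
    case False
    then have "v * z \<le> v * w" "v * w \<le> 0" "- (v * z) \<le> s"
      using that by (simp_all add: mult_left_mono_neg mult_nonpos_nonneg)
    then show ?thesis by linarith
  qed
  have band': "c + z + k \<le> F \<and> F \<le> c + z + k + s" if "z \<le> w \<and> w \<le> z + s" "F = c + k + w"
    for c z k w F :: real
    using that by linarith
  have "fits s V u v (px + m * dx + min 0 (dx / D * tau) + dx / D * (u - b),
      py + m * dy + min 0 (dy / D * tau) + dy / D * (u - b))"
    if "b \<le> u" "v \<le> t1" "v - u \<le> tau" for u v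
    unfolding fits_iff fst_conv snd_conv
  proof (intro conjI ballI)
    fix t assume t: "t \<in> {u..v}"
    have w: "0 \<le> t - u" "t - u \<le> tau" using t that by auto
    have k: "c + v * (t - b) = c + v * (u - b) + v * (t - u)" for c v :: real
      by (simp add: algebra_simps)
    have tt: "b \<le> t" "t \<le> t1" using t that by auto
    have "X t = px + m * dx + dx / D * (u - b) + dx / D * (t - u)"
      "Y t = py + m * dy + dy / D * (u - b) + dy / D * (t - u)"
      by (rule trans[OF pos_from(1)[OF m tt] k], rule trans[OF pos_from(2)[OF m tt] k])
    note e = band'[OF band[OF w speed_bound(1)[OF b(2)]] this(1)] band'[OF band[OF w speed_bound(2)[OF b(2)]] this(2)]
    note e = e[unfolded o_apply]
    show "px + m * dx + min 0 (dx / D * tau) + dx / D * (u - b) \<le> fst (traj_pos V t)"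
      "fst (traj_pos V t) \<le> px + m * dx + min 0 (dx / D * tau) + dx / D * (u - b) + s"
      by (rule conjunct1[OF e(1)], rule conjunct2[OF e(1)])
    show "py + m * dy + min 0 (dy / D * tau) + dy / D * (u - b) \<le> snd (traj_pos V t)"
      "snd (traj_pos V t) \<le> py + m * dy + min 0 (dy / D * tau) + dy / D * (u - b) + s"
      by (rule conjunct1[OF e(2)], rule conjunct2[OF e(2)])
  qed
  moreover have "v - u \<le> tau" if "b \<le> u" "u \<le> v" "v \<le> t1" "fits s V u v c" for u v c
    by (rule edge_fits_bound[OF _ that(2-4) b(2)]) (use that(1) bt in linarith)
  moreover have "v \<le> t1" if "fits s V b v c" for v c
  proof (rule ccontr)
    assume "\<not> v \<le> t1"
    then have "fits s V b t1 c" using fits_subset[OF that] by auto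
    from edge_fits_bound[OF bt(2,1) order_refl this b(2)] show False using b(1) by linarith
  qed
  ultimately show ?thesis
    unfolding good_record_def using bt(1) less_imp_le[OF b(1)] by blast
qed

end

text \<open>If nonnegative, the longest duration that the record provides inside the window. It is
  negative if record and window are apart, which is harmless since maxima start from 0.\<close>

definition clip :: "real \<Rightarrow> real \<Rightarrow> real \<Rightarrow> real \<Rightarrow> real \<Rightarrow> real" where
  "clip x y l r cap = min cap (min r y - max l x)"

section \<open>Comparing a hotspot with the best clipped record\<close>

lemma weight_bdd: "x < y \<Longrightarrow>
  bdd_above (insert 0 {b - a | a b. x \<le> a \<and> a \<le> b \<and> b \<le> y \<and> (\<forall>t\<in>{a..b}. traj_pos V t \<in> r)})"
  by (rule bdd_aboveI[of _ "y - x"]) auto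

lemma weight_nonneg: "x < y \<Longrightarrow> 0 \<le> weight V x y r"
  unfolding weight_def by (rule cSup_upper[OF _ weight_bdd]) auto

lemma weight_ge_fits:
  assumes "x < y" "x \<le> a" "a \<le> b" "b \<le> y" "fits s V a b c"
  shows "b - a \<le> weight V x y (square s c)"
  unfolding weight_def using assms(2-) fits_def
  by (intro cSup_upper[OF _ weight_bdd[OF assms(1)]]) fastforce

lemma hotspot_weight_le:
  assumes "0 \<le> w" "\<And>a b c. x \<le> a \<Longrightarrow> a \<le> b \<Longrightarrow> b \<le> y \<Longrightarrow> fits s V a b c \<Longrightarrow> b - a \<le> w"
  shows "hotspot_weight s V x y \<le> w"
  unfolding hotspot_weight_def
proof (rule cSUP_least)
  fix c
  show "weight V x y (square s c) \<le> w"
    unfolding weight_def using assms(1) assms(2)[of _ _ c, unfolded fits_def]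
    by (intro cSup_least) auto
qed simp

lemma half_of_hotspot:
  fixes l :: "nat \<Rightarrow> real"
  assumes M: "0 < M" and ends: "l 0 = t_start V" "l M = t_end V"
    and good: "\<And>k. k < M \<Longrightarrow> good_record s V (l k) (l (Suc k)) (cap k) (cx k) (cy k) (vx k) (vy k)"
    and best: "0 \<le> best" "\<And>k. k < M \<Longrightarrow> clip x y (l k) (l (Suc k)) (cap k) \<le> best"
    and xy: "t_start V \<le> x" "x < y" "y \<le> t_end V"
  shows "hotspot_weight s V x y / 2 \<le> best"
proof -
  have "b - a \<le> 2 * best" if ab: "x \<le> a" "a \<le> b" "b \<le> y" "fits s V a b c" for a b c
  proof -
    have inner: "v - u \<le> best" if "k < M" "l k \<le> u" "u \<le> v" "v \<le> l (Suc k)" "a \<le> u" "v \<le> b" for k u v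
    proof -
      have "v - u \<le> cap k"
        using good[OF that(1)] that fits_subset[OF ab(4)] unfolding good_record_def by blast
      then have "v - u \<le> clip x y (l k) (l (Suc k)) (cap k)" using that ab unfolding clip_def by auto
      then show ?thesis using best(2)[OF that(1)] by linarith
    qed
    \<comment> \<open>The record in which the interval starts: being the greatest such index forces
      \<open>a < l (Suc k)\<close> whenever a further record exists.\<close>
    define k where "k = (GREATEST k. k < M \<and> l k \<le> a)"
    have "0 < M \<and> l 0 \<le> a" using M ends xy ab by simp
    then have k: "k < M" "l k \<le> a" and kmax: "\<And>j. j < M \<Longrightarrow> l j \<le> a \<Longrightarrow> j \<le> k"
      unfolding k_def
      using GreatestI_nat[of "\<lambda>k. k < M \<and> l k \<le> a" 0 M] Greatest_le_nat[of "\<lambda>k. k < M \<and> l k \<le> a" _ M]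
      by auto
    show ?thesis
    proof (cases "b \<le> l (Suc k)")
      case True
      then show ?thesis using inner[of k a b] k ab best(1) by simp
    next
      case False
      have S: "Suc k < M"
      proof (rule ccontr)
        assume "\<not> ?thesis"
        then have "Suc k = M" using k by simp
        then show False using False ends ab xy by simp
      qed
      then have "a < l (Suc k)" using kmax[of "Suc k"] by force
      \<comment> \<open>The part after the cut fits into the same square and starts exactly where
        record \<open>Suc k\<close> does, so it cannot outlast that record.\<close>
      moreover have "b \<le> l (Suc (Suc k))"
      proof -
        have "fits s V (l (Suc k)) b c" using fits_subset[OF ab(4)] \<open>a < l (Suc k)\<close> by simp
        moreover have "b \<le> t_end V" using ab xy by simp
        ultimately show ?thesis using good[OF S] unfolding good_record_def by blast
      qed
      ultimately show ?thesis
        using inner[of k a "l (Suc k)"] inner[of "Suc k" "l (Suc k)" b] k S False by simp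
    qed
  qed
  then have "hotspot_weight s V x y \<le> 2 * best" using best(1) by (intro hotspot_weight_le) auto
  then show ?thesis by simp
qed

lemma clip_attained:
  assumes "good_record s V l r cap cx cy vx vy" "x < y" "0 \<le> clip x y l r cap"
  shows "clip x y l r cap \<le> weight V x y (square s (cx + vx * (max l x - l), cy + vy * (max l x - l)))"
proof -
  let ?u = "max l x" and ?w = "clip x y l r cap"
  have "fits s V ?u (?u + ?w) (cx + vx * (?u - l), cy + vy * (?u - l))"
    using assms(1) unfolding good_record_def by (auto simp: clip_def)
  then show ?thesis using weight_ge_fits[of x y ?u "?u + ?w"] assms(2,3) by (auto simp: clip_def)
qed

section \<open>Memory layout\<close>

text \<open>The input fills all low cells, so cells 1 to 127 are first copied to \<open>128 * n\<close> and beyond. The only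
  cell whose content may be overwritten before that is cell 0, which serves as the address register.\<close>

definition save_code :: "nat \<Rightarrow> instr list" where
  "save_code k = replicate 7 (Arith AAdd 0 0 0) @ [Store 0 1, Const 1 1] @
     concat (map (\<lambda>j. [Arith AAdd 0 0 1, Store 0 j]) [2..<k])"

definition input_saved :: "trajectory \<Rightarrow> mem \<Rightarrow> bool" where
  "input_saved V \<sigma> \<longleftrightarrow> (\<forall>a. 1 \<le> a \<and> a \<le> 3 * length V \<longrightarrow>
     \<sigma> (if a \<le> 127 then 128 * length V + a - 1 else a) = encode_traj V a)"

lemma runs_double:
  "code_at P pc (replicate k (Arith AAdd 0 0 0)) \<Longrightarrow> runs P k pc m (pc + k) (m(0 := 2 ^ k * m 0))"
proof (induction k arbitrary: pc m)
  case (Suc k)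
  have c: "pc < length P" "P ! pc = Arith AAdd 0 0 0" "code_at P (Suc pc) (replicate k (Arith AAdd 0 0 0))"
    using Suc.prems by (auto simp: code_at_Cons)
  have "(m(0 := 2 * m 0))(0 := 2 ^ k * (m(0 := 2 * m 0)) 0) = m(0 := 2 ^ Suc k * m 0)" by (simp add: mult_ac)
  then have "runs P k (Suc pc) (m(0 := 2 * m 0)) (pc + Suc k) (m(0 := 2 ^ Suc k * m 0))"
    using Suc.IH[OF c(3), of "m(0 := 2 * m 0)"] by (simp only: add_Suc_shift)
  moreover have "exec_instr (P ! pc) (pc, m) = (Suc pc, m(0 := 2 * m 0))" using c(2) by simp
  ultimately show ?case using c(1) runs_step by blast
qed (simp add: runs_refl)

text \<open>Seven doublings turn \<open>n\<close> into \<open>128 * n\<close> without a register for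
  a constant. Once cell 1 is saved it can hold the increment 1. Cell \<open>j\<close> is copied to
  \<open>128 * n + j - 1\<close>, above the low cells and above the input, and cell 0 ends up
  pointing to the last copy, whence \<open>k - 2\<close>.\<close>

lemma runs_save_code:
  assumes "code_at P 0 (save_code k)" "2 \<le> k" "k \<le> 128" "m 0 = real n" "2 \<le> n"
  shows "\<exists>m'. runs P (length (save_code k)) 0 m (length (save_code k)) m' \<and>
    m' 0 = 128 * real n + real k - 2 \<and> m' 1 = 1 \<and>
    (\<forall>a. m' a = (if a = 0 then 128 * real n + real k - 2 else if a = 1 then 1
       else if 128 * n \<le> a \<and> a < 128 * n + k - 1 then m (a - 128 * n + 1) else m a))"
  using assms(2,1,3)
proof (induction k rule: dec_induct)
  case base
  let ?m = "m(0 := 128 * real n, 128 * n := m 1, 1 := 1)"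
  have c: "code_at P 0 (replicate 7 (Arith AAdd 0 0 0))" "code_at P 7 [Store 0 1, Const 1 1]"
    using base(1) unfolding save_code_def by (simp_all only: code_at_append) simp_all
  have a: "nat \<lfloor>128 * real n\<rfloor> = 128 * n" by linarith
  have "runs P 7 0 m 7 (m(0 := 128 * real n))" using runs_double[OF c(1), of m] assms(4) by simp
  moreover have "exec_instr (Store 0 1) (7, m(0 := 128 * real n)) = (8, m(0 := 128 * real n, 128 * n := m 1))"
    "exec_instr (Const 1 1) (8, m(0 := 128 * real n, 128 * n := m 1)) = (9, ?m)"
    using a by simp_all
  then have "runs P 2 7 (m(0 := 128 * real n)) 9 ?m"
    using c(2) unfolding numeral_2_eq_2 by (intro runs_step[OF _ _ runs_step[OF _ _ runs_refl]]) (auto simp: code_at_Cons)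
  ultimately have "runs P (7 + 2) 0 m 9 ?m" by (rule runs_trans)
  moreover have "7 + 2 = length (save_code 2)" "9 = length (save_code 2)" by (simp_all add: save_code_def)
  ultimately have "runs P (length (save_code 2)) 0 m (length (save_code 2)) ?m" by metis
  moreover have "?m 0 = 128 * real n + real 2 - 2 \<and> ?m 1 = 1 \<and>
    (\<forall>a. ?m a = (if a = 0 then 128 * real n + real 2 - 2 else if a = 1 then 1
       else if 128 * n \<le> a \<and> a < 128 * n + 2 - 1 then m (a - 128 * n + 1) else m a))"
    using assms(5) by auto
  ultimately show ?case by (intro exI[of _ ?m] conjI) blast+
next
  case (step k)
  have sc: "save_code (Suc k) = save_code k @ [Arith AAdd 0 0 1, Store 0 k]"
    using step.hyps by (simp add: save_code_def)
  let ?q = "length (save_code k)"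
  have c: "code_at P 0 (save_code k)" "code_at P ?q [Arith AAdd 0 0 1, Store 0 k]"
    using step.prems(1) unfolding sc by (simp_all add: code_at_append)
  obtain m1 where m1: "runs P ?q 0 m ?q m1" "m1 0 = 128 * real n + real k - 2" "m1 1 = 1"
    "\<And>a. m1 a = (if a = 0 then 128 * real n + real k - 2 else if a = 1 then 1
       else if 128 * n \<le> a \<and> a < 128 * n + k - 1 then m (a - 128 * n + 1) else m a)"
    using step.IH[OF c(1)] step.prems by auto
  have ad: "nat \<lfloor>128 * real n + real k - 1\<rfloor> = 128 * n + k - 1" using step.hyps by linarith
  have "m1 k = m k" using step m1(4)[of k] assms(5) by simp
  define m2 where "m2 = m1(0 := 128 * real n + real (Suc k) - 2, 128 * n + k - 1 := m k)"
  have "exec_instr (Arith AAdd 0 0 1) (?q, m1) = (Suc ?q, m1(0 := 128 * real n + real (Suc k) - 2))"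
    using m1(2,3) by simp
  moreover have "exec_instr (Store 0 k) (Suc ?q, m1(0 := 128 * real n + real (Suc k) - 2)) = (Suc (Suc ?q), m2)"
    using step.hyps \<open>m1 k = m k\<close> ad by (simp add: m2_def del: fun_upd_apply) (simp add: fun_upd_def)
  ultimately have "runs P 2 ?q m1 (Suc (Suc ?q)) m2"
    using c(2) unfolding numeral_2_eq_2 by (intro runs_step[OF _ _ runs_step[OF _ _ runs_refl]]) (auto simp: code_at_Cons)
  from runs_trans[OF m1(1) this] have "runs P (length (save_code (Suc k))) 0 m (length (save_code (Suc k))) m2"
    by (simp add: sc)
  moreover have "m2 a = (if a = 0 then 128 * real n + real (Suc k) - 2 else if a = 1 then 1
       else if 128 * n \<le> a \<and> a < 128 * n + Suc k - 1 then m (a - 128 * n + 1) else m a)" for a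
  proof (cases "a = 128 * n + k - 1")
    case True
    then have "a - 128 * n + 1 = k" "a \<noteq> 0" "a \<noteq> 1" "128 * n \<le> a" "a < 128 * n + Suc k - 1"
      using step.hyps assms(5) by simp_all
    moreover have "m2 a = m k" using True by (simp add: m2_def)
    ultimately show ?thesis by simp
  next
    case False
    then show ?thesis using m1(4)[of a] step.hyps by (auto simp: m2_def)
  qed
  moreover from this[of 0] this[of 1] step.hyps assms(5)
  have "m2 0 = 128 * real n + real (Suc k) - 2" "m2 1 = 1" by simp_all
  ultimately show ?case by blast
qed

lemma input_saved_code:
  assumes "2 \<le> length V"
    "\<And>a. m' a = (if a = 0 then z else if a = 1 then 1
       else if 128 * length V \<le> a \<and> a < 128 * length V + 128 - 1 then encode_traj V (a - 128 * length V + 1)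
       else encode_traj V a)"
  shows "input_saved V m'"
  unfolding input_saved_def using assms(1) by (auto simp: assms(2))

lemma encode_traj_vertex:
  assumes "i < length V"
  shows "encode_traj V (3 * i + 1) = fst (fst (V ! i))" "encode_traj V (3 * i + 2) = snd (fst (V ! i))"
    "encode_traj V (3 * i + 3) = snd (V ! i)"
proof -
  have "(3 * i + 2) mod 3 = 2" "(3 * i + 1) mod 3 = 1" "(3 * i + 2) div 3 = i" "(3 * i + 1) div 3 = i" by presburger+
  then show "encode_traj V (3 * i + 1) = fst (fst (V ! i))" "encode_traj V (3 * i + 2) = snd (fst (V ! i))"
    "encode_traj V (3 * i + 3) = snd (V ! i)"
    using assms by (auto simp: encode_traj_def Let_def)
qed

text \<open>Reads an input cell at its present place; cell 2 holds \<open>128 * n - 1\<close>, the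
  shift of the cells that were copied.\<close>

definition input_exp :: "exp \<Rightarrow> exp" where
  "input_exp e = Ite e (Cst 127) (Mm (Op AAdd e (Rg 2))) (Mm e)"

lemma ev_input_exp:
  assumes "input_saved V \<sigma>" "\<sigma> 2 = 128 * real (length V) - 1" "ev e \<sigma> = real a"
    "1 \<le> a" "a \<le> 3 * length V" "2 \<le> length V"
  shows "ev (input_exp e) \<sigma> = encode_traj V a"
proof (cases "a \<le> 127")
  case True
  have "nat \<lfloor>real a + (128 * real (length V) - 1)\<rfloor> = 128 * length V + a - 1"
    using assms(4) by linarith
  moreover have "max 128 (128 * length V + a - 1) = 128 * length V + a - 1" using assms by simp
  ultimately show ?thesis
    using assms True unfolding input_exp_def input_saved_def by auto
next
  case False
  have "\<sigma> (if a \<le> 127 then 128 * length V + a - 1 else a) = encode_traj V a"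
    using assms(1,4,5) unfolding input_saved_def by blast
  then show ?thesis using False assms(3) by (simp add: input_exp_def max_def)
qed

text \<open>Record \<open>k\<close> of a trajectory with \<open>n\<close> vertices occupies the eight cells from \<open>256 * n + 8 * k\<close> on:
  start time, cap, corner, velocity of the corner, jump pointer, index of the best record.\<close>

definition slot :: "nat \<Rightarrow> nat \<Rightarrow> nat \<Rightarrow> nat" where
  "slot n k f = 256 * n + 8 * k + f"

definition slot_addr :: "real \<Rightarrow> real \<Rightarrow> nat \<Rightarrow> nat" where
  "slot_addr b x f = max 128 (nat \<lfloor>b + 8 * x + real f\<rfloor>)"

definition slot_exp :: "exp \<Rightarrow> nat \<Rightarrow> exp" where
  "slot_exp e f = Op AAdd (Op AAdd (Rg 4) (Op AMul (Cst 8) e)) (Cst (real f))"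

definition field :: "exp \<Rightarrow> nat \<Rightarrow> exp" where
  "field e f = Mm (slot_exp e f)"

definition put :: "exp \<Rightarrow> nat \<Rightarrow> exp \<Rightarrow> stmt" where
  "put e f v = Wr (slot_exp e f) v"

lemma ev_field [simp]: "ev (field e f) \<sigma> = \<sigma> (slot_addr (\<sigma> 4) (ev e \<sigma>) f)"
  by (simp add: field_def slot_exp_def slot_addr_def)

lemma exec_put [simp]: "exec_stmt (put e f v) \<sigma> = \<sigma>(slot_addr (\<sigma> 4) (ev e \<sigma>) f := ev v \<sigma>)"
  by (simp add: put_def slot_exp_def slot_addr_def)

lemma slot_addr_neq [simp]: "r < 128 \<Longrightarrow> r \<noteq> slot_addr b x f" "r < 128 \<Longrightarrow> slot_addr b x f \<noteq> r"
  by (auto simp: slot_addr_def)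

lemma slot_addr_slot: "1 \<le> n \<Longrightarrow> slot_addr (256 * real n) (real k) f = slot n k f"
proof -
  assume "1 \<le> n"
  moreover have "256 * real n + 8 * real k + real f = real (slot n k f)" by (simp add: slot_def)
  then have "nat \<lfloor>256 * real n + 8 * real k + real f\<rfloor> = slot n k f" by (simp only: floor_of_nat nat_int)
  ultimately show ?thesis unfolding slot_addr_def by (simp add: slot_def)
qed

lemma slot_eq_iff: "f < 8 \<Longrightarrow> g < 8 \<Longrightarrow> slot n k f = slot n j g \<longleftrightarrow> k = j \<and> f = g"
  unfolding slot_def by presburger

abbreviation min_exp :: "exp \<Rightarrow> exp \<Rightarrow> exp" where
  "min_exp a b \<equiv> Ite a b a b"

abbreviation max_exp :: "exp \<Rightarrow> exp \<Rightarrow> exp" where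
  "max_exp a b \<equiv> Ite a b b a"

abbreviation abs_exp :: "exp \<Rightarrow> exp" where
  "abs_exp a \<equiv> Ite (Cst 0) a a (Op ASub (Cst 0) a)"

text \<open>Here \<open>e\<close> is the start time of the piece that is still growing.\<close>

definition records :: "real \<Rightarrow> trajectory \<Rightarrow> nat \<Rightarrow> mem \<Rightarrow> nat \<Rightarrow> real \<Rightarrow> bool" where
  "records s V n \<sigma> K e \<longleftrightarrow> (if K = 0 then e else \<sigma> (slot n 0 0)) = t_start V \<and>
     (\<forall>k<K. good_record s V (\<sigma> (slot n k 0)) (if Suc k < K then \<sigma> (slot n (Suc k) 0) else e)
       (\<sigma> (slot n k 1)) (\<sigma> (slot n k 2)) (\<sigma> (slot n k 3)) (\<sigma> (slot n k 4)) (\<sigma> (slot n k 5)))"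

lemma records_cong:
  assumes "records s V n \<sigma> K e" "\<And>k f. k < K \<Longrightarrow> f < 6 \<Longrightarrow> \<sigma>' (slot n k f) = \<sigma> (slot n k f)"
  shows "records s V n \<sigma>' K e"
proof -
  have "\<sigma>' (slot n k f) = \<sigma> (slot n k f)" if "k < K" "f \<in> {0, 1, 2, 3, 4, 5}" for k f
    using assms(2)[OF that(1), of f] that(2) by auto
  then show ?thesis using assms(1) unfolding records_def by (cases "K = 0") (auto split: if_splits)
qed

lemma records_snoc:
  assumes r: "records s V n \<sigma> K e" and eq: "\<And>k f. k < K \<Longrightarrow> f < 6 \<Longrightarrow> \<sigma>' (slot n k f) = \<sigma> (slot n k f)"
    and K: "\<sigma>' (slot n K 0) = e"
      "good_record s V e e' (\<sigma>' (slot n K 1)) (\<sigma>' (slot n K 2)) (\<sigma>' (slot n K 3))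
        (\<sigma>' (slot n K 4)) (\<sigma>' (slot n K 5))"
  shows "records s V n \<sigma>' (Suc K) e'"
proof -
  have "records s V n \<sigma>' K e" using records_cong[OF r eq] .
  then have r: "(if K = 0 then e else \<sigma>' (slot n 0 0)) = t_start V"
    "\<And>k. k < K \<Longrightarrow> good_record s V (\<sigma>' (slot n k 0)) (if Suc k < K then \<sigma>' (slot n (Suc k) 0) else e)
       (\<sigma>' (slot n k 1)) (\<sigma>' (slot n k 2)) (\<sigma>' (slot n k 3)) (\<sigma>' (slot n k 4)) (\<sigma>' (slot n k 5))"
    unfolding records_def by blast+
  show ?thesis unfolding records_def
  proof (intro conjI allI impI)
    show "(if Suc K = 0 then e' else \<sigma>' (slot n 0 0)) = t_start V" using r(1) K(1) by (auto split: if_splits)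
    fix k assume "k < Suc K"
    then consider "Suc k < K" | "Suc k = K" | "k = K" by linarith
    then show "good_record s V (\<sigma>' (slot n k 0)) (if Suc k < Suc K then \<sigma>' (slot n (Suc k) 0) else e')
       (\<sigma>' (slot n k 1)) (\<sigma>' (slot n k 2)) (\<sigma>' (slot n k 3)) (\<sigma>' (slot n k 4)) (\<sigma>' (slot n k 5))"
      using r(2)[of k] K by cases auto
  qed
qed

section \<open>The greedy sweep\<close>

abbreviation add_exp (infixl "\<^bold>+" 65) where "a \<^bold>+ b \<equiv> Op AAdd a b"
abbreviation sub_exp (infixl "\<^bold>-" 65) where "a \<^bold>- b \<equiv> Op ASub a b"
abbreviation mul_exp (infixl "\<^bold>*" 70) where "a \<^bold>* b \<equiv> Op AMul a b"
abbreviation div_exp (infixl "\<^bold>'/" 70) where "a \<^bold>/ b \<equiv> Op ADiv a b"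

definition reach_exp :: "real \<Rightarrow> exp \<Rightarrow> exp \<Rightarrow> exp \<Rightarrow> exp \<Rightarrow> exp" where
  "reach_exp s lo hi p d =
     Ite d (Cst 0) (Ite (Cst 0) d (Cst 1) ((hi \<^bold>- Cst s \<^bold>- p) \<^bold>/ d)) ((lo \<^bold>+ Cst s \<^bold>- p) \<^bold>/ d)"

lemma ev_reach_exp: "ev (reach_exp s lo hi p d) \<sigma> = reach s (ev lo \<sigma>) (ev hi \<sigma>) (ev p \<sigma>) (ev d \<sigma>)"
  by (simp add: reach_exp_def reach_def)

text \<open>Variables of the sweep: 4 the base of the records, 5 their number, 6 to 9 the current vertex,
  10 the start of the growing piece, 11 to 14 its bounding box, 15 to 20 the end and the extent of the current edge,
  21 to 24 the point where the piece leaves the edge, 25 the longest time on the edge that fits into a square.\<close>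

definition start_block :: "stmt list" where
  "start_block =
    [Asg 2 (Rg 0 \<^bold>- Cst 127), Asg 3 ((Rg 0 \<^bold>- Cst 126) \<^bold>/ Cst 128), Asg 4 (Cst 256 \<^bold>* Rg 3),
     Asg 5 (Cst 0), Asg 6 (Cst 0),
     Asg 7 (input_exp (Cst 1)), Asg 8 (input_exp (Cst 2)), Asg 9 (input_exp (Cst 3)),
     Asg 10 (Rg 9), Asg 11 (Rg 7), Asg 12 (Rg 7), Asg 13 (Rg 8), Asg 14 (Rg 8)]"

definition load_block :: "stmt list" where
  "load_block =
    [Asg 15 (input_exp (Cst 3 \<^bold>* Rg 6 \<^bold>+ Cst 4)), Asg 16 (input_exp (Cst 3 \<^bold>* Rg 6 \<^bold>+ Cst 5)),
     Asg 17 (input_exp (Cst 3 \<^bold>* Rg 6 \<^bold>+ Cst 6)),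
     Asg 18 (Rg 15 \<^bold>- Rg 7), Asg 19 (Rg 16 \<^bold>- Rg 8), Asg 20 (Rg 17 \<^bold>- Rg 9)]"

definition cut_block :: "real \<Rightarrow> stmt list" where
  "cut_block s =
    [Asg 21 (min_exp (Cst 1) (min_exp (reach_exp s (Rg 11) (Rg 12) (Rg 7) (Rg 18))
       (reach_exp s (Rg 13) (Rg 14) (Rg 8) (Rg 19)))),
     Asg 22 (Rg 9 \<^bold>+ Rg 21 \<^bold>* Rg 20), Asg 23 (Rg 7 \<^bold>+ Rg 21 \<^bold>* Rg 18), Asg 24 (Rg 8 \<^bold>+ Rg 21 \<^bold>* Rg 19),
     Asg 25 (Rg 20 \<^bold>* Cst s \<^bold>/ max_exp (abs_exp (Rg 18)) (abs_exp (Rg 19)))]"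

text \<open>There are no conditional statements. The record is always written to the next free slot,
  and the counter alone decides whether it is kept; otherwise the next record written overwrites
  it.\<close>

definition piece_block :: "stmt list" where
  "piece_block =
    [put (Rg 5) 0 (Rg 10), put (Rg 5) 1 (Rg 22 \<^bold>- Rg 10),
     put (Rg 5) 2 (min_exp (Rg 11) (Rg 23)), put (Rg 5) 3 (min_exp (Rg 13) (Rg 24)),
     put (Rg 5) 4 (Cst 0), put (Rg 5) 5 (Cst 0),
     Asg 5 (Ite (Cst 1) (Rg 21) (Rg 5) (Rg 5 \<^bold>+ Cst 1))]"

definition rest_block :: "stmt list" where
  "rest_block =
    [put (Rg 5) 0 (Rg 22), put (Rg 5) 1 (Rg 25),
     put (Rg 5) 2 (Rg 23 \<^bold>+ min_exp (Cst 0) (Rg 18 \<^bold>/ Rg 20 \<^bold>* Rg 25)),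
     put (Rg 5) 3 (Rg 24 \<^bold>+ min_exp (Cst 0) (Rg 19 \<^bold>/ Rg 20 \<^bold>* Rg 25)),
     put (Rg 5) 4 (Rg 18 \<^bold>/ Rg 20), put (Rg 5) 5 (Rg 19 \<^bold>/ Rg 20),
     Asg 5 (Ite (Cst 1) (Rg 21) (Rg 5) (Ite (Rg 17 \<^bold>- Rg 22) (Rg 25) (Rg 5) (Rg 5 \<^bold>+ Cst 1)))]"

text \<open>The three outcomes for an edge: the piece absorbs it; the piece is cut and a short rest
  opens a new piece; the piece is cut and a long rest becomes a record.\<close>

definition three_way :: "exp \<Rightarrow> exp \<Rightarrow> exp \<Rightarrow> exp" where
  "three_way a b c = Ite (Cst 1) (Rg 21) a (Ite (Rg 17 \<^bold>- Rg 22) (Rg 25) b c)"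

definition next_block :: "stmt list" where
  "next_block =
    [Asg 10 (three_way (Rg 10) (Rg 22) (Rg 17)),
     Asg 11 (three_way (min_exp (Rg 11) (Rg 15)) (min_exp (Rg 23) (Rg 15)) (Rg 15)),
     Asg 12 (three_way (max_exp (Rg 12) (Rg 15)) (max_exp (Rg 23) (Rg 15)) (Rg 15)),
     Asg 13 (three_way (min_exp (Rg 13) (Rg 16)) (min_exp (Rg 24) (Rg 16)) (Rg 16)),
     Asg 14 (three_way (max_exp (Rg 14) (Rg 16)) (max_exp (Rg 24) (Rg 16)) (Rg 16)),
     Asg 7 (Rg 15), Asg 8 (Rg 16), Asg 9 (Rg 17), Asg 6 (Rg 6 \<^bold>+ Cst 1)]"

text \<open>The open piece is closed at the last vertex. The final time is also stored as start of
  one more slot, so that every record finds its end in the slot after it.\<close>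

definition last_block :: "stmt list" where
  "last_block =
    [put (Rg 5) 0 (Rg 10), put (Rg 5) 1 (Rg 9 \<^bold>- Rg 10), put (Rg 5) 2 (Rg 11), put (Rg 5) 3 (Rg 13),
     put (Rg 5) 4 (Cst 0), put (Rg 5) 5 (Cst 0),
     Asg 5 (Rg 5 \<^bold>+ Cst 1), put (Rg 5) 0 (Rg 9)]"

definition sweep_block :: "real \<Rightarrow> stmt list" where
  "sweep_block s = load_block @ cut_block s @ piece_block @ rest_block @ next_block"

text \<open>The bound \<open>K \<le> 2 * i\<close> keeps the number of records linear, on which the
  cost of linking and of queries rests.\<close>

definition sweep_inv :: "real \<Rightarrow> trajectory \<Rightarrow> nat \<Rightarrow> nat \<Rightarrow> mem \<Rightarrow> bool" where
  "sweep_inv s V i K \<sigma> \<longleftrightarrow> input_saved V \<sigma> \<and> \<sigma> 2 = 128 * real (length V) - 1 \<and> \<sigma> 3 = real (length V) \<and>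
     \<sigma> 4 = 256 * real (length V) \<and> \<sigma> 5 = real K \<and> \<sigma> 6 = real i \<and> i < length V \<and> K \<le> 2 * i \<and>
     \<sigma> 7 = fst (fst (V ! i)) \<and> \<sigma> 8 = snd (fst (V ! i)) \<and> \<sigma> 9 = snd (V ! i) \<and>
     box_on s V (\<sigma> 10) (snd (V ! i)) (\<sigma> 11) (\<sigma> 12) (\<sigma> 13) (\<sigma> 14) \<and>
     records s V (length V) \<sigma> K (\<sigma> 10)"

lemma slot_neq_reg [simp]:
  "1 \<le> n \<Longrightarrow> r < 256 \<Longrightarrow> slot n k f \<noteq> r" "1 \<le> n \<Longrightarrow> r < 256 \<Longrightarrow> r \<noteq> slot n k f"
  by (auto simp: slot_def)

lemma input_saved_cong:
  assumes "input_saved V \<sigma>" "2 \<le> length V" "\<And>a. 128 \<le> a \<Longrightarrow> a < 256 * length V \<Longrightarrow> \<sigma>' a = \<sigma> a"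
  shows "input_saved V \<sigma>'"
proof -
  have "128 \<le> (if a \<le> 127 then 128 * length V + a - 1 else a)"
    "(if a \<le> 127 then 128 * length V + a - 1 else a) < 256 * length V" if "1 \<le> a" "a \<le> 3 * length V" for a
    using that assms(2) by auto
  then show ?thesis using assms(1,3) unfolding input_saved_def by metis
qed

lemma exec_load_block:
  assumes "input_saved V \<sigma>" "\<sigma> 2 = 128 * real (length V) - 1" "\<sigma> 6 = real i" "Suc i < length V"
  shows "exec load_block \<sigma> = \<sigma>(15 := fst (fst (V ! Suc i)), 16 := snd (fst (V ! Suc i)), 17 := snd (V ! Suc i),
    18 := fst (fst (V ! Suc i)) - \<sigma> 7, 19 := snd (fst (V ! Suc i)) - \<sigma> 8, 20 := snd (V ! Suc i) - \<sigma> 9)"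
proof -
  have r: "ev (input_exp (Cst 3 \<^bold>* Rg 6 \<^bold>+ Cst (real c))) \<sigma>' = encode_traj V (3 * i + c)"
    if "c \<in> {4, 5, 6}" "\<sigma>' 2 = \<sigma> 2" "\<sigma>' 6 = \<sigma> 6" "\<And>a. 128 \<le> a \<Longrightarrow> \<sigma>' a = \<sigma> a" for c \<sigma>'
    using that assms input_saved_cong[of V \<sigma> \<sigma>'] by (intro ev_input_exp) auto
  have e: "encode_traj V (3 * i + 4) = fst (fst (V ! Suc i))" "encode_traj V (3 * i + 5) = snd (fst (V ! Suc i))"
    "encode_traj V (3 * i + 6) = snd (V ! Suc i)"
    using encode_traj_vertex[OF assms(4)] by (simp_all add: add.commute)
  show ?thesis
    unfolding load_block_def using r[of 4, unfolded e] r[of 5, unfolded e] r[of 6, unfolded e] by simp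
qed

lemma exec_cut_block:
  assumes "lam = min 1 (min (reach s (\<sigma> 11) (\<sigma> 12) (\<sigma> 7) (\<sigma> 18)) (reach s (\<sigma> 13) (\<sigma> 14) (\<sigma> 8) (\<sigma> 19)))"
  shows "exec (cut_block s) \<sigma> = \<sigma>(21 := lam, 22 := \<sigma> 9 + lam * \<sigma> 20, 23 := \<sigma> 7 + lam * \<sigma> 18,
    24 := \<sigma> 8 + lam * \<sigma> 19, 25 := \<sigma> 20 * s / max \<bar>\<sigma> 18\<bar> \<bar>\<sigma> 19\<bar>)"
proof -
  have "ev (min_exp (Cst 1) (min_exp (reach_exp s (Rg 11) (Rg 12) (Rg 7) (Rg 18))
       (reach_exp s (Rg 13) (Rg 14) (Rg 8) (Rg 19)))) \<sigma> = lam"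
    unfolding assms by (simp add: ev_reach_exp min_def)
  moreover have "ev (max_exp (abs_exp (Rg 18)) (abs_exp (Rg 19))) \<sigma>' = max \<bar>\<sigma>' 18\<bar> \<bar>\<sigma>' 19\<bar>" for \<sigma>'
    by (simp add: max_def abs_if)
  ultimately show ?thesis unfolding cut_block_def by (simp del: ev.simps(5))
qed

lemma exec_piece_block:
  assumes "\<sigma> 4 = 256 * real n" "\<sigma> 5 = real K" "1 \<le> n"
  shows "exec piece_block \<sigma> = \<sigma>(slot n K 0 := \<sigma> 10, slot n K 1 := \<sigma> 22 - \<sigma> 10,
    slot n K 2 := min (\<sigma> 11) (\<sigma> 23), slot n K 3 := min (\<sigma> 13) (\<sigma> 24), slot n K 4 := 0, slot n K 5 := 0,
    5 := real (if 1 \<le> \<sigma> 21 then K else Suc K))"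
  unfolding piece_block_def using assms by (simp add: slot_addr_slot min_def add.commute)

lemma exec_rest_block:
  assumes "\<sigma> 4 = 256 * real n" "\<sigma> 5 = real K" "1 \<le> n"
  shows "exec rest_block \<sigma> = \<sigma>(slot n K 0 := \<sigma> 22, slot n K 1 := \<sigma> 25,
    slot n K 2 := \<sigma> 23 + min 0 (\<sigma> 18 / \<sigma> 20 * \<sigma> 25), slot n K 3 := \<sigma> 24 + min 0 (\<sigma> 19 / \<sigma> 20 * \<sigma> 25),
    slot n K 4 := \<sigma> 18 / \<sigma> 20, slot n K 5 := \<sigma> 19 / \<sigma> 20,
    5 := real (if 1 \<le> \<sigma> 21 \<or> \<sigma> 17 - \<sigma> 22 \<le> \<sigma> 25 then K else Suc K))"
  unfolding rest_block_def using assms by (simp add: slot_addr_slot min_def add.commute)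

lemma exec_next_block:
  "exec next_block \<sigma> =
   (if 1 \<le> \<sigma> 21 then \<sigma>(11 := min (\<sigma> 11) (\<sigma> 15), 12 := max (\<sigma> 12) (\<sigma> 15),
      13 := min (\<sigma> 13) (\<sigma> 16), 14 := max (\<sigma> 14) (\<sigma> 16), 7 := \<sigma> 15, 8 := \<sigma> 16, 9 := \<sigma> 17, 6 := \<sigma> 6 + 1)
    else if \<sigma> 17 - \<sigma> 22 \<le> \<sigma> 25 then \<sigma>(10 := \<sigma> 22, 11 := min (\<sigma> 23) (\<sigma> 15), 12 := max (\<sigma> 23) (\<sigma> 15),
      13 := min (\<sigma> 24) (\<sigma> 16), 14 := max (\<sigma> 24) (\<sigma> 16), 7 := \<sigma> 15, 8 := \<sigma> 16, 9 := \<sigma> 17, 6 := \<sigma> 6 + 1)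
    else \<sigma>(10 := \<sigma> 17, 11 := \<sigma> 15, 12 := \<sigma> 15, 13 := \<sigma> 16, 14 := \<sigma> 16,
      7 := \<sigma> 15, 8 := \<sigma> 16, 9 := \<sigma> 17, 6 := \<sigma> 6 + 1))"
  unfolding next_block_def three_way_def by (simp add: min_def max_def)

text \<open>The doublings destroyed the original content \<open>n\<close> of cell 0, so the shift,
  \<open>n\<close> and the base of the records are all recovered from the address
  \<open>128 * n + 126\<close> that it holds now.\<close>

lemma sweep_start:
  assumes "input_saved V \<sigma>" "\<sigma> 0 = 128 * real (length V) + 126" "2 \<le> length V" "s > 0" "valid_traj V"
  shows "sweep_inv s V 0 0 (exec start_block \<sigma>)"
proof -
  let ?n = "length V"
  have r: "ev (input_exp (Cst (real c))) \<sigma>' = encode_traj V c"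
    if "c \<in> {1, 2, 3}" "\<sigma>' 2 = 128 * real ?n - 1" "\<And>a. 128 \<le> a \<Longrightarrow> \<sigma>' a = \<sigma> a" for c \<sigma>'
    using that assms input_saved_cong[of V \<sigma> \<sigma>'] by (intro ev_input_exp) auto
  have e: "encode_traj V 1 = fst (fst (V ! 0))" "encode_traj V 2 = snd (fst (V ! 0))" "encode_traj V 3 = snd (V ! 0)"
  proof -
    have "0 < length V" using assms(3) by linarith
    from encode_traj_vertex[OF this]
    show "encode_traj V 1 = fst (fst (V ! 0))" "encode_traj V 2 = snd (fst (V ! 0))" "encode_traj V 3 = snd (V ! 0)"
      unfolding mult_0_right add_0 by this+
  qed
  define x y t where "x = fst (fst (V ! 0))" and "y = snd (fst (V ! 0))" and "t = snd (V ! 0)"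
  have 1: "exec start_block \<sigma> = \<sigma>(2 := 128 * real ?n - 1, 3 := real ?n, 4 := 256 * real ?n, 5 := 0, 6 := 0,
      7 := x, 8 := y, 9 := t, 10 := t, 11 := x, 12 := x, 13 := y, 14 := y)"
    unfolding start_block_def x_def y_def t_def
    using r[of 1, unfolded e] r[of 2, unfolded e] r[of 3, unfolded e] assms(2) by simp
  have t: "t = t_start V" using assms(3) by (cases V) (auto simp: t_def t_start_def)
  have "box_on s V t t x x y y"
  proof -
    have "traj_pos V t = fst (V ! 0)"
      using traj_pos_edge[OF assms(5), of 0 t] valid_traj_less[OF assms(5), of 0 1] assms(3) by (simp add: t_def)
    then have "(fst \<circ> traj_pos V) t = x" "(snd \<circ> traj_pos V) t = y" by (simp_all add: x_def y_def)
    then show ?thesis unfolding box_on_def using hull_on_point assms(4) by (metis diff_self less_imp_le)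
  qed
  moreover have "input_saved V (exec start_block \<sigma>)"
    by (rule input_saved_cong[OF assms(1,3)]) (simp add: 1)
  moreover have "records s V ?n (exec start_block \<sigma>) 0 t" using t by (simp add: records_def)
  ultimately show ?thesis
    unfolding sweep_inv_def using assms(3) by (auto simp: 1 x_def y_def t_def)
qed

lemma sweep_step:
  assumes inv: "sweep_inv s V i K \<sigma>" and i: "Suc i < length V" and V: "valid_traj V" and s: "s > 0"
  shows "\<exists>K'. sweep_inv s V (Suc i) K' (exec (sweep_block s) \<sigma>)"
proof -
  interpret edge s V i using i V s by unfold_locales
  let ?n = "length V"
  have n: "1 \<le> ?n" "2 \<le> ?n" using i by auto
  note I = inv[unfolded sweep_inv_def]
  define a x1 x2 y1 y2 where ax: "a = \<sigma> 10" "x1 = \<sigma> 11" "x2 = \<sigma> 12" "y1 = \<sigma> 13" "y2 = \<sigma> 14"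
  have box: "box_on s V a t0 x1 x2 y1 y2" using I ax by simp
  define X' Y' T' dX dY dT where loc: "X' = qx" "Y' = qy" "T' = t1" "dX = dx" "dY = dy" "dT = D"
  define lam where "lam = min 1 (min (reach s x1 x2 px dX) (reach s y1 y2 py dY))"
  define b where "b = t0 + lam * dT"
  define bx where "bx = px + lam * dX"
  define by' where "by' = py + lam * dY"
  define ta where "ta = dT * s / max \<bar>dX\<bar> \<bar>dY\<bar>"
  have lam: "min 1 (min (reach s x1 x2 px dx) (reach s y1 y2 py dy)) = lam" by (simp only: lam_def loc)
  have fold_defs: "t0 + lam * D = b" "px + lam * dx = bx" "py + lam * dy = by'" "D * s / max \<bar>dx\<bar> \<bar>dy\<bar> = ta"
    by (simp_all only: b_def bx_def by'_def ta_def loc)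
  note cut = piece_record[OF box, unfolded lam fold_defs] moving[OF box, unfolded lam] box_on_whole[OF box, unfolded lam]
  define \<sigma>1 where "\<sigma>1 = \<sigma>(15 := X', 16 := Y', 17 := T', 18 := dX, 19 := dY, 20 := dT,
    21 := lam, 22 := b, 23 := bx, 24 := by', 25 := ta)"
  have 1: "exec (cut_block s) (exec load_block \<sigma>) = \<sigma>1"
  proof -
    have l: "exec load_block \<sigma> = \<sigma>(15 := X', 16 := Y', 17 := T', 18 := dX, 19 := dY, 20 := dT)"
      unfolding loc using I i by (subst exec_load_block[where i = i]) auto
    show ?thesis
      unfolding l \<sigma>1_def
      by (subst exec_cut_block[where lam = lam])
        (use I in \<open>simp_all add: lam_def ax b_def bx_def by'_def ta_def\<close>)
  qed
  have in1: "\<And>r. r < 15 \<or> 128 \<le> r \<Longrightarrow> \<sigma>1 r = \<sigma> r" by (auto simp: \<sigma>1_def)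
  have rec1: "records s V ?n \<sigma>1 K a"
  proof (rule records_cong[OF _ in1])
    show "records s V ?n \<sigma> K a" unfolding ax using I by blast
    show "slot ?n k f < 15 \<or> 128 \<le> slot ?n k f" for k f using n(1) unfolding slot_def by linarith
  qed
  define K1 where "K1 = (if 1 \<le> lam then K else Suc K)"
  define \<sigma>2 where "\<sigma>2 = \<sigma>1(slot ?n K 0 := a, slot ?n K 1 := b - a, slot ?n K 2 := min x1 bx,
    slot ?n K 3 := min y1 by', slot ?n K 4 := 0, slot ?n K 5 := 0, 5 := real K1)"
  have 2: "exec piece_block \<sigma>1 = \<sigma>2"
    using I n by (subst exec_piece_block[of _ ?n K]) (simp_all add: \<sigma>1_def \<sigma>2_def ax K1_def)
  have in2: "\<sigma>2 r = \<sigma>1 r" if "r < 256" "r \<noteq> 5" for r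
    using that n by (simp add: \<sigma>2_def)
  have out2: "\<sigma>2 r = \<sigma>1 r" if "128 \<le> r" "r < 256 * ?n" for r
    using that by (simp add: \<sigma>2_def slot_def)
  \<comment> \<open>The start of the piece left open after the first, optional record.\<close>
  define e1 where "e1 = (if 1 \<le> lam then a else b)"
  have slot2: "\<sigma>2 (slot ?n k f) = \<sigma>1 (slot ?n k f)" if "k < K" "f < 6" for k f
    using that n by (simp add: \<sigma>2_def slot_eq_iff)
  have rec2: "records s V ?n \<sigma>2 K1 e1"
  proof (cases "1 \<le> lam")
    case True
    then show ?thesis using records_cong[OF rec1 slot2] by (simp add: K1_def e1_def)
  next
    case False
    then have "good_record s V a b (b - a) (min x1 bx) (min y1 by') 0 0" using cut(1) by simp
    then have "records s V ?n \<sigma>2 (Suc K) b"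
      using n by (intro records_snoc[OF rec1 slot2]) (simp_all add: \<sigma>2_def slot_eq_iff)
    then show ?thesis using False by (simp add: K1_def e1_def)
  qed
  \<comment> \<open>The third outcome: the piece was cut and the rest of the edge is too long for a
    square, so a second record is kept.\<close>
  define long where "long \<longleftrightarrow> \<not> 1 \<le> lam \<and> \<not> T' - b \<le> ta"
  define K2 where "K2 = (if long then Suc K1 else K1)"
  define \<sigma>3 where "\<sigma>3 = \<sigma>2(slot ?n K1 0 := b, slot ?n K1 1 := ta, slot ?n K1 2 := bx + min 0 (dX / dT * ta),
    slot ?n K1 3 := by' + min 0 (dY / dT * ta), slot ?n K1 4 := dX / dT, slot ?n K1 5 := dY / dT, 5 := real K2)"
  have r2: "\<sigma>2 22 = b" "\<sigma>2 25 = ta" "\<sigma>2 23 = bx" "\<sigma>2 24 = by'" "\<sigma>2 18 = dX" "\<sigma>2 19 = dY" "\<sigma>2 20 = dT"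
    "\<sigma>2 21 = lam" "\<sigma>2 17 = T'"
    by (simp_all add: in2) (simp_all add: \<sigma>1_def)
  have "\<sigma>2 4 = \<sigma>1 4" by (rule in2) simp_all
  also have "\<sigma>1 4 = \<sigma> 4" by (rule in1) simp
  finally have g: "\<sigma>2 4 = 256 * real ?n" using I by simp
  have h: "\<sigma>2 5 = real K1" by (simp add: \<sigma>2_def)
  have c: "(if 1 \<le> lam \<or> T' - b \<le> ta then K1 else Suc K1) = K2" by (simp add: K2_def long_def)
  have 3: "exec rest_block \<sigma>2 = \<sigma>3"
    unfolding exec_rest_block[OF g h n(1)] r2 c \<sigma>3_def ..
  have in3: "\<sigma>3 r = \<sigma>1 r" if "r < 256" "r \<noteq> 5" for r
    using that n in2 by (simp add: \<sigma>3_def)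
  have out3: "\<sigma>3 r = \<sigma> r" if "128 \<le> r" "r < 256 * ?n" for r
    using that out2 in1 by (simp add: \<sigma>3_def slot_def)
  define e2 where "e2 = (if long then T' else e1)"
  have slot3: "\<sigma>3 (slot ?n k f) = \<sigma>2 (slot ?n k f)" if "k < K1" "f < 6" for k f
    using that n by (simp add: \<sigma>3_def slot_eq_iff)
  have m: "0 \<le> lam" "lam \<le> 1" using lam_bounds[OF box, unfolded lam] by blast+
  have rec3: "records s V ?n \<sigma>3 K2 e2"
  proof (cases long)
    case False
    then show ?thesis using records_cong[OF rec2 slot3] by (simp add: K2_def e2_def)
  next
    case True
    then have "0 < max \<bar>dx\<bar> \<bar>dy\<bar>" using cut(2) by (simp add: long_def)
    moreover have "ta < t1 - b" using True by (simp add: long_def loc)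
    ultimately have "good_record s V b T' ta (bx + min 0 (dX / dT * ta)) (by' + min 0 (dY / dT * ta)) (dX / dT) (dY / dT)"
      using rest_record[OF m fold_defs(1)[symmetric], unfolded fold_defs] unfolding loc by blast
    moreover have "e1 = b" using True by (simp add: e1_def long_def)
    ultimately have "records s V ?n \<sigma>3 (Suc K1) T'"
      using n by (intro records_snoc[OF rec2 slot3]) (simp_all add: \<sigma>3_def slot_eq_iff)
    then show ?thesis using True by (simp add: K2_def e2_def)
  qed
  define \<sigma>4 where "\<sigma>4 = exec next_block \<sigma>3"
  have r3: "\<sigma>3 10 = a" "\<sigma>3 11 = x1" "\<sigma>3 12 = x2" "\<sigma>3 13 = y1" "\<sigma>3 14 = y2" "\<sigma>3 15 = X'" "\<sigma>3 16 = Y'" "\<sigma>3 17 = T'"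
    "\<sigma>3 21 = lam" "\<sigma>3 22 = b" "\<sigma>3 23 = bx" "\<sigma>3 24 = by'" "\<sigma>3 25 = ta" "\<sigma>3 6 = real i" "\<sigma>3 5 = real K2"
    using in3 I by (simp_all add: \<sigma>1_def ax) (simp add: \<sigma>3_def)
  note 4 = exec_next_block[of \<sigma>3, unfolded r3, folded \<sigma>4_def]
  have out4: "\<sigma>4 r = \<sigma>3 r" if "128 \<le> r \<or> r < 6" for r
    using that unfolding 4 by auto
  have "exec (sweep_block s) \<sigma> = \<sigma>4" by (simp add: sweep_block_def exec_append 1 2 3 \<sigma>4_def)
  moreover have "sweep_inv s V (Suc i) K2 \<sigma>4"
    unfolding sweep_inv_def
  proof (intro conjI)
    show "input_saved V \<sigma>4"
    proof (rule input_saved_cong[OF _ n(2)])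
      show "input_saved V \<sigma>" using I by blast
      show "\<sigma>4 a = \<sigma> a" if "128 \<le> a" "a < 256 * ?n" for a
        using out4[of a] out3[OF that] that by simp
    qed
    have "\<sigma>4 r = \<sigma> r" if "r < 5" for r using out4[of r] in3[of r] in1[of r] that by simp
    then show "\<sigma>4 2 = 128 * real ?n - 1" "\<sigma>4 3 = real ?n" "\<sigma>4 4 = 256 * real ?n" using I by simp_all
    show "\<sigma>4 5 = real K2" using out4[of 5] r3 by simp
    show "\<sigma>4 6 = real (Suc i)" "\<sigma>4 7 = fst (fst (V ! Suc i))" "\<sigma>4 8 = snd (fst (V ! Suc i))" "\<sigma>4 9 = snd (V ! Suc i)"
      unfolding 4 loc by (simp_all add: add.commute)
    show "Suc i < ?n" by (rule i)
    have "K \<le> 2 * i" using I by blast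
    then show "K2 \<le> 2 * Suc i" unfolding K2_def K1_def by auto
    have e2: "\<sigma>4 10 = e2" unfolding 4 by (auto simp: r3 e2_def e1_def long_def)
    show "records s V ?n \<sigma>4 K2 (\<sigma>4 10)"
      unfolding e2
    proof (rule records_cong[OF rec3 out4])
      show "128 \<le> slot ?n k f \<or> slot ?n k f < 6" for k f using n(1) unfolding slot_def by linarith
    qed
    consider "1 \<le> lam" | "lam < 1" "T' - b \<le> ta" | "lam < 1" "\<not> T' - b \<le> ta" by linarith
    then show "box_on s V (\<sigma>4 10) (snd (V ! Suc i)) (\<sigma>4 11) (\<sigma>4 12) (\<sigma>4 13) (\<sigma>4 14)"
    proof cases
      case 1
      then have "box_on s V a t1 (min x1 qx) (max x2 qx) (min y1 qy) (max y2 qy)"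
        using cut(3) by simp
      moreover have "\<sigma>4 10 = a" "\<sigma>4 11 = min x1 X'" "\<sigma>4 12 = max x2 X'" "\<sigma>4 13 = min y1 Y'" "\<sigma>4 14 = max y2 Y'"
        unfolding 4 if_P[OF 1] by (simp_all add: r3)
      ultimately show ?thesis by (simp only: loc)
    next
      case 2
      then have "0 < max \<bar>dx\<bar> \<bar>dy\<bar>" using cut(2) by simp
      moreover have "t1 - b \<le> ta" using 2 by (simp add: loc)
      ultimately have "box_on s V b t1 (min bx qx) (max bx qx) (min by' qy) (max by' qy)"
        using rest_box[OF m fold_defs(1)[symmetric], unfolded fold_defs] by blast
      moreover have "\<sigma>4 10 = b" "\<sigma>4 11 = min bx X'" "\<sigma>4 12 = max bx X'" "\<sigma>4 13 = min by' Y'" "\<sigma>4 14 = max by' Y'"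
        unfolding 4 if_not_P[OF 2(1)[unfolded not_le[symmetric]]] if_P[OF 2(2)] by simp_all
      ultimately show ?thesis by (simp only: loc)
    next
      case 3
      \<comment> \<open>After a long rest the next piece starts at the vertex itself, with a single
        point as its box.\<close>
      have e: "X t1 = qx" "Y t1 = qy" using X.f_at[of 1] Y.f_at[of 1] by simp_all
      have "box_on s V t1 t1 qx qx qy qy"
        unfolding box_on_def using hull_on_point[of X t1] hull_on_point[of Y t1] s unfolding e by simp
      moreover have "\<sigma>4 10 = T'" "\<sigma>4 11 = X'" "\<sigma>4 12 = X'" "\<sigma>4 13 = Y'" "\<sigma>4 14 = Y'"
        unfolding 4 if_not_P[OF 3(1)[unfolded not_le[symmetric]]] if_not_P[OF 3(2)] by simp_all
      ultimately show ?thesis by (simp only: loc)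
    qed
  qed
  ultimately show ?thesis by metis
qed

definition swept :: "real \<Rightarrow> trajectory \<Rightarrow> nat \<Rightarrow> mem \<Rightarrow> bool" where
  "swept s V M \<sigma> \<longleftrightarrow> \<sigma> 4 = 256 * real (length V) \<and> \<sigma> 5 = real M \<and> 0 < M \<and> M \<le> 2 * length V \<and>
     \<sigma> (slot (length V) 0 0) = t_start V \<and> \<sigma> (slot (length V) M 0) = t_end V \<and>
     (\<forall>k<M. good_record s V (\<sigma> (slot (length V) k 0)) (\<sigma> (slot (length V) (Suc k) 0)) (\<sigma> (slot (length V) k 1))
       (\<sigma> (slot (length V) k 2)) (\<sigma> (slot (length V) k 3)) (\<sigma> (slot (length V) k 4)) (\<sigma> (slot (length V) k 5)))"

text \<open>The last piece is not stopped by an overflow. It is a good record because maximality is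
  only demanded up to \<open>t_end V\<close>.\<close>

lemma sweep_finish:
  assumes inv: "sweep_inv s V i K \<sigma>" and i: "i = length V - 1" "2 \<le> length V"
  shows "swept s V (Suc K) (exec last_block \<sigma>)"
proof -
  let ?n = "length V"
  have n: "1 \<le> ?n" using i by simp
  note I = inv[unfolded sweep_inv_def]
  define a where "a = \<sigma> 10"
  define \<sigma>' where "\<sigma>' = \<sigma>(slot ?n K 0 := a, slot ?n K 1 := \<sigma> 9 - a, slot ?n K 2 := \<sigma> 11, slot ?n K 3 := \<sigma> 13,
     slot ?n K 4 := 0, slot ?n K 5 := 0, 5 := real (Suc K), slot ?n (Suc K) 0 := \<sigma> 9)"
  have "slot_addr (256 * real ?n) (1 + real K) 0 = slot ?n (Suc K) 0"
    using slot_addr_slot[OF n, of "Suc K" 0] by simp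
  then have 1: "exec last_block \<sigma> = \<sigma>'"
    unfolding last_block_def \<sigma>'_def a_def using n I by (simp add: slot_addr_slot add.commute)
  have e: "\<sigma> 9 = t_end V" using I i by (cases "V = []") (auto simp: t_end_def last_conv_nth)
  have box: "box_on s V a (\<sigma> 9) (\<sigma> 11) (\<sigma> 12) (\<sigma> 13) (\<sigma> 14)" using I by (simp add: a_def)
  have slot': "\<sigma>' (slot ?n k f) = \<sigma> (slot ?n k f)" if "k < K" "f < 6" for k f
    using that n by (simp add: \<sigma>'_def slot_eq_iff)
  have S: "\<sigma>' (slot ?n (Suc K) 0) = \<sigma> 9" by (simp add: \<sigma>'_def)
  have rec: "records s V ?n \<sigma> K a" using I by (simp add: a_def)
  have "records s V ?n \<sigma>' (Suc K) (\<sigma> 9)"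
  proof (rule records_snoc[OF rec slot'])
    show "\<sigma>' (slot ?n K 0) = a" using n by (simp add: \<sigma>'_def slot_eq_iff)
    have "good_record s V a (\<sigma> 9) (\<sigma> 9 - a) (\<sigma> 11) (\<sigma> 13) 0 0"
      using box_on_record[OF box] e by simp
    then show "good_record s V a (\<sigma> 9) (\<sigma>' (slot ?n K 1)) (\<sigma>' (slot ?n K 2)) (\<sigma>' (slot ?n K 3))
        (\<sigma>' (slot ?n K 4)) (\<sigma>' (slot ?n K 5))"
      using n by (simp add: \<sigma>'_def slot_eq_iff)
  qed
  then have "\<sigma>' (slot ?n 0 0) = t_start V" and
    "\<And>k. k < Suc K \<Longrightarrow> good_record s V (\<sigma>' (slot ?n k 0)) (\<sigma>' (slot ?n (Suc k) 0)) (\<sigma>' (slot ?n k 1))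
       (\<sigma>' (slot ?n k 2)) (\<sigma>' (slot ?n k 3)) (\<sigma>' (slot ?n k 4)) (\<sigma>' (slot ?n k 5))"
  proof -
    assume r: "records s V ?n \<sigma>' (Suc K) (\<sigma> 9)"
    show "\<sigma>' (slot ?n 0 0) = t_start V" using r by (simp add: records_def)
    fix k assume k: "k < Suc K"
    then have eq: "(if Suc k < Suc K then \<sigma>' (slot ?n (Suc k) 0) else \<sigma> 9) = \<sigma>' (slot ?n (Suc k) 0)"
      using S by (cases "k = K") simp_all
    show "good_record s V (\<sigma>' (slot ?n k 0)) (\<sigma>' (slot ?n (Suc k) 0)) (\<sigma>' (slot ?n k 1))
       (\<sigma>' (slot ?n k 2)) (\<sigma>' (slot ?n k 3)) (\<sigma>' (slot ?n k 4)) (\<sigma>' (slot ?n k 5))"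
      using r[unfolded records_def, THEN conjunct2, rule_format, OF k] unfolding eq .
  qed
  moreover have "Suc K \<le> 2 * ?n" using I i by auto
  moreover have "\<sigma>' 4 = 256 * real ?n" "\<sigma>' 5 = real (Suc K)" using I n by (simp_all add: \<sigma>'_def)
  ultimately show ?thesis unfolding swept_def 1 using S e by simp
qed

section \<open>Linking the records\<close>

text \<open>Index \<open>i\<close> is read as the boundary before record \<open>i\<close>, so the
  jump from \<open>i\<close> skips the records from \<open>jmp i\<close> to \<open>i - 1\<close>. At
  0 nothing is skipped, and the entry is a default.\<close>

definition best_in :: "(nat \<Rightarrow> real) \<Rightarrow> nat \<Rightarrow> nat \<Rightarrow> bool" where
  "best_in cap i b \<longleftrightarrow>
     (if i = 0 then b = 0 else jmp i \<le> b \<and> b < i \<and> (\<forall>k. jmp i \<le> k \<and> k < i \<longrightarrow> cap k \<le> cap b))"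

lemma jmp_le: "jmp i \<le> i"
  by (cases "i = 0") (auto simp: jmp_less less_imp_le)

lemma best_in_Suc_single: "p - jmp p \<noteq> jmp p - jmp (jmp p) \<Longrightarrow> best_in cap (Suc p) p"
  by (auto simp: best_in_def jmp_Suc less_Suc_eq)

text \<open>A merging jump skips record \<open>p\<close> and precisely the records skipped by the
  jumps from \<open>p\<close> and from \<open>jmp p\<close>, so three candidates are
  compared.\<close>

lemma best_in_Suc_merge:
  assumes "best_in cap p c" "best_in cap (jmp p) c'" and eq: "p - jmp p = jmp p - jmp (jmp p)"
    and b: "b \<in> {p, c, c'}" "cap p \<le> cap b" "cap c \<le> cap b" "cap c' \<le> cap b"
  shows "best_in cap (Suc p) b"
proof (cases "p = 0")
  case True
  then show ?thesis using assms by (auto simp: best_in_def jmp_Suc)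
next
  case False
  then have "jmp p \<noteq> 0" using eq jmp_less[of p] by auto
  note c = assms(1,2)[unfolded best_in_def, simplified False \<open>jmp p \<noteq> 0\<close>, simplified]
  have j: "jmp (Suc p) = jmp (jmp p)" using eq by (simp add: jmp_Suc)
  have "cap k \<le> cap b" if "jmp (jmp p) \<le> k" "k < Suc p" for k
  proof -
    consider "k = p" | "jmp p \<le> k" "k < p" | "k < jmp p" using \<open>k < Suc p\<close> by linarith
    then show ?thesis using c b that order_trans by cases blast+
  qed
  moreover have "jmp (jmp p) \<le> b" "b \<le> p" using b(1) c jmp_le[of p] jmp_le[of "jmp p"] by auto
  ultimately show ?thesis unfolding best_in_def j by auto
qed

definition link_start :: "stmt list" where
  "link_start = [Asg 27 (Cst 0), put (Cst 0) 6 (Cst 0), put (Cst 0) 7 (Cst 0)]"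

text \<open>Equality of the two jump lengths is decided by two comparisons. Without a merge both
  other candidates are set to record \<open>p\<close>, so the same two maxima can be taken in either
  case.\<close>

definition link_block :: "stmt list" where
  "link_block =
    [Asg 28 (field (Rg 27) 6), Asg 29 (field (Rg 28) 6),
     Asg 30 (Ite (Rg 27 \<^bold>- Rg 28) (Rg 28 \<^bold>- Rg 29)
       (Ite (Rg 28 \<^bold>- Rg 29) (Rg 27 \<^bold>- Rg 28) (Cst 1) (Cst 0)) (Cst 0)),
     Asg 31 (Ite (Cst 1) (Rg 30) (field (Rg 27) 7) (Rg 27)),
     Asg 32 (Ite (Cst 1) (Rg 30) (field (Rg 28) 7) (Rg 27)),
     Asg 33 (Ite (field (Rg 31) 1) (field (Rg 27) 1) (Rg 27) (Rg 31)),
     Asg 33 (Ite (field (Rg 32) 1) (field (Rg 33) 1) (Rg 33) (Rg 32)),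
     Asg 30 (Ite (Cst 1) (Rg 30) (Rg 29) (Rg 27)),
     Asg 27 (Rg 27 \<^bold>+ Cst 1), put (Rg 27) 6 (Rg 30), put (Rg 27) 7 (Rg 33)]"

lemma exec_link_block:
  assumes n: "1 \<le> n" and r: "\<sigma> 4 = 256 * real n" "\<sigma> 27 = real p"
    and j: "\<sigma> (slot n p 6) = real jp" "\<sigma> (slot n jp 6) = real jj" "jp \<le> p" "jj \<le> jp"
    and b: "\<sigma> (slot n p 7) = real b1" "\<sigma> (slot n jp 7) = real b2"
    and mg: "mg \<longleftrightarrow> p - jp = jp - jj"
    and c: "c1 = (if mg then b1 else p)" "c2 = (if mg then b2 else p)"
    and m: "b' = (if \<sigma> (slot n c1 1) \<le> \<sigma> (slot n p 1) then p else c1)"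
      "bb = (if \<sigma> (slot n c2 1) \<le> \<sigma> (slot n b' 1) then b' else c2)"
  shows "exec link_block \<sigma> = \<sigma>(28 := real jp, 29 := real jj, 30 := if mg then 1 else 0, 31 := real c1, 32 := real c2, 33 := real bb,
    30 := real (if mg then jj else p), 27 := real (Suc p),
    slot n (Suc p) 6 := real (if mg then jj else p), slot n (Suc p) 7 := real bb)"
proof -
  have sa: "slot_addr (256 * real n) (real k) f = slot n k f" for k f using n by (rule slot_addr_slot)
  have sa': "slot_addr (256 * real n) (real k + 1) f = slot n (Suc k) f" for k f using sa[of "Suc k"] by (simp add: add.commute)
  \<comment> \<open>The machine subtracts reals, whereas \<open>mg\<close> uses truncated
    subtraction; they agree because of \<open>jj \<le> jp\<close> and
    \<open>jp \<le> p\<close>.\<close>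
  have mg': "mg \<longleftrightarrow> 2 * real jp - real jj = real p"
  proof -
    have "mg \<longleftrightarrow> p + jj = jp + jp" using mg j(3,4) by linarith
    also have "\<dots> \<longleftrightarrow> real p + real jj = real jp + real jp"
      unfolding of_nat_add[symmetric] of_nat_eq_iff ..
    finally show ?thesis by linarith
  qed
  define \<sigma>1 where "\<sigma>1 = \<sigma>(28 := real jp, 29 := real jj, 30 := if mg then 1 else 0)"
  have 1: "exec (take 3 link_block) \<sigma> = \<sigma>1"
    unfolding link_block_def \<sigma>1_def mg' using r j n by (auto simp: sa)
  have r1: "\<sigma>1 4 = 256 * real n" "\<sigma>1 27 = real p" "\<sigma>1 28 = real jp" "\<sigma>1 29 = real jj"
    "\<sigma>1 30 = (if mg then 1 else 0)" "\<And>k f. \<sigma>1 (slot n k f) = \<sigma> (slot n k f)"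
    using r n by (simp_all add: \<sigma>1_def)
  define \<sigma>2 where "\<sigma>2 = \<sigma>1(31 := real c1, 32 := real c2)"
  have 2: "exec (take 2 (drop 3 link_block)) \<sigma>1 = \<sigma>2"
    unfolding link_block_def \<sigma>2_def c using r1 b n by (cases mg) (simp_all add: sa)
  have r2: "\<sigma>2 4 = 256 * real n" "\<sigma>2 27 = real p" "\<sigma>2 31 = real c1" "\<sigma>2 32 = real c2" "\<sigma>2 29 = real jj"
    "\<sigma>2 30 = (if mg then 1 else 0)" "\<And>k f. \<sigma>2 (slot n k f) = \<sigma> (slot n k f)"
    using r1 n by (simp_all add: \<sigma>2_def)
  define \<sigma>3 where "\<sigma>3 = \<sigma>2(33 := real bb)"
  have 3: "exec (take 2 (drop 5 link_block)) \<sigma>2 = \<sigma>3"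
  proof -
    define \<sigma>' where "\<sigma>' = \<sigma>2(33 := real b')"
    have r': "\<sigma>' 4 = 256 * real n" "\<sigma>' 27 = real p" "\<sigma>' 33 = real b'" "\<sigma>' 32 = real c2"
      "\<And>k f. \<sigma>' (slot n k f) = \<sigma> (slot n k f)"
      using r2 n by (simp_all add: \<sigma>'_def)
    have "exec [Asg 33 (Ite (field (Rg 31) 1) (field (Rg 27) 1) (Rg 27) (Rg 31))] \<sigma>2 = \<sigma>'"
      unfolding \<sigma>'_def m(1) using r2 by (simp add: sa)
    moreover have "exec [Asg 33 (Ite (field (Rg 32) 1) (field (Rg 33) 1) (Rg 33) (Rg 32))] \<sigma>' = \<sigma>'(33 := real bb)"
      unfolding m(2) using r' by (simp add: sa)
    ultimately show ?thesis by (simp add: link_block_def \<sigma>3_def \<sigma>'_def)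
  qed
  have r3: "\<sigma>3 4 = 256 * real n" "\<sigma>3 27 = real p" "\<sigma>3 33 = real bb" "\<sigma>3 29 = real jj"
    "\<sigma>3 30 = (if mg then 1 else 0)"
    using r2 by (simp_all add: \<sigma>3_def)
  have 4: "exec (drop 7 link_block) \<sigma>3 = \<sigma>3(30 := real (if mg then jj else p), 27 := real (Suc p),
    slot n (Suc p) 6 := real (if mg then jj else p), slot n (Suc p) 7 := real bb)"
    unfolding link_block_def using r3 n by (simp add: sa' add.commute[of 1])
  have split: "link_block = take 3 link_block @ take 2 (drop 3 link_block) @ take 2 (drop 5 link_block) @ drop 7 link_block"
    by (simp add: link_block_def)
  have "exec link_block \<sigma> = exec (drop 7 link_block) (exec (take 2 (drop 5 link_block))
      (exec (take 2 (drop 3 link_block)) (exec (take 3 link_block) \<sigma>)))"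
    by (rule trans[OF arg_cong[OF split, of "\<lambda>b. exec b \<sigma>"]]) (simp only: exec_append)
  then show ?thesis unfolding 1 2 3 4 unfolding \<sigma>3_def \<sigma>2_def \<sigma>1_def .
qed

definition linked :: "nat \<Rightarrow> nat \<Rightarrow> mem \<Rightarrow> bool" where
  "linked n p \<sigma> \<longleftrightarrow> (\<forall>i\<le>p. \<sigma> (slot n i 6) = real (jmp i) \<and>
     (\<exists>b. \<sigma> (slot n i 7) = real b \<and> best_in (\<lambda>k. \<sigma> (slot n k 1)) i b))"

lemma swept_cong:
  assumes "swept s V M \<sigma>" "\<And>k f. f < 6 \<Longrightarrow> \<sigma>' (slot (length V) k f) = \<sigma> (slot (length V) k f)"
    "\<sigma>' 4 = \<sigma> 4" "\<sigma>' 5 = \<sigma> 5"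
  shows "swept s V M \<sigma>'"
  using assms(1) unfolding swept_def by (simp add: assms(2-4))

lemma link_start:
  assumes "swept s V M \<sigma>" "2 \<le> length V"
  shows "swept s V M (exec link_start \<sigma>)" "linked (length V) 0 (exec link_start \<sigma>)" "exec link_start \<sigma> 27 = 0"
proof -
  let ?n = "length V"
  have n: "1 \<le> ?n" using assms(2) by simp
  have 1: "exec link_start \<sigma> = \<sigma>(27 := 0, slot ?n 0 6 := 0, slot ?n 0 7 := 0)"
    using assms(1) slot_addr_slot[OF n, of 0] by (simp add: link_start_def swept_def)
  show "swept s V M (exec link_start \<sigma>)"
    unfolding 1 using n by (intro swept_cong[OF assms(1)]) (simp_all add: slot_eq_iff)
  show "linked ?n 0 (exec link_start \<sigma>)" "exec link_start \<sigma> 27 = 0"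
    unfolding 1 using n by (simp_all add: linked_def best_in_def slot_eq_iff)
qed

lemma link_step:
  assumes sw: "swept s V M \<sigma>" and ln: "linked (length V) p \<sigma>" and p: "\<sigma> 27 = real p" and n: "2 \<le> length V"
  shows "swept s V M (exec link_block \<sigma>)" "linked (length V) (Suc p) (exec link_block \<sigma>)"
    "exec link_block \<sigma> 27 = real (Suc p)"
proof -
  let ?n = "length V"
  have n1: "1 \<le> ?n" using n by simp
  define cap where "cap k = \<sigma> (slot ?n k 1)" for k
  have jp: "jmp p \<le> p" by (rule jmp_le)
  obtain b1 b2 where b: "\<sigma> (slot ?n p 7) = real b1" "\<sigma> (slot ?n (jmp p) 7) = real b2"
    "best_in cap p b1" "best_in cap (jmp p) b2"
    and j: "\<sigma> (slot ?n p 6) = real (jmp p)" "\<sigma> (slot ?n (jmp p) 6) = real (jmp (jmp p))"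
    using ln jp unfolding linked_def cap_def by blast
  define mg where "mg \<longleftrightarrow> p - jmp p = jmp p - jmp (jmp p)"
  define c1 c2 where c: "c1 = (if mg then b1 else p)" "c2 = (if mg then b2 else p)"
  define b' where "b' = (if cap c1 \<le> cap p then p else c1)"
  define bb where "bb = (if cap c2 \<le> cap b' then b' else c2)"
  have e: "exec link_block \<sigma> = \<sigma>(28 := real (jmp p), 29 := real (jmp (jmp p)),
    30 := if mg then 1 else 0, 31 := real c1, 32 := real c2, 33 := real bb,
    30 := real (if mg then jmp (jmp p) else p), 27 := real (Suc p),
    slot ?n (Suc p) 6 := real (if mg then jmp (jmp p) else p), slot ?n (Suc p) 7 := real bb)" (is "_ = ?\<sigma>")
    using sw by (intro exec_link_block[OF n1 _ p j jp jmp_le b(1,2) mg_def c, of b'])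
      (simp_all add: swept_def b'_def bb_def cap_def)
  have js: "jmp (Suc p) = (if mg then jmp (jmp p) else p)" by (simp add: jmp_Suc mg_def)
  have best: "best_in cap (Suc p) bb"
  proof (cases mg)
    case True
    then have "bb \<in> {p, b1, b2}" "cap p \<le> cap bb" "cap b1 \<le> cap bb" "cap b2 \<le> cap bb"
      unfolding bb_def b'_def c by auto
    then show ?thesis using best_in_Suc_merge b(3,4) True[unfolded mg_def] by blast
  next
    case False
    then have "bb = p" by (simp add: bb_def b'_def c)
    then show ?thesis using best_in_Suc_single False[unfolded mg_def] by blast
  qed
  have out: "?\<sigma> (slot ?n k f) = \<sigma> (slot ?n k f)" if "f < 6 \<or> f < 8 \<and> k \<le> p" for k f
    using that n1 by (auto simp: slot_eq_iff)
  have cap': "(\<lambda>k. ?\<sigma> (slot ?n k 1)) = cap" unfolding cap_def using out by auto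
  show "swept s V M (exec link_block \<sigma>)"
    unfolding e by (intro swept_cong[OF sw] out) (use n1 in simp_all)
  show "linked ?n (Suc p) (exec link_block \<sigma>)"
    unfolding linked_def e cap'
  proof (intro allI impI)
    fix i assume i: "i \<le> Suc p"
    show "?\<sigma> (slot ?n i 6) = real (jmp i) \<and> (\<exists>b. ?\<sigma> (slot ?n i 7) = real b \<and> best_in cap i b)"
    proof (cases "i = Suc p")
      case True
      then show ?thesis using best js by (simp add: slot_eq_iff)
    next
      case False
      then have "?\<sigma> (slot ?n i 6) = \<sigma> (slot ?n i 6)" "?\<sigma> (slot ?n i 7) = \<sigma> (slot ?n i 7)"
        using i by (intro out; simp)+
      then show ?thesis using ln i False unfolding linked_def cap_def[symmetric] by simp
    qed
  qed
  show "exec link_block \<sigma> 27 = real (Suc p)" unfolding e using n1 by simp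
qed

section \<open>Queries\<close>

lemma threshold:
  fixes Q :: "nat \<Rightarrow> bool"
  assumes "Q 0" "\<And>i j. i \<le> j \<Longrightarrow> j \<le> M \<Longrightarrow> Q j \<Longrightarrow> Q i"
  obtains d where "d \<le> M" "\<And>j. j \<le> M \<Longrightarrow> Q j \<longleftrightarrow> j \<le> d"
proof
  let ?d = "Max {j. j \<le> M \<and> Q j}"
  have f: "finite {j. j \<le> M \<and> Q j}" by simp
  have "?d \<in> {j. j \<le> M \<and> Q j}" using assms(1) by (intro Max_in f) auto
  then show "?d \<le> M" "\<And>j. j \<le> M \<Longrightarrow> Q j \<longleftrightarrow> j \<le> ?d" using assms(2) Max_ge[OF f] by blast+
qed

text \<open>The walk of a query first skips the records after the window, then crosses those inside it. In both
  phases it follows \<^const>\<open>descent\<close>, so the potential is the number of steps left.\<close>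

lemma query_potential:
  fixes l :: "nat \<Rightarrow> real"
  assumes mono: "\<And>i j. i \<le> j \<Longrightarrow> j \<le> M \<Longrightarrow> l i \<le> l j" and x: "l 0 \<le> x" "x < y" and M: "M < 2 ^ L"
  obtains \<Phi> :: "nat \<Rightarrow> nat" where "\<Phi> M \<le> 6 * L + 4"
    "\<And>i. i \<le> M \<Longrightarrow> \<not> l i \<le> x \<Longrightarrow>
      \<Phi> (if y \<le> l (jmp i) \<or> x \<le> l (jmp i) \<and> l i \<le> y then jmp i else i - 1) < \<Phi> i"
proof -
  obtain d where d: "d \<le> M" "\<And>j. j \<le> M \<Longrightarrow> l j \<le> x \<longleftrightarrow> j \<le> d"
    using threshold[of "\<lambda>j. l j \<le> x" M] mono x order_trans by metis
  obtain b where b: "b \<le> M" "\<And>j. j \<le> M \<Longrightarrow> l j < y \<longleftrightarrow> j \<le> b"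
    using threshold[of "\<lambda>j. l j < y" M] mono x le_less_trans by metis
  \<comment> \<open>Indices up to \<open>d\<close> end the loop. In the second phase the value is at
    most \<open>3 * L + 2\<close>, so with the offset \<open>3 * L + 3\<close> every move from the
    first phase into the second is a decrease.\<close>
  define \<Phi> where "\<Phi> i = (if i \<le> d then 0 else if i \<le> b then 1 + descent (Suc d) i
    else descent (Suc b) i + (3 * L + 3))" for i
  have bound: "descent t i \<le> 3 * L + 1" if "t \<le> i" "i \<le> M" for t i
    using descent_le[of t i L] that M by simp
  have low: "\<Phi> i < 3 * L + 3" if "i \<le> b" for i
    using bound[of "Suc d" i] that b(1) by (cases "i \<le> d") (simp_all add: \<Phi>_def)
  show ?thesis
  proof
    show "\<Phi> M \<le> 6 * L + 4"
      using bound[of "Suc d" M] bound[of "Suc b" M] d(1) b(1) by (auto simp: \<Phi>_def)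
    fix i assume i: "i \<le> M" "\<not> l i \<le> x"
    then have di: "d < i" using d by auto
    define j where "j = jmp i"
    have j: "j < i" using di jmp_less[of i] by (simp add: j_def)
    have step: "descent t i = Suc (descent t (if t \<le> j then j else i - 1))" if "t < i" for t
      using that unfolding j_def by (subst descent.simps) auto
    show "\<Phi> (if y \<le> l (jmp i) \<or> x \<le> l (jmp i) \<and> l i \<le> y then jmp i else i - 1) < \<Phi> i"
      unfolding j_def[symmetric]
    proof (cases "i \<le> b")
      case True
      then have ly: "l i < y" "l j < y" using b i j by auto
      have "\<Phi> (i - 1) < \<Phi> i" if "j \<le> d"
        using step[of "Suc d"] True di that by (auto simp: \<Phi>_def)
      \<comment> \<open>If \<open>l j = x\<close>, the query jumps to \<open>j\<close> although
        \<open>descent\<close> would take a single step; it lands where the potential is 0.\<close>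
      moreover have "\<Phi> j < \<Phi> i" if "j \<le> d" using that di True by (simp add: \<Phi>_def)
      moreover have "\<Phi> j < \<Phi> i" "x \<le> l j" if "\<not> j \<le> d"
        using step[of "Suc d"] True j that d(2)[of j] i by (auto simp: \<Phi>_def)
      ultimately show "\<Phi> (if y \<le> l j \<or> x \<le> l j \<and> l i \<le> y then j else i - 1) < \<Phi> i"
        using ly by (cases "j \<le> d") auto
    next
      case False
      have Phi_i: "\<Phi> i = descent (Suc b) i + (3 * L + 3)" using False di by (simp add: \<Phi>_def)
      show "\<Phi> (if y \<le> l j \<or> x \<le> l j \<and> l i \<le> y then j else i - 1) < \<Phi> i"
      proof (cases "j \<le> b")
        case True
        \<comment> \<open>If \<open>l i = y\<close>, the block may already count as lying inside the
          window and be jumped over, so both possible moves are covered.\<close>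
        then have "\<Phi> j < \<Phi> i" using low Phi_i by (simp add: trans_less_add2)
        moreover have "\<Phi> (i - 1) < \<Phi> i"
        proof (cases "i - 1 \<le> b")
          case True
          then show ?thesis using low Phi_i by (simp add: trans_less_add2)
        next
          case False
          then have "\<Phi> (i - 1) \<le> descent (Suc b) (i - 1) + (3 * L + 3)" by (simp add: \<Phi>_def)
          then show ?thesis using step[of "Suc b"] False True Phi_i by simp
        qed
        ultimately show ?thesis by simp
      next
        case jb: False
        then have "y \<le> l j" using b(2)[of j] i j by simp
        moreover have "\<Phi> j \<le> descent (Suc b) j + (3 * L + 3)" using jb by (simp add: \<Phi>_def)
        then have "\<Phi> j < \<Phi> i" using step[of "Suc b"] jb j Phi_i by simp
        ultimately show ?thesis by simp
      qed
    qed
  qed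
qed

text \<open>Best value 0 at corner (0, 0) is a sound start because every square has nonnegative
  weight.\<close>

definition query_start :: "stmt list" where
  "query_start = [Asg 34 (Rg 5), Asg 35 (Cst 0), Asg 36 (Cst 0), Asg 37 (Cst 0)]"

text \<open>Blocks beyond the window and blocks inside it are treated alike, by clipping their best
  record: beyond the window the result is at most 0 and changes nothing, inside it is the cap. In
  all other cases only record \<open>i - 1\<close> is examined.\<close>

definition query_block :: "stmt list" where
  "query_block =
    [Asg 38 (field (Rg 34) 6),
     Asg 39 (Ite (Rg 1) (field (Rg 38) 0) (Cst 1)
       (Ite (Rg 0) (field (Rg 38) 0) (Ite (field (Rg 34) 0) (Rg 1) (Cst 1) (Cst 0)) (Cst 0))),
     Asg 40 (Ite (Cst 1) (Rg 39) (field (Rg 34) 7) (Rg 34 \<^bold>- Cst 1)),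
     Asg 34 (Ite (Cst 1) (Rg 39) (Rg 38) (Rg 34 \<^bold>- Cst 1)),
     Asg 42 (max_exp (field (Rg 40) 0) (Rg 0)),
     Asg 43 (min_exp (field (Rg 40) 1) (min_exp (field (Rg 40 \<^bold>+ Cst 1) 0) (Rg 1) \<^bold>- Rg 42)),
     Asg 36 (Ite (Rg 43) (Rg 35) (Rg 36)
       (field (Rg 40) 2 \<^bold>+ field (Rg 40) 4 \<^bold>* (Rg 42 \<^bold>- field (Rg 40) 0))),
     Asg 37 (Ite (Rg 43) (Rg 35) (Rg 37)
       (field (Rg 40) 3 \<^bold>+ field (Rg 40) 5 \<^bold>* (Rg 42 \<^bold>- field (Rg 40) 0))),
     Asg 35 (max_exp (Rg 35) (Rg 43))]"

definition query_finish :: "stmt list" where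
  "query_finish = [Asg 0 (Rg 36), Asg 1 (Rg 37)]"

lemma exec_query_block:
  assumes n: "1 \<le> n" and r: "\<sigma> 4 = 256 * real n" "\<sigma> 0 = x" "\<sigma> 1 = y" "\<sigma> 34 = real (Suc i)"
    and j: "\<sigma> (slot n (Suc i) 6) = real j" "\<sigma> (slot n (Suc i) 7) = real b"
    and R: "\<And>k f. R k f = \<sigma> (slot n k f)"
    and blk: "blk \<longleftrightarrow> y \<le> R j 0 \<or> x \<le> R j 0 \<and> R (Suc i) 0 \<le> y"
    and k: "k = (if blk then b else i)"
    and u: "u = max (R k 0) x" and w: "w = clip x y (R k 0) (R (Suc k) 0) (R k 1)"
  shows "exec query_block \<sigma> = \<sigma>(38 := real j, 39 := if blk then 1 else 0, 40 := real k,
    34 := real (if blk then j else i), 42 := u, 43 := w,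
    36 := if w \<le> \<sigma> 35 then \<sigma> 36 else R k 2 + R k 4 * (u - R k 0),
    37 := if w \<le> \<sigma> 35 then \<sigma> 37 else R k 3 + R k 5 * (u - R k 0),
    35 := max (\<sigma> 35) w)"
proof -
  have sa: "slot_addr (256 * real n) (real k) f = slot n k f" for k f using n by (rule slot_addr_slot)
  have sa': "slot_addr (256 * real n) (real k + 1) f = slot n (Suc k) f" for k f
    using sa[of "Suc k"] by (simp add: add.commute)
  have sa'': "slot_addr (256 * real n) (1 + real k) f = slot n (Suc k) f" for k f
    using sa[of "Suc k"] by simp
  define \<sigma>1 where "\<sigma>1 = \<sigma>(38 := real j, 39 := if blk then 1 else 0)"
  have 1: "exec (take 2 query_block) \<sigma> = \<sigma>1"
    unfolding query_block_def \<sigma>1_def blk R using r j n by (auto simp: sa sa'')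
  have r1: "\<sigma>1 4 = 256 * real n" "\<sigma>1 0 = x" "\<sigma>1 1 = y" "\<sigma>1 34 = real (Suc i)" "\<sigma>1 38 = real j"
    "\<sigma>1 39 = (if blk then 1 else 0)" "\<sigma>1 (slot n (Suc i) 7) = real b" "\<And>k f. \<sigma>1 (slot n k f) = R k f"
    using r j n by (simp_all add: \<sigma>1_def R)
  define \<sigma>2 where "\<sigma>2 = \<sigma>1(40 := real k, 34 := real (if blk then j else i))"
  have 2: "exec (take 2 (drop 2 query_block)) \<sigma>1 = \<sigma>2"
    unfolding query_block_def \<sigma>2_def k using r1 n by (cases blk) (simp_all add: sa sa'')
  have r2: "\<sigma>2 4 = 256 * real n" "\<sigma>2 0 = x" "\<sigma>2 1 = y" "\<sigma>2 40 = real k"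
    "\<And>r. r \<in> {35, 36, 37} \<Longrightarrow> \<sigma>2 r = \<sigma> r" "\<And>k f. \<sigma>2 (slot n k f) = R k f"
    using r1 n by (auto simp: \<sigma>2_def) (auto simp: \<sigma>1_def)
  define \<sigma>3 where "\<sigma>3 = \<sigma>2(42 := u, 43 := w)"
  have 3: "exec (take 2 (drop 4 query_block)) \<sigma>2 = \<sigma>3"
  proof -
    have "exec [Asg 42 (max_exp (field (Rg 40) 0) (Rg 0))] \<sigma>2 = \<sigma>2(42 := u)"
      unfolding u using r2 by (simp add: sa max_def)
    moreover have "exec [Asg 43 (min_exp (field (Rg 40) 1) (min_exp (field (Rg 40 \<^bold>+ Cst 1) 0) (Rg 1) \<^bold>- Rg 42))]
        (\<sigma>2(42 := u)) = \<sigma>3"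
      unfolding \<sigma>3_def w clip_def u[symmetric] using r2 n by (simp add: sa sa' sa'' min_def)
    ultimately show ?thesis by (simp add: query_block_def)
  qed
  have r3: "\<sigma>3 4 = 256 * real n" "\<sigma>3 40 = real k" "\<sigma>3 42 = u" "\<sigma>3 43 = w"
    "\<sigma>3 35 = \<sigma> 35" "\<sigma>3 36 = \<sigma> 36" "\<sigma>3 37 = \<sigma> 37" "\<And>k f. \<sigma>3 (slot n k f) = R k f"
    using r2 n by (auto simp: \<sigma>3_def)
  have 4: "exec (drop 6 query_block) \<sigma>3 = \<sigma>3(
    36 := if w \<le> \<sigma> 35 then \<sigma> 36 else R k 2 + R k 4 * (u - R k 0),
    37 := if w \<le> \<sigma> 35 then \<sigma> 37 else R k 3 + R k 5 * (u - R k 0),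
    35 := max (\<sigma> 35) w)"
    unfolding query_block_def using r3 n by (simp add: sa max_def)
  have split: "query_block = take 2 query_block @ take 2 (drop 2 query_block) @ take 2 (drop 4 query_block) @ drop 6 query_block"
    by (simp add: query_block_def)
  have "exec query_block \<sigma> = exec (drop 6 query_block) (exec (take 2 (drop 4 query_block))
      (exec (take 2 (drop 2 query_block)) (exec (take 2 query_block) \<sigma>)))"
    by (rule trans[OF arg_cong[OF split, of "\<lambda>b. exec b \<sigma>"]]) (simp only: exec_append)
  then show ?thesis unfolding 1 2 3 4 unfolding \<sigma>3_def \<sigma>2_def \<sigma>1_def .
qed

definition answer_inv :: "real \<Rightarrow> trajectory \<Rightarrow> nat \<Rightarrow> real \<Rightarrow> real \<Rightarrow> nat \<Rightarrow> mem \<Rightarrow> bool" where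
  "answer_inv s V M x y i \<sigma> \<longleftrightarrow> swept s V M \<sigma> \<and> linked (length V) M \<sigma> \<and> \<sigma> 0 = x \<and> \<sigma> 1 = y \<and>
     i \<le> M \<and> \<sigma> 34 = real i \<and> 0 \<le> \<sigma> 35 \<and>
     (\<forall>k. i \<le> k \<and> k < M \<longrightarrow>
       clip x y (\<sigma> (slot (length V) k 0)) (\<sigma> (slot (length V) (Suc k) 0)) (\<sigma> (slot (length V) k 1)) \<le> \<sigma> 35) \<and>
     \<sigma> 35 \<le> weight V x y (square s (\<sigma> 36, \<sigma> 37))"

lemma swept_mono:
  assumes "swept s V M \<sigma>" "i \<le> j" "j \<le> M"
  shows "\<sigma> (slot (length V) i 0) \<le> \<sigma> (slot (length V) j 0)"
  using assms(2,3)
proof (induction j rule: dec_induct)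
  case (step j)
  then have "\<sigma> (slot (length V) j 0) \<le> \<sigma> (slot (length V) (Suc j) 0)"
    using assms(1) unfolding swept_def good_record_def by auto
  then show ?case using step by simp
qed simp

lemma linked_cong:
  assumes "linked n p \<sigma>" "\<And>k f. \<sigma>' (slot n k f) = \<sigma> (slot n k f)"
  shows "linked n p \<sigma>'"
  using assms unfolding linked_def by simp

lemma query_step:
  assumes inv: "answer_inv s V M x y i \<sigma>" and run: "\<not> \<sigma> (slot (length V) i 0) \<le> x"
    and V: "2 \<le> length V" and x: "t_start V \<le> x" "x < y"
    and L: "\<And>k. L k = \<sigma> (slot (length V) k 0)"
  shows "answer_inv s V M x y
      (if y \<le> L (jmp i) \<or> x \<le> L (jmp i) \<and> L i \<le> y then jmp i else i - 1) (exec query_block \<sigma>)"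
    "\<And>k f. exec query_block \<sigma> (slot (length V) k f) = \<sigma> (slot (length V) k f)"
proof -
  let ?n = "length V"
  note I = inv[unfolded answer_inv_def]
  have sw: "swept s V M \<sigma>" and ln: "linked ?n M \<sigma>" using I by blast+
  have n: "1 \<le> ?n" using V by simp
  have "\<sigma> (slot ?n 0 0) = t_start V" using sw unfolding swept_def by blast
  then have "i \<noteq> 0" using run x(1) by (intro notI) simp
  then obtain i' where i': "i = Suc i'" by (cases i) auto
  have iM: "i \<le> M" using I by blast
  obtain b where b: "\<sigma> (slot ?n i 7) = real b" "best_in (\<lambda>k. \<sigma> (slot ?n k 1)) i b"
    and j: "\<sigma> (slot ?n i 6) = real (jmp i)"
    using ln iM unfolding linked_def by blast
  have bj: "jmp i \<le> b" "b < i" and bbest: "\<And>k. jmp i \<le> k \<Longrightarrow> k < i \<Longrightarrow> \<sigma> (slot ?n k 1) \<le> \<sigma> (slot ?n b 1)"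
    using b(2) \<open>i \<noteq> 0\<close> unfolding best_in_def by auto
  define R where "R k f = \<sigma> (slot ?n k f)" for k f
  have LR: "L k = R k 0" for k by (simp add: L R_def)
  define blk where "blk \<longleftrightarrow> y \<le> R (jmp i) 0 \<or> x \<le> R (jmp i) 0 \<and> R i 0 \<le> y"
  define k where "k = (if blk then b else i')"
  define u where "u = max (R k 0) x"
  define w where "w = clip x y (R k 0) (R (Suc k) 0) (R k 1)"
  define \<sigma>' where "\<sigma>' = exec query_block \<sigma>"
  define i2 where "i2 = (if blk then jmp i else i')"
  have e: "\<sigma>' = \<sigma>(38 := real (jmp i), 39 := if blk then 1 else 0, 40 := real k, 34 := real i2, 42 := u, 43 := w,
    36 := if w \<le> \<sigma> 35 then \<sigma> 36 else R k 2 + R k 4 * (u - R k 0),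
    37 := if w \<le> \<sigma> 35 then \<sigma> 37 else R k 3 + R k 5 * (u - R k 0), 35 := max (\<sigma> 35) w)"
    unfolding \<sigma>'_def i2_def
    using I i' j b(1)
    by (intro exec_query_block[where n = ?n and b = b and R = R and x = x and y = y and i = i' and j = "jmp i"])
      (simp_all add: n swept_def R_def blk_def k_def u_def w_def)
  have heap: "\<sigma>' (slot ?n k f) = \<sigma> (slot ?n k f)" for k f unfolding e using n by simp
  then show "\<And>k f. exec query_block \<sigma> (slot ?n k f) = \<sigma> (slot ?n k f)" by (simp add: \<sigma>'_def)
  have good: "good_record s V (R k 0) (R (Suc k) 0) (R k 1) (R k 2) (R k 3) (R k 4) (R k 5)" if "k < M" for k
    using sw that unfolding swept_def R_def by blast
  have mono: "R a 0 \<le> R c 0" if "a \<le> c" "c \<le> M" for a c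
    using swept_mono[OF sw that] by (simp add: R_def)
  have kM: "k < M" unfolding k_def using bj iM i' by auto
  have covered: "clip x y (R a 0) (R (Suc a) 0) (R a 1) \<le> max (\<sigma> 35) w" if a: "i2 \<le> a" "a < M" for a
  proof (cases "i \<le> a")
    case True
    then have "clip x y (R a 0) (R (Suc a) 0) (R a 1) \<le> \<sigma> 35" using I a unfolding R_def by blast
    then show ?thesis by simp
  next
    case False
    show ?thesis
    proof (cases blk)
      case True
      then have ja: "jmp i \<le> a" using a by (simp add: i2_def)
      show ?thesis
      proof (cases "y \<le> R (jmp i) 0")
        case True
        then have "y \<le> R a 0" using mono[OF ja] a by simp
        then have "clip x y (R a 0) (R (Suc a) 0) (R a 1) \<le> 0" by (auto simp: clip_def min_def max_def)
        moreover have "0 \<le> \<sigma> 35" using I by blast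
        ultimately show ?thesis by simp
      next
        case False
        then have "x \<le> R (jmp i) 0" "R i 0 \<le> y" using \<open>blk\<close> unfolding blk_def by auto
        then have "x \<le> R b 0" "R (Suc b) 0 \<le> y"
          using mono[OF bj(1)] mono[of "Suc b" i] bj iM by auto
        \<comment> \<open>A cap never exceeds the duration of its record, so a record inside the
          window is not shortened by clipping. The other records of the block clip to at most their
          caps, hence to at most the cap of \<open>b\<close>.\<close>
        then have "w = R b 1" using good[of b] bj iM \<open>blk\<close>
          unfolding w_def k_def clip_def good_record_def by auto
        moreover have "R a 1 \<le> R b 1" using bbest[OF ja] \<open>\<not> i \<le> a\<close> by (simp add: R_def)
        ultimately show ?thesis by (simp add: clip_def)
      qed
    next
      case nblk: False
      then have "a = k" using a False i' by (simp add: i2_def k_def)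
      then show ?thesis by (simp add: w_def)
    qed
  qed
  have "answer_inv s V M x y i2 \<sigma>'"
    unfolding answer_inv_def heap
  proof (intro conjI)
    show "swept s V M \<sigma>'" using heap by (intro swept_cong[OF sw]) (simp_all add: e)
    show "linked ?n M \<sigma>'" using heap by (rule linked_cong[OF ln])
    show "\<sigma>' 0 = x" "\<sigma>' 1 = y" unfolding e using I by simp_all
    show "i2 \<le> M" unfolding i2_def using iM jmp_le[of i] i' by simp
    show "\<sigma>' 34 = real i2" by (simp add: e)
    have p35: "\<sigma>' 35 = max (\<sigma> 35) w" by (simp add: e)
    have pos: "0 \<le> \<sigma> 35" using I by blast
    show "0 \<le> \<sigma>' 35" unfolding p35 using pos by simp
    show "\<forall>k. i2 \<le> k \<and> k < M \<longrightarrow>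
        clip x y (\<sigma> (slot ?n k 0)) (\<sigma> (slot ?n (Suc k) 0)) (\<sigma> (slot ?n k 1)) \<le> \<sigma>' 35"
      unfolding p35 using covered unfolding R_def by blast
    show "\<sigma>' 35 \<le> weight V x y (square s (\<sigma>' 36, \<sigma>' 37))"
    proof (cases "w \<le> \<sigma> 35")
      case True
      then have "\<sigma>' 35 = \<sigma> 35" "\<sigma>' 36 = \<sigma> 36" "\<sigma>' 37 = \<sigma> 37" by (simp_all add: e)
      then show ?thesis using I by simp
    next
      case False
      then have "\<sigma>' 35 = w" "\<sigma>' 36 = R k 2 + R k 4 * (u - R k 0)" "\<sigma>' 37 = R k 3 + R k 5 * (u - R k 0)"
        by (simp_all add: e)
      moreover have "w \<le> weight V x y (square s (R k 2 + R k 4 * (u - R k 0), R k 3 + R k 5 * (u - R k 0)))"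
        using clip_attained[OF good[OF kM] x(2)] False pos unfolding w_def u_def by simp
      ultimately show ?thesis by simp
    qed
  qed
  moreover have "i2 = (if y \<le> L (jmp i) \<or> x \<le> L (jmp i) \<and> L i \<le> y then jmp i else i - 1)"
    by (simp add: i2_def blk_def LR i')
  ultimately show "answer_inv s V M x y
      (if y \<le> L (jmp i) \<or> x \<le> L (jmp i) \<and> L i \<le> y then jmp i else i - 1) (exec query_block \<sigma>)"
    by (simp add: \<sigma>'_def)
qed

section \<open>The two programs\<close>

definition pre_coms :: "real \<Rightarrow> com list" where
  "pre_coms s = [Block start_block, Until (Rg 3 \<^bold>- Cst 1) (Rg 6) (sweep_block s),
     Block (last_block @ link_start), Until (Rg 5) (Rg 27) link_block]"

definition pre_code :: "real \<Rightarrow> instr list" where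
  "pre_code s = save_code 128 @ comp_prog (pre_coms s) (length (save_code 128))"

definition query_coms :: "com list" where
  "query_coms = [Block query_start, Until (field (Rg 34) 0) (Rg 0) query_block, Block query_finish]"

definition query_code :: "instr list" where
  "query_code = comp_prog query_coms 0"

lemmas block_defs = start_block_def sweep_block_def load_block_def cut_block_def piece_block_def rest_block_def
  next_block_def last_block_def link_start_def link_block_def query_start_def query_block_def query_finish_def
  input_exp_def reach_exp_def three_way_def put_def field_def slot_exp_def

lemma wf_pre_coms: "list_all wf_com (pre_coms s)"
  by (simp add: pre_coms_def block_defs)

lemma wf_query_coms: "list_all wf_com query_coms"
  by (simp add: query_coms_def block_defs)

text \<open>The factor 3 belongs to linking: at most \<open>2 * n\<close> records lead to at most
  \<open>2 * n + 1 \<le> 3 * n\<close> tests.\<close>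

definition pre_cost :: "real \<Rightarrow> nat" where
  "pre_cost s = length (save_code 128) + block_len start_block + com_len (Until (Rg 3 \<^bold>- Cst 1) (Rg 6) (sweep_block s)) +
     block_len (last_block @ link_start) + 3 * com_len (Until (Rg 5) (Rg 27) link_block)"

lemma sems_pre_coms:
  assumes V: "valid_traj V" "2 \<le> length V" and s: "s > 0"
    and \<sigma>: "input_saved V \<sigma>" "\<sigma> 0 = 128 * real (length V) + 126"
  obtains t \<sigma>' M where "sems (pre_coms s) \<sigma> t \<sigma>'" "t + length (save_code 128) \<le> pre_cost s * length V"
    "swept s V M \<sigma>'" "linked (length V) M \<sigma>'"
proof -
  let ?n = "length V"
  define \<sigma>1 where "\<sigma>1 = exec start_block \<sigma>"
  have 1: "sem (Block start_block) \<sigma> (block_len start_block) \<sigma>1" unfolding \<sigma>1_def by (rule sem.block)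
  have "sweep_inv s V 0 0 \<sigma>1" using sweep_start[OF \<sigma> V(2) s V(1)] by (simp add: \<sigma>1_def)
  then have start: "\<exists>i K. sweep_inv s V i K \<sigma>1 \<and> ?n - 1 = ?n - 1 - i"
    by (intro exI[of _ 0]) simp
  obtain t2 \<sigma>2 j2 where 2: "sem (Until (Rg 3 \<^bold>- Cst 1) (Rg 6) (sweep_block s)) \<sigma>1 t2 \<sigma>2"
    "t2 \<le> Suc (?n - 1) * com_len (Until (Rg 3 \<^bold>- Cst 1) (Rg 6) (sweep_block s))"
    "\<exists>i K. sweep_inv s V i K \<sigma>2 \<and> j2 = ?n - 1 - i" "ev (Rg 3 \<^bold>- Cst 1) \<sigma>2 \<le> ev (Rg 6) \<sigma>2"
  proof (rule exE[OF sem_Until[where I = "\<lambda>j \<sigma>. \<exists>i K. sweep_inv s V i K \<sigma> \<and> j = ?n - 1 - i", OF start]])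
    fix j \<sigma>' assume "\<exists>i K. sweep_inv s V i K \<sigma>' \<and> j = ?n - 1 - i"
      and run: "\<not> ev (Rg 3 \<^bold>- Cst 1) \<sigma>' \<le> ev (Rg 6) \<sigma>'"
    then obtain i K where i: "sweep_inv s V i K \<sigma>'" "j = ?n - 1 - i" by blast
    then have "\<sigma>' 3 = real ?n" "\<sigma>' 6 = real i" unfolding sweep_inv_def by blast+
    then have "Suc i < ?n" using run by simp
    then obtain K' where "sweep_inv s V (Suc i) K' (exec (sweep_block s) \<sigma>')"
      using sweep_step[OF i(1) _ V(1) s] by blast
    moreover have "?n - 1 - Suc i < j" using i(2) \<open>Suc i < ?n\<close> by simp
    ultimately show "\<exists>i<j. \<exists>i' K. sweep_inv s V i' K (exec (sweep_block s) \<sigma>') \<and> i = ?n - 1 - i'" by blast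
  qed (use that in blast)
  then obtain i K where i: "sweep_inv s V i K \<sigma>2" by blast
  then have "\<sigma>2 3 = real ?n" "\<sigma>2 6 = real i" "i < ?n" unfolding sweep_inv_def by blast+
  then have "i = ?n - 1" using 2(4) by simp
  note fin = sweep_finish[OF i this V(2)]
  define \<sigma>3 where "\<sigma>3 = exec (last_block @ link_start) \<sigma>2"
  have 3: "sem (Block (last_block @ link_start)) \<sigma>2 (block_len (last_block @ link_start)) \<sigma>3"
    unfolding \<sigma>3_def by (rule sem.block)
  define M where "M = Suc K"
  define I where "I j \<sigma> \<longleftrightarrow> (\<exists>p\<le>M. j = M - p \<and> swept s V M \<sigma> \<and> linked ?n p \<sigma> \<and> \<sigma> 27 = real p)" for j \<sigma>
  have "I M \<sigma>3"
    unfolding I_def using link_start[OF fin V(2)]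
    by (intro exI[of _ 0]) (simp add: \<sigma>3_def exec_append M_def)
  then obtain t4 \<sigma>4 j4 where 4: "sem (Until (Rg 5) (Rg 27) link_block) \<sigma>3 t4 \<sigma>4"
    "t4 \<le> Suc M * com_len (Until (Rg 5) (Rg 27) link_block)" "I j4 \<sigma>4" "ev (Rg 5) \<sigma>4 \<le> ev (Rg 27) \<sigma>4"
  proof (rule exE[OF sem_Until[where I = I]])
    fix j \<sigma>' assume "I j \<sigma>'" and run: "\<not> ev (Rg 5) \<sigma>' \<le> ev (Rg 27) \<sigma>'"
    then obtain p where p: "p \<le> M" "j = M - p" "swept s V M \<sigma>'" "linked ?n p \<sigma>'" "\<sigma>' 27 = real p"
      unfolding I_def by blast
    then have "\<sigma>' 5 = real M" unfolding swept_def by blast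
    then have "p < M" using run p(5) by simp
    then have "I (M - Suc p) (exec link_block \<sigma>')"
      unfolding I_def using link_step[OF p(3-5) V(2)] by (intro exI[of _ "Suc p"]) simp
    moreover have "M - Suc p < j" using p(2) \<open>p < M\<close> by simp
    ultimately show "\<exists>i<j. I i (exec link_block \<sigma>')" by blast
  qed (use that in blast)
  then obtain p where p: "p \<le> M" "swept s V M \<sigma>4" "linked ?n p \<sigma>4" "\<sigma>4 27 = real p"
    unfolding I_def by blast
  then have "\<sigma>4 5 = real M" "M \<le> 2 * ?n" unfolding swept_def by blast+
  then have "p = M" using 4(4) p(1,4) by simp
  have "sems (pre_coms s) \<sigma> (block_len start_block + (t2 + (block_len (last_block @ link_start) + (t4 + 0)))) \<sigma>4"
    unfolding pre_coms_def by (rule sems.Cons[OF 1 sems.Cons[OF 2(1) sems.Cons[OF 3 sems.Cons[OF 4(1) sems.Nil]]]])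
  moreover have "block_len start_block + (t2 + (block_len (last_block @ link_start) + (t4 + 0))) + length (save_code 128)
      \<le> pre_cost s * ?n"
  proof -
    define A B C D E where costs: "A = length (save_code 128)" "B = block_len start_block"
      "C = com_len (Until (Rg 3 \<^bold>- Cst 1) (Rg 6) (sweep_block s))" "D = block_len (last_block @ link_start)"
      "E = com_len (Until (Rg 5) (Rg 27) link_block)"
    have n: "1 \<le> ?n" "Suc (?n - 1) = ?n" "Suc M \<le> 3 * ?n" using V(2) \<open>M \<le> 2 * ?n\<close> by auto
    have "t2 \<le> ?n * C" using 2(2) unfolding costs n(2) .
    moreover have "t4 \<le> 3 * ?n * E" using 4(2) mult_le_mono1[OF n(3), of E] unfolding costs by linarith
    moreover have "A \<le> A * ?n" "B \<le> B * ?n" "D \<le> D * ?n" using n(1) by simp_all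
    moreover have "pre_cost s * ?n = A * ?n + B * ?n + ?n * C + D * ?n + 3 * ?n * E"
      unfolding pre_cost_def costs by (simp add: algebra_simps)
    ultimately show ?thesis unfolding costs by linarith
  qed
  ultimately show ?thesis using that p \<open>p = M\<close> by blast
qed

definition query_cost :: "nat \<Rightarrow> nat" where
  "query_cost L = block_len query_start + (6 * L + 5) * com_len (Until (field (Rg 34) 0) (Rg 0) query_block) + block_len query_finish"

lemma sems_query_coms:
  assumes sw: "swept s V M \<sigma>" and ln: "linked (length V) M \<sigma>" and xy: "\<sigma> 0 = x" "\<sigma> 1 = y"
    and V: "2 \<le> length V" and win: "t_start V \<le> x" "x < y" "y \<le> t_end V" and L: "M < 2 ^ L"
  obtains t \<sigma>' where "sems query_coms \<sigma> t \<sigma>'" "t \<le> query_cost L"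
    "hotspot_weight s V x y / 2 \<le> weight V x y (square s (\<sigma>' 0, \<sigma>' 1))"
proof -
  let ?n = "length V"
  have n: "1 \<le> ?n" using V by simp
  define l where "l k = \<sigma> (slot ?n k 0)" for k
  have l0: "l 0 = t_start V" using sw unfolding swept_def l_def by blast
  have mono: "l i \<le> l j" if "i \<le> j" "j \<le> M" for i j
    using swept_mono[OF sw that] by (simp add: l_def)
  obtain \<Phi> where \<Phi>: "\<Phi> M \<le> 6 * L + 4" "\<And>i. i \<le> M \<Longrightarrow> \<not> l i \<le> x \<Longrightarrow>
      \<Phi> (if y \<le> l (jmp i) \<or> x \<le> l (jmp i) \<and> l i \<le> y then jmp i else i - 1) < \<Phi> i"
    using query_potential[of M l x y L] mono l0 win L by metis
  define \<sigma>1 where "\<sigma>1 = exec query_start \<sigma>"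
  have 1: "sem (Block query_start) \<sigma> (block_len query_start) \<sigma>1" unfolding \<sigma>1_def by (rule sem.block)
  have e1: "\<sigma>1 = \<sigma>(34 := real M, 35 := 0, 36 := 0, 37 := 0)"
    using sw by (simp add: \<sigma>1_def query_start_def swept_def)
  have h1: "\<sigma>1 (slot ?n k f) = \<sigma> (slot ?n k f)" for k f using n by (simp add: e1)
  define I where "I j \<sigma>' \<longleftrightarrow> (\<exists>i. j = \<Phi> i \<and> answer_inv s V M x y i \<sigma>' \<and> (\<forall>k f. \<sigma>' (slot ?n k f) = \<sigma> (slot ?n k f)))"
    for j \<sigma>'
  have "answer_inv s V M x y M \<sigma>1"
    unfolding answer_inv_def
  proof (intro conjI)
    show "swept s V M \<sigma>1" using h1 by (intro swept_cong[OF sw]) (simp_all add: e1)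
    show "linked ?n M \<sigma>1" using h1 by (rule linked_cong[OF ln])
    show "\<sigma>1 0 = x" "\<sigma>1 1 = y" unfolding e1 using xy by simp_all
    show "\<sigma>1 35 \<le> weight V x y (square s (\<sigma>1 36, \<sigma>1 37))"
      using weight_nonneg[OF win(2)] by (simp add: e1)
  qed (simp_all add: e1)
  then have "I (\<Phi> M) \<sigma>1" unfolding I_def using h1 by blast
  then obtain t2 \<sigma>2 j2 where 2: "sem (Until (field (Rg 34) 0) (Rg 0) query_block) \<sigma>1 t2 \<sigma>2"
    "t2 \<le> Suc (\<Phi> M) * com_len (Until (field (Rg 34) 0) (Rg 0) query_block)"
    "I j2 \<sigma>2" "ev (field (Rg 34) 0) \<sigma>2 \<le> ev (Rg 0) \<sigma>2"
  proof (rule exE[OF sem_Until[where I = I]])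
    fix j \<sigma>' assume "I j \<sigma>'" and run: "\<not> ev (field (Rg 34) 0) \<sigma>' \<le> ev (Rg 0) \<sigma>'"
    then obtain i where i: "j = \<Phi> i" "answer_inv s V M x y i \<sigma>'" "\<And>k f. \<sigma>' (slot ?n k f) = \<sigma> (slot ?n k f)"
      unfolding I_def by blast
    have "\<sigma>' 0 = x" "\<sigma>' 34 = real i" "i \<le> M" "\<sigma>' 4 = 256 * real ?n"
      using i(2) unfolding answer_inv_def swept_def by blast+
    then have out: "\<not> \<sigma>' (slot ?n i 0) \<le> x" using run slot_addr_slot[OF n] by simp
    have l': "l k = \<sigma>' (slot ?n k 0)" for k by (simp add: l_def i(3))
    note st = query_step[OF i(2) out V win(1,2) l']
    have "\<not> l i \<le> x" using out by (simp add: l')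
    from \<Phi>(2)[OF \<open>i \<le> M\<close> this] st i(3) show "\<exists>i<j. I i (exec query_block \<sigma>')"
      unfolding I_def i(1) by auto
  qed (use that in blast)
  then obtain i where i: "answer_inv s V M x y i \<sigma>2" "\<And>k f. \<sigma>2 (slot ?n k f) = \<sigma> (slot ?n k f)"
    unfolding I_def by blast
  note J = i(1)[unfolded answer_inv_def i(2)]
  have iM: "i \<le> M" and li: "l i \<le> x"
  proof -
    show "i \<le> M" using J by blast
    have "\<sigma>2 0 = x" "\<sigma>2 34 = real i" "\<sigma>2 4 = 256 * real ?n" using J unfolding swept_def by blast+
    then show "l i \<le> x" using 2(4) slot_addr_slot[OF n] i(2) by (simp add: l_def)
  qed
  define \<sigma>3 where "\<sigma>3 = exec query_finish \<sigma>2"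
  have 3: "sem (Block query_finish) \<sigma>2 (block_len query_finish) \<sigma>3" unfolding \<sigma>3_def by (rule sem.block)
  have e3: "\<sigma>3 0 = \<sigma>2 36" "\<sigma>3 1 = \<sigma>2 37" by (simp_all add: \<sigma>3_def query_finish_def)
  have "hotspot_weight s V x y / 2 \<le> \<sigma>2 35"
  proof (rule half_of_hotspot[of M l, OF _ l0 _ _ _ _ win])
    show "0 < M" "l M = t_end V" using sw unfolding swept_def l_def by blast+
    show "good_record s V (l k) (l (Suc k)) (\<sigma> (slot ?n k 1)) (\<sigma> (slot ?n k 2)) (\<sigma> (slot ?n k 3))
      (\<sigma> (slot ?n k 4)) (\<sigma> (slot ?n k 5))" if "k < M" for k
      using sw that unfolding swept_def l_def by blast
    show p: "0 \<le> \<sigma>2 35" using J by blast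
    show "clip x y (l k) (l (Suc k)) (\<sigma> (slot ?n k 1)) \<le> \<sigma>2 35" if "k < M" for k
    proof (cases "i \<le> k")
      case True
      then show ?thesis using J that unfolding l_def by blast
    next
      case False
      \<comment> \<open>Records that the walk did not reach end no later than the window
        begins.\<close>
      then have "l (Suc k) \<le> x" using mono[of "Suc k" i] iM li by simp
      then have "clip x y (l k) (l (Suc k)) (\<sigma> (slot ?n k 1)) \<le> 0" by (auto simp: clip_def min_def max_def)
      then show ?thesis using p by simp
    qed
  qed
  also have "\<dots> \<le> weight V x y (square s (\<sigma>3 0, \<sigma>3 1))" unfolding e3 using J by blast
  finally have "hotspot_weight s V x y / 2 \<le> weight V x y (square s (\<sigma>3 0, \<sigma>3 1))" .
  moreover have "sems query_coms \<sigma> (block_len query_start + (t2 + (block_len query_finish + 0))) \<sigma>3"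
    unfolding query_coms_def by (rule sems.Cons[OF 1 sems.Cons[OF 2(1) sems.Cons[OF 3 sems.Nil]]])
  moreover have "block_len query_start + (t2 + (block_len query_finish + 0)) \<le> query_cost L"
  proof -
    have "Suc (\<Phi> M) \<le> 6 * L + 5" using \<Phi>(1) by simp
    from mult_le_mono1[OF this] 2(2) have "t2 \<le> (6 * L + 5) * com_len (Until (field (Rg 34) 0) (Rg 0) query_block)"
      using le_trans by blast
    then show ?thesis unfolding query_cost_def by simp
  qed
  ultimately show ?thesis using that by blast
qed

text \<open>The number of records is at most \<open>2 * n\<close>. The least power of two above this
  is at most \<open>4 * n\<close>, hence at most \<open>n ^ 3\<close> for \<open>n \<ge> 2\<close>,
  which explains the factor 3.\<close>

lemma exp_above:
  assumes "2 \<le> n"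
  obtains L :: nat where "2 * n < 2 ^ L" "real L * ln 2 \<le> 3 * ln (real n)"
proof
  define L where "L = Suc (floor_log (2 * n))"
  show "2 * n < 2 ^ L" unfolding L_def using floor_log_exp2_gt[of "2 * n"] assms by simp
  have "(2::real) ^ L \<le> 4 * real n"
  proof -
    have "2 ^ floor_log (2 * n) \<le> 2 * n" using floor_log_exp2_le[of "2 * n"] assms by simp
    then have "2 ^ L \<le> 4 * n" by (simp add: L_def)
    then have "real (2 ^ L) \<le> real (4 * n)" by (simp only: of_nat_le_iff)
    then show ?thesis by simp
  qed
  also have "\<dots> \<le> real n ^ 3"
  proof -
    have "4 \<le> real n ^ 2" using power_mono[of 2 "real n" 2] assms by simp
    then have "4 * real n \<le> real n ^ 2 * real n" by (intro mult_right_mono) auto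
    then show ?thesis by (simp add: power_numeral_reduce)
  qed
  finally have "ln ((2::real) ^ L) \<le> ln (real n ^ 3)" using assms by (subst ln_le_cancel_iff) auto
  then show "real L * ln 2 \<le> 3 * ln (real n)" using assms by (simp add: ln_realpow)
qed

text \<open>The cost is linear in \<open>z\<close>, the binary logarithm of \<open>n\<close>. The
  square only enters through \<open>z \<le> z\<^sup>2\<close>, which holds because
  \<open>n \<ge> 2\<close> gives \<open>z \<ge> 1\<close>.\<close>

lemma query_cost_log:
  assumes "2 \<le> n" "real L * ln 2 \<le> 3 * ln (real n)"
  shows "real (query_cost L) \<le> real (3 * query_cost 1) / (ln 2)\<^sup>2 * (ln (real n))\<^sup>2"
proof -
  define z where "z = ln (real n) / ln 2"
  have z: "1 \<le> z" using assms(1) by (simp add: z_def)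
  have L: "real L \<le> 3 * z" using assms(2) by (simp add: z_def field_simps)
  define C where "C = com_len (Until (field (Rg 34) 0) (Rg 0) query_block)"
  define A where "A = block_len query_start + block_len query_finish"
  have q: "query_cost k = A + (6 * k + 5) * C" for k by (simp add: query_cost_def A_def C_def)
  have "real (query_cost L) = real A + (6 * real L + 5) * real C" by (simp add: q)
  \<comment> \<open>33 is three times \<open>6 + 5\<close>, chosen so that the sum is exactly
    \<open>3 * query_cost 1\<close> times \<open>z\<close>.\<close>
  also have "\<dots> \<le> 3 * real A * z + (33 * z) * real C"
  proof (intro add_mono mult_right_mono)
    show "real A \<le> 3 * real A * z" using z mult_left_mono[of 1 z "3 * real A"] by simp
    show "6 * real L + 5 \<le> 33 * z" using L z by simp
  qed simp
  also have "\<dots> = real (3 * query_cost 1) * z" by (simp add: q algebra_simps)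
  also have "\<dots> \<le> real (3 * query_cost 1) * z\<^sup>2"
    using z by (intro mult_left_mono self_le_power) auto
  also have "\<dots> = real (3 * query_cost 1) / (ln 2)\<^sup>2 * (ln (real n))\<^sup>2"
    by (simp add: z_def power_divide)
  finally show ?thesis .
qed

lemma code_at_whole: "code_at P 0 P"
  by (simp add: code_at_def)

text \<open>The side length occurs only in the preprocessing program, as a constant; the query
  program is the same for every \<open>s\<close>. The maximum of the two cost constants serves both
  time bounds.\<close>

theorem theorem3:
  fixes s :: real
  assumes "s > 0"
  shows "\<exists>(Pre :: instr list) (Qry :: instr list) (c :: real).
    \<forall>V :: trajectory. valid_traj V \<and> length V \<ge> 2 \<longrightarrow>
      (\<exists>D. halts_within Pre (c * real (length V)) (encode_traj V) D \<and>
        (\<forall>x y. t_start V \<le> x \<and> x < y \<and> y \<le> t_end V \<longrightarrow>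
          (\<exists>m'. halts_within Qry (c * (ln (real (length V)))^2) (D(0 := x, 1 := y)) m' \<and>
                weight V x y (square s (m' 0, m' 1)) \<ge> hotspot_weight s V x y / 2)))"
proof (rule exI[of _ "pre_code s"], rule exI[of _ query_code],
    rule exI[of _ "max (real (pre_cost s)) (real (3 * query_cost 1) / (ln 2)\<^sup>2)"], intro allI impI)
  let ?c = "max (real (pre_cost s)) (real (3 * query_cost 1) / (ln 2)\<^sup>2)"
  fix V :: trajectory
  assume "valid_traj V \<and> length V \<ge> 2"
  then have V: "valid_traj V" "2 \<le> length V" by auto
  let ?n = "length V" and ?S = "length (save_code 128)"
  have code: "code_at (pre_code s) 0 (save_code 128)" "code_at (pre_code s) ?S (comp_prog (pre_coms s) ?S)"
    using code_at_whole[of "pre_code s"] by (subst (asm) (2) pre_code_def; simp add: code_at_append)+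
  have "encode_traj V 0 = real ?n" by (simp add: encode_traj_def)
  then obtain m1 where m1: "runs (pre_code s) ?S 0 (encode_traj V) ?S m1" "m1 0 = 128 * real ?n + real 128 - 2"
    "\<And>a. m1 a = (if a = 0 then 128 * real ?n + real 128 - 2 else if a = 1 then 1
       else if 128 * ?n \<le> a \<and> a < 128 * ?n + 128 - 1 then encode_traj V (a - 128 * ?n + 1) else encode_traj V a)"
    using runs_save_code[OF code(1) _ _ _ V(2)] by auto
  have "input_saved V m1" using input_saved_code[OF V(2) m1(3)] .
  moreover have "m1 0 = 128 * real ?n + 126" using m1(2) by simp
  ultimately obtain t \<sigma> M where t: "sems (pre_coms s) m1 t \<sigma>" "t + ?S \<le> pre_cost s * ?n"
    and \<sigma>: "swept s V M \<sigma>" "linked ?n M \<sigma>"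
    by (rule sems_pre_coms[OF V assms])
  have "agree m1 m1" by (simp add: agree_def)
  then obtain pc D where D: "runs (pre_code s) t ?S m1 pc D" "pc < length (pre_code s)" "pre_code s ! pc = Halt"
    "agree D \<sigma>"
    using comp_prog_correct[OF t(1) code(2) wf_pre_coms] by blast
  have "real (?S + t) \<le> ?c * real ?n"
  proof -
    have "real (?S + t) \<le> real (pre_cost s * ?n)" using t(2) by (simp only: of_nat_le_iff add.commute)
    also have "\<dots> \<le> ?c * real ?n" unfolding of_nat_mult by (intro mult_right_mono) auto
    finally show ?thesis .
  qed
  then have "halts_within (pre_code s) (?c * real ?n) (encode_traj V) D"
    using halts_withinI[OF runs_trans[OF m1(1) D(1)] D(2,3)] by blast
  moreover have "\<exists>m'. halts_within query_code (?c * (ln (real ?n))\<^sup>2) (D(0 := x, 1 := y)) m' \<and>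
      weight V x y (square s (m' 0, m' 1)) \<ge> hotspot_weight s V x y / 2"
    if xy: "t_start V \<le> x \<and> x < y \<and> y \<le> t_end V" for x y
  proof -
    obtain L where L: "2 * ?n < 2 ^ L" "real L * ln 2 \<le> 3 * ln (real ?n)" using exp_above[OF V(2)] .
    define \<sigma>0 where "\<sigma>0 = \<sigma>(0 := x, 1 := y)"
    \<comment> \<open>The window overwrites cells 0 and 1 only; the records lie from
      \<open>256 * n\<close> on, and their base and number are kept in cells 4 and 5.\<close>
    have heap: "\<sigma>0 (slot ?n k f) = \<sigma> (slot ?n k f)" for k f using V(2) by (simp add: \<sigma>0_def)
    have "swept s V M \<sigma>0" "linked ?n M \<sigma>0" "\<sigma>0 0 = x" "\<sigma>0 1 = y"
      using swept_cong[OF \<sigma>(1), of \<sigma>0] linked_cong[OF \<sigma>(2), of \<sigma>0] heap by (simp_all add: \<sigma>0_def)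
    moreover have "M < 2 ^ L" using \<sigma>(1) L(1) unfolding swept_def by linarith
    ultimately obtain u \<sigma>' where u: "sems query_coms \<sigma>0 u \<sigma>'" "u \<le> query_cost L"
      "hotspot_weight s V x y / 2 \<le> weight V x y (square s (\<sigma>' 0, \<sigma>' 1))"
      using sems_query_coms[of s V M \<sigma>0 x y L] V(2) xy by blast
    have "agree (D(0 := x, 1 := y)) \<sigma>0" using D(4) by (simp add: agree_def \<sigma>0_def)
    then obtain pc' m' where m': "runs query_code u 0 (D(0 := x, 1 := y)) pc' m'" "pc' < length query_code"
      "query_code ! pc' = Halt" "agree m' \<sigma>'"
      using comp_prog_correct[OF u(1) _ wf_query_coms, of query_code 0] code_at_whole[of query_code]
      unfolding query_code_def by blast
    have "real u \<le> real (query_cost L)" using u(2) by simp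
    also have "\<dots> \<le> real (3 * query_cost 1) / (ln 2)\<^sup>2 * (ln (real ?n))\<^sup>2" by (rule query_cost_log[OF V(2) L(2)])
    also have "\<dots> \<le> ?c * (ln (real ?n))\<^sup>2" by (intro mult_right_mono) auto
    finally have "halts_within query_code (?c * (ln (real ?n))\<^sup>2) (D(0 := x, 1 := y)) m'"
      by (rule halts_withinI[OF m'(1-3)])
    moreover have "m' 0 = \<sigma>' 0" "m' 1 = \<sigma>' 1" using m'(4) by (simp_all add: agree_def)
    ultimately show ?thesis using u(3) by auto
  qed
  ultimately show "\<exists>D. halts_within (pre_code s) (?c * real ?n) (encode_traj V) D \<and>
        (\<forall>x y. t_start V \<le> x \<and> x < y \<and> y \<le> t_end V \<longrightarrow>
          (\<exists>m'. halts_within query_code (?c * (ln (real ?n))^2) (D(0 := x, 1 := y)) m' \<and>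
                weight V x y (square s (m' 0, m' 1)) \<ge> hotspot_weight s V x y / 2))"
    by blast
qed

end
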